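(* There exists a divergence-free vector field $u\in B^{1/3}_{3,\infty}(\mathbb R^3)\cap L^2(\mathbb R^3)$ whose energy flux is asymptotically bounded from below by a positive constant, i.e. $$\liminf_{Q\to\infty}\Pi_Q>0 .$$
   Context: Littlewood-Paley notation. $\lambda_q=2^q$. Fix a nonnegative radial $\chi\in C_0^\infty(B(0,1))$ on $\mathbb R^3$ with $\chi(\xi)=1$ for $|\xi|\le 1/2$, and let $\varphi(\xi)=\chi(\xi/2)-\chi(\xi)$. With $\mathcal F$ the Fourier transform, $\Delta_q u=\mathcal F^{-1}(\varphi(\lambda_q^{-1}\xi)\mathcal F u)$ for $q\ge 0$, $\Delta_{-1}u=\mathcal F^{-1}(\chi(\xi)\mathcal F u)$, and $S_Q=\sum_{q=-1}^{Q}\Delta_q$, so $S_Qu=\mathcal F^{-1}(\chi(\lambda_{Q+1}^{-1}\xi)\mathcal F u)$. $B^{1/3}_{3,\infty}(\mathbb R^3)$ is the space of tempered distributions with finite norm $\|\Delta_{-1}u\|_{L^3}+\sup_{q\ge0}\lambda_q^{1/3}\|\Delta_qu\|_{L^3}$. Energy flux at wave number $\lambda_Q$ of a divergence-free $u\in L^2(\mathbb R^3)$: $\Pi_Q=\int_{\mathbb R^3}\mathrm{Tr}[S_Q(u\otimes u)\cdot\nabla S_Qu]\,dx=\int_{\mathbb R^3}\sum_{i,j}S_Q(u_iu_j)\,\partial_i S_Qu_j\,dx$. *)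

theory Defs
  imports "HOL-Analysis.Analysis"
begin

section \<open>Smooth functions, Schwartz functions and tempered distributions on \<open>\<real>\<^sup>3\<close>\<close>

definition partial_deriv ::
    "3 \<Rightarrow> (real^3 \<Rightarrow> 'b::real_normed_vector) \<Rightarrow> real^3 \<Rightarrow> 'b" where
  "partial_deriv i f x = frechet_derivative f (at x) (axis i 1)"

definition partial_derivs ::
    "3 list \<Rightarrow> (real^3 \<Rightarrow> 'b::real_normed_vector) \<Rightarrow> real^3 \<Rightarrow> 'b" where
  "partial_derivs is f = foldr partial_deriv is f"

text \<open>Frechet differentiability of all iterated partial derivatives includes their continuity,
  so this is \<open>C\<^sup>\<infinity>\<close>.\<close>

definition smooth :: "(real^3 \<Rightarrow> 'b::real_normed_vector) \<Rightarrow> bool" where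
  "smooth f \<longleftrightarrow> (\<forall>is x. partial_derivs is f differentiable (at x))"

definition schwartz :: "(real^3 \<Rightarrow> complex) \<Rightarrow> bool" where
  "schwartz f \<longleftrightarrow> smooth f \<and>
     (\<forall>k is. bdd_above (range (\<lambda>x. norm x ^ k * norm (partial_derivs is f x))))"

definition schwartz_seminorm :: "nat \<Rightarrow> 3 list \<Rightarrow> (real^3 \<Rightarrow> complex) \<Rightarrow> real" where
  "schwartz_seminorm k is f = (SUP x. norm x ^ k * norm (partial_derivs is f x))"

text \<open>A distribution is a functional on all functions \<open>\<real>\<^sup>3 \<rightarrow> \<complex>\<close> of which only the values at Schwartz
  functions are meaningful.\<close>

type_synonym distr = "(real^3 \<Rightarrow> complex) \<Rightarrow> complex"

definition tempered :: "distr \<Rightarrow> bool" where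
  "tempered T \<longleftrightarrow>
     (\<forall>f g. schwartz f \<longrightarrow> schwartz g \<longrightarrow> T (\<lambda>x. f x + g x) = T f + T g) \<and>
     (\<forall>c f. schwartz f \<longrightarrow> T (\<lambda>x. c * f x) = c * T f) \<and>
     (\<exists>C N. \<forall>f. schwartz f \<longrightarrow>
        norm (T f) \<le> C * (\<Sum>k\<le>N. \<Sum>is | length is \<le> N. schwartz_seminorm k is f))"

definition distr_of :: "(real^3 \<Rightarrow> complex) \<Rightarrow> distr" where
  "distr_of g f = (LINT x|lborel. g x * f x)"

definition represents :: "(real^3 \<Rightarrow> complex) \<Rightarrow> distr \<Rightarrow> bool" where
  "represents g T \<longleftrightarrow>
     (\<forall>f. schwartz f \<longrightarrow> integrable lborel (\<lambda>x. g x * f x) \<and> T f = distr_of g f)"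

text \<open>The function to which a distribution given by a smooth function is identified; every
  distribution with compactly supported Fourier transform is of this kind.\<close>

definition smooth_rep :: "distr \<Rightarrow> real^3 \<Rightarrow> complex" where
  "smooth_rep T = (THE g. smooth g \<and> represents g T)"

definition distr_deriv :: "3 \<Rightarrow> distr \<Rightarrow> distr" where
  "distr_deriv i T f = - T (partial_deriv i f)"

section \<open>Fourier transform\<close>

definition fourier :: "(real^3 \<Rightarrow> complex) \<Rightarrow> real^3 \<Rightarrow> complex" where
  "fourier f \<xi> = (LINT x|lborel. cis (- (x \<bullet> \<xi>)) * f x)"

definition inv_fourier :: "(real^3 \<Rightarrow> complex) \<Rightarrow> real^3 \<Rightarrow> complex" where
  "inv_fourier f x = (LINT \<xi>|lborel. cis (x \<bullet> \<xi>) * f \<xi>) / (2 * pi) ^ 3"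

definition distr_fourier :: "distr \<Rightarrow> distr" where
  "distr_fourier T f = T (fourier f)"

definition distr_inv_fourier :: "distr \<Rightarrow> distr" where
  "distr_inv_fourier T f = T (inv_fourier f)"

definition distr_mult :: "(real^3 \<Rightarrow> real) \<Rightarrow> distr \<Rightarrow> distr" where
  "distr_mult m T f = T (\<lambda>\<xi>. m \<xi> * f \<xi>)"

definition multiplier :: "(real^3 \<Rightarrow> real) \<Rightarrow> distr \<Rightarrow> distr" where
  "multiplier m T = distr_inv_fourier (distr_mult m (distr_fourier T))"

section \<open>Littlewood-Paley decomposition\<close>

definition lp_cutoff :: "(real^3 \<Rightarrow> real) \<Rightarrow> bool" where
  "lp_cutoff chi \<longleftrightarrow>
     smooth chi \<and> closure {\<xi>. chi \<xi> \<noteq> 0} \<subseteq> ball 0 1 \<and>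
     (\<forall>\<xi>. chi \<xi> \<ge> 0) \<and> (\<forall>\<xi> \<eta>. norm \<xi> = norm \<eta> \<longrightarrow> chi \<xi> = chi \<eta>) \<and>
     (\<forall>\<xi>. norm \<xi> \<le> 1/2 \<longrightarrow> chi \<xi> = 1)"

definition lp_freq :: "int \<Rightarrow> real" where
  "lp_freq q = 2 powi q"

definition lp_phi :: "(real^3 \<Rightarrow> real) \<Rightarrow> real^3 \<Rightarrow> real" where
  "lp_phi chi \<xi> = chi (\<xi> /\<^sub>R 2) - chi \<xi>"

text \<open>Only indices \<open>q \<ge> -1\<close> are used.\<close>

definition lp_symbol :: "(real^3 \<Rightarrow> real) \<Rightarrow> int \<Rightarrow> real^3 \<Rightarrow> real" where
  "lp_symbol chi q \<xi> = (if q = -1 then chi \<xi> else lp_phi chi (\<xi> /\<^sub>R lp_freq q))"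

definition lp_block :: "(real^3 \<Rightarrow> real) \<Rightarrow> int \<Rightarrow> distr \<Rightarrow> distr" where
  "lp_block chi q T = multiplier (lp_symbol chi q) T"

definition lp_sum :: "(real^3 \<Rightarrow> real) \<Rightarrow> int \<Rightarrow> distr \<Rightarrow> distr" where
  "lp_sum chi Q T f = (\<Sum>q = -1..Q. lp_block chi q T f)"

lemma sum_lp_symbol:
  "(\<Sum>q = -1..int n - 1. lp_symbol chi q \<xi>) = chi (\<xi> /\<^sub>R lp_freq (int n))"
proof (induction n)
  case 0
  show ?case by (simp add: lp_symbol_def lp_freq_def)
next
  case (Suc n)
  have eq: "{-1..int (Suc n) - 1} = insert (int n) {-1..int n - 1}"
    by auto
  have "lp_symbol chi (int n) \<xi> = chi (\<xi> /\<^sub>R lp_freq (int (Suc n))) - chi (\<xi> /\<^sub>R lp_freq (int n))"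
    by (simp add: lp_symbol_def lp_phi_def lp_freq_def power_int_add mult.commute)
  with Suc show ?case by (simp add: eq del: of_nat_Suc)
qed

section \<open>Lebesgue and Besov spaces\<close>

definition in_Lp :: "real \<Rightarrow> (real^3 \<Rightarrow> 'b::euclidean_space) \<Rightarrow> bool" where
  "in_Lp p f \<longleftrightarrow>
     f \<in> borel_measurable lborel \<and> integrable lborel (\<lambda>x. norm (f x) powr p)"

definition Lp_norm :: "real \<Rightarrow> (real^3 \<Rightarrow> 'b::euclidean_space) \<Rightarrow> real" where
  "Lp_norm p f = (LINT x|lborel. norm (f x) powr p) powr (1 / p)"

text \<open>The representing \<open>L\<^sup>p\<close> function is unique almost everywhere, so the infimum is over at most one
  value; it is \<open>\<infinity>\<close> if the distribution is not given by an \<open>L\<^sup>p\<close> function.\<close>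

definition distr_Lp_norm :: "real \<Rightarrow> distr \<Rightarrow> ennreal" where
  "distr_Lp_norm p T = (INF g \<in> {g. in_Lp p g \<and> represents g T}. ennreal (Lp_norm p g))"

text \<open>The norm and the space \<open>B\<^sup>s\<^bsub>p,\<infinity>\<^esub>\<close>.\<close>

definition besov_norm :: "(real^3 \<Rightarrow> real) \<Rightarrow> real \<Rightarrow> real \<Rightarrow> distr \<Rightarrow> ennreal" where
  "besov_norm chi s p T =
     distr_Lp_norm p (lp_block chi (-1) T) +
     (SUP q\<in>{0..}. ennreal (lp_freq q powr s) * distr_Lp_norm p (lp_block chi q T))"

definition besov :: "(real^3 \<Rightarrow> real) \<Rightarrow> real \<Rightarrow> real \<Rightarrow> distr set" where
  "besov chi s p = {T. tempered T \<and> besov_norm chi s p T < \<infinity>}"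

section \<open>Vector fields and energy flux\<close>

definition comp_distr :: "(real^3 \<Rightarrow> real^3) \<Rightarrow> 3 \<Rightarrow> distr" where
  "comp_distr u i = distr_of (\<lambda>x. complex_of_real (u x $ i))"

definition tensor_distr :: "(real^3 \<Rightarrow> real^3) \<Rightarrow> 3 \<Rightarrow> 3 \<Rightarrow> distr" where
  "tensor_distr u i j = distr_of (\<lambda>x. complex_of_real (u x $ i * u x $ j))"

definition divergence_free :: "(real^3 \<Rightarrow> real^3) \<Rightarrow> bool" where
  "divergence_free u \<longleftrightarrow>
     (\<forall>f. schwartz f \<longrightarrow> (\<Sum>i\<in>UNIV. distr_deriv i (comp_distr u i) f) = 0)"

text \<open>The integrand is real because \<open>chi\<close> is radial, hence even; \<open>Re\<close> only adjusts the type.\<close>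

definition energy_flux :: "(real^3 \<Rightarrow> real) \<Rightarrow> (real^3 \<Rightarrow> real^3) \<Rightarrow> int \<Rightarrow> real" where
  "energy_flux chi u Q = Re (LINT x|lborel. (\<Sum>i\<in>UNIV. \<Sum>j\<in>UNIV.
     smooth_rep (lp_sum chi Q (tensor_distr u i j)) x *
     partial_deriv i (smooth_rep (lp_sum chi Q (comp_distr u j))) x))"

end

theory Submission
  imports Defs
begin

text \<open>The field is \<open>u(x) = sum over a \<ge> 0 of 2\<^bsup>2a/3\<^esup> v(2\<^sup>a x)\<close> with one solenoidal Schwartz field \<open>v\<close>: by scaling,
  every dyadic level contributes the same amount to the \<open>B\<^sup>1\<^sup>/\<^sup>3\<^bsub>3,\<infinity>\<^esub>\<close> norm and to the flux. The Fourier transform of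
  \<open>v\<close> lives in small balls around vectors of a common length slightly below \<open>1\<close>, where the cutoff already
  vanishes, while it is \<open>1\<close> at half that length; so the Littlewood-Paley operators pick out the levels exactly,
  whatever the cutoff does in between. Because low-low interactions cancel by incompressibility, the flux
  through level \<open>Q\<close> only involves triads of wave vectors with a high partner. The wave vectors and the
  symmetry types of the three modes of \<open>v\<close> leave a single resonant triad, between levels \<open>Q + 1\<close>, \<open>Q + 1\<close>
  and \<open>Q\<close>; its contribution is independent of \<open>Q\<close> and is a Fourier integral with nonnegative integrand.\<close>


section \<open>Smooth functions\<close>

text \<open>The obstacle is nonlocal interaction: two nearly opposite wave vectors of comparable
  size with one arbitrarily lower partner. The number of such triads crossing a level grows with
  \<open>Q\<close>, and nothing controls their sign. Nearly opposite wave vectors belong to the same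
  mode, so it is enough that no mode meets itself. Assigning to three modes the three nontrivial
  characters of a group of two commuting reflections achieves this by symmetry alone, and no
  remainder has to be estimated.

  The exponent 2/3 is fixed by the flux: three amplitudes \<open>2^(2a/3)\<close>, one derivative
  \<open>2^a\<close> and the volume factor \<open>8^(-a)\<close> multiply to 1. The same exponent
  halves the cube of the \<open>L^3\<close> norm from one level to the next, which is exactly the
  Besov scale, while the \<open>L^1\<close> and \<open>L^2\<close> norms decay geometrically. At the
  origin the levels grow like \<open>2^(2a/3)\<close> times a constant, so pointwise statements
  about the series exclude this null point.\<close>

lemma partial_derivs_simps [simp]:
  "partial_derivs [] f = f"
  "partial_derivs (i # ks) f = partial_deriv i (partial_derivs ks f)"
  by (simp_all add: partial_derivs_def)

lemma partial_derivs_append: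
  "partial_derivs (ks @ ls) f = partial_derivs ks (partial_derivs ls f)"
  by (simp add: partial_derivs_def)

lemma partial_deriv_eqI:
  "(f has_derivative D) (at x) \<Longrightarrow> partial_deriv i f x = D (axis i 1)"
  unfolding partial_deriv_def by (metis frechet_derivative_at)

text \<open>The useful classes \<open>P\<close> consist of functions of a form that differentiation
  reproduces, such as inverse transforms of integrable symbols of bounded support. Closure of the
  class then replaces an induction over derivative lists in each later proof.\<close>

lemma smooth_coinduct:
  assumes "P f" and "\<And>g x. P g \<Longrightarrow> g differentiable (at x)"
    and "\<And>g i. P g \<Longrightarrow> P (partial_deriv i g)"
  shows "smooth f"
proof -
  have "P (partial_derivs ks f)" for ks
    by (induction ks) (auto simp: assms)
  then show ?thesis
    using assms(2) by (auto simp: smooth_def)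
qed

lemma smooth_differentiable: "smooth f \<Longrightarrow> f differentiable (at x)"
  unfolding smooth_def by (metis partial_derivs_simps(1))

lemma smooth_partial_deriv: "smooth f \<Longrightarrow> smooth (partial_deriv i f)"
  unfolding smooth_def
  by (metis partial_derivs_append partial_derivs_simps)

lemma smooth_continuous: "smooth f \<Longrightarrow> continuous_on UNIV f"
  by (meson continuous_at_imp_continuous_on differentiable_imp_continuous_within smooth_differentiable)

lemma smooth_measurable: "smooth f \<Longrightarrow> f \<in> borel_measurable borel"
  by (simp add: borel_measurable_continuous_onI smooth_continuous)

lemma partial_deriv_add:
  assumes "f differentiable (at x)" "g differentiable (at x)"
  shows "partial_deriv i (\<lambda>x. f x + g x) x = partial_deriv i f x + partial_deriv i g x"
proof -
  obtain D E where D: "(f has_derivative D) (at x)" and E: "(g has_derivative E) (at x)"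
    using assms by (auto simp: differentiable_def)
  show ?thesis
    using partial_deriv_eqI[OF has_derivative_add[OF D E]]
    by (simp add: partial_deriv_eqI[OF D] partial_deriv_eqI[OF E])
qed

lemma partial_deriv_bounded_linear:
  assumes "bounded_linear L" "f differentiable (at x)"
  shows "partial_deriv i (\<lambda>x. L (f x)) x = L (partial_deriv i f x)"
  using assms
  by (auto simp: differentiable_def partial_deriv_eqI dest: bounded_linear.has_derivative)

lemma partial_deriv_affine:
  assumes "\<And>x. f differentiable (at x)"
  shows "partial_deriv i (\<lambda>x. f (d + c *\<^sub>R x)) x = c *\<^sub>R partial_deriv i f (d + c *\<^sub>R x)"
proof -
  obtain D where D: "(f has_derivative D) (at (d + c *\<^sub>R x))"
    using assms by (auto simp: differentiable_def)
  have "((\<lambda>x. f (d + c *\<^sub>R x)) has_derivative (\<lambda>y. D (c *\<^sub>R y))) (at x)"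
    by (rule has_derivative_compose[of "\<lambda>x. d + c *\<^sub>R x" "\<lambda>y. c *\<^sub>R y" x UNIV f D])
       (use D in \<open>auto intro!: derivative_eq_intros\<close>)
  then have "partial_deriv i (\<lambda>x. f (d + c *\<^sub>R x)) x = D (c *\<^sub>R axis i 1)"
    by (rule partial_deriv_eqI)
  also have "\<dots> = c *\<^sub>R D (axis i 1)"
    using D by (meson bounded_linear.linear has_derivative_bounded_linear linear_scale)
  finally show ?thesis
    by (simp add: partial_deriv_eqI[OF D])
qed

lemma smooth_add:
  assumes "smooth f" "smooth g"
  shows "smooth (\<lambda>x. f x + g x)"
proof (rule smooth_coinduct[where P = "\<lambda>h. \<exists>f g. smooth f \<and> smooth g \<and> h = (\<lambda>x. f x + g x)"])
  fix h :: "real^3 \<Rightarrow> 'a" and i x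
  assume "\<exists>f g. smooth f \<and> smooth g \<and> h = (\<lambda>x. f x + g x)"
  then obtain f g where fg: "smooth f" "smooth g" "h = (\<lambda>x. f x + g x)" by blast
  show "h differentiable at x"
    unfolding fg(3) using fg(1,2) by (intro differentiable_add smooth_differentiable)
  have "partial_deriv i h = (\<lambda>x. partial_deriv i f x + partial_deriv i g x)"
    using fg by (auto simp: partial_deriv_add smooth_differentiable)
  then show "\<exists>f g. smooth f \<and> smooth g \<and> partial_deriv i h = (\<lambda>x. f x + g x)"
    using fg smooth_partial_deriv by blast
qed (use assms in blast)

lemma smooth_bounded_linear:
  assumes "bounded_linear L" "smooth f"
  shows "smooth (\<lambda>x. L (f x))"
proof (rule smooth_coinduct[where P = "\<lambda>h. \<exists>f. smooth f \<and> h = (\<lambda>x. L (f x))"])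
  fix h :: "real^3 \<Rightarrow> 'b" and i x
  assume "\<exists>f. smooth f \<and> h = (\<lambda>x. L (f x))"
  then obtain f where f: "smooth f" "h = (\<lambda>x. L (f x))" by blast
  show "h differentiable at x"
    using f assms(1) smooth_differentiable bounded_linear.has_derivative
    unfolding differentiable_def by blast
  have "partial_deriv i h = (\<lambda>x. L (partial_deriv i f x))"
    using f assms(1) by (auto simp: partial_deriv_bounded_linear smooth_differentiable)
  then show "\<exists>f. smooth f \<and> partial_deriv i h = (\<lambda>x. L (f x))"
    using f smooth_partial_deriv by blast
qed (use assms in blast)

lemma smooth_affine:
  assumes "smooth f"
  shows "smooth (\<lambda>x. f (d + c *\<^sub>R x))"
proof (rule smooth_coinduct[where P = "\<lambda>h. \<exists>f. smooth f \<and> h = (\<lambda>x. f (d + c *\<^sub>R x))"])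
  fix h :: "real^3 \<Rightarrow> 'a" and i x
  assume "\<exists>f. smooth f \<and> h = (\<lambda>x. f (d + c *\<^sub>R x))"
  then obtain f where f: "smooth f" "h = (\<lambda>x. f (d + c *\<^sub>R x))" by blast
  have "f differentiable at (d + c *\<^sub>R x)" using f smooth_differentiable by blast
  then show "h differentiable at x"
    unfolding f(2) by (rule differentiable_compose) auto
  have "partial_deriv i h = (\<lambda>x. c *\<^sub>R partial_deriv i f (d + c *\<^sub>R x))"
    using f by (auto simp: partial_deriv_affine smooth_differentiable)
  moreover have "smooth (\<lambda>x. c *\<^sub>R partial_deriv i f x)"
    by (rule smooth_bounded_linear[OF bounded_linear_scaleR_right]) (use f smooth_partial_deriv in blast)
  ultimately show "\<exists>f. smooth f \<and> partial_deriv i h = (\<lambda>x. f (d + c *\<^sub>R x))"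
    by blast
qed (use assms in blast)

lemma smooth_coord_mult:
  assumes "smooth f"
  shows "smooth (\<lambda>x. (x $ j) *\<^sub>R f x)"
\<comment> \<open>The summand \<open>g\<close> makes the class stable: the product rule leaves an
  undifferentiated \<open>f\<close> when \<open>i = j\<close>.\<close>
proof (rule smooth_coinduct[where P = "\<lambda>h. \<exists>f g. smooth f \<and> smooth g \<and> h = (\<lambda>x. (x $ j) *\<^sub>R f x + g x)"])
  have "smooth (\<lambda>x. 0 *\<^sub>R f x)"
    by (rule smooth_bounded_linear[OF bounded_linear_scaleR_right assms])
  then show "\<exists>fa g. smooth fa \<and> smooth g \<and> (\<lambda>x. (x $ j) *\<^sub>R f x) = (\<lambda>x. (x $ j) *\<^sub>R fa x + g x)"
    using assms by (intro exI[of _ f] exI[of _ "\<lambda>x. 0"]) auto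
next
  fix h :: "real^3 \<Rightarrow> 'a" and i x
  assume "\<exists>f g. smooth f \<and> smooth g \<and> h = (\<lambda>x. (x $ j) *\<^sub>R f x + g x)"
  then obtain f g where f: "smooth f" "smooth g" "h = (\<lambda>x. (x $ j) *\<^sub>R f x + g x)" by blast
  have D: "(h has_derivative (\<lambda>y. (x $ j) *\<^sub>R frechet_derivative f (at x) y + (y $ j) *\<^sub>R f x
      + frechet_derivative g (at x) y)) (at x)" for x
    unfolding f(3)
  proof (intro has_derivative_add)
    have "((\<lambda>x. x $ j) has_derivative (\<lambda>y. y $ j)) (at x)"
      by (intro bounded_linear_imp_has_derivative bounded_linear_vec_nth)
    moreover have "(f has_derivative frechet_derivative f (at x)) (at x)"
      using f smooth_differentiable frechet_derivative_works by blast
    ultimately show "((\<lambda>x. (x $ j) *\<^sub>R f x) has_derivative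
        (\<lambda>y. (x $ j) *\<^sub>R frechet_derivative f (at x) y + (y $ j) *\<^sub>R f x)) (at x)"
      by (rule has_derivative_scaleR)
    show "(g has_derivative frechet_derivative g (at x)) (at x)"
      using f smooth_differentiable frechet_derivative_works by blast
  qed
  then show "h differentiable at x" by (auto simp: differentiable_def)
  have "partial_deriv i h x = (x $ j) *\<^sub>R partial_deriv i f x + ((if i = j then 1 else 0) *\<^sub>R f x + partial_deriv i g x)" for x
    unfolding partial_deriv_eqI[OF D] by (simp add: partial_deriv_def axis_def)
  then have "partial_deriv i h = (\<lambda>x. (x $ j) *\<^sub>R partial_deriv i f x + ((if i = j then 1 else 0) *\<^sub>R f x + partial_deriv i g x))"
    by blast
  moreover have "smooth (\<lambda>x. (if i = j then 1 else 0) *\<^sub>R f x + partial_deriv i g x)"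
    using f by (intro smooth_add smooth_bounded_linear[OF bounded_linear_scaleR_right] smooth_partial_deriv) auto
  ultimately show "\<exists>f g. smooth f \<and> smooth g \<and> partial_deriv i h = (\<lambda>x. (x $ j) *\<^sub>R f x + g x)"
    using f smooth_partial_deriv by blast
qed

section \<open>Integration on \<open>\<real>\<^sup>3\<close>\<close>

lemma power_two_cubed: "(2 ^ n) ^ 3 = (8::real) ^ n"
proof -
  have "(2 ^ n) ^ 3 = ((2::real) ^ 3) ^ n" by (simp only: power_mult[symmetric] mult.commute)
  then show ?thesis by simp
qed

text \<open>Dyadic balls replace polar coordinates: the weight \<open>16 / 16^n\<close> against a
  volume proportional to \<open>8^n\<close> leaves a geometric series of ratio 1/2.\<close>

lemma integrable_inverse_power4: "integrable lborel (\<lambda>x::real^3. 1 / (1 + norm x) ^ 4)"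
proof -
  define g where "g n x = 16 / 16 ^ n * (indicator (ball 0 (2 ^ n)) x :: real)" for n and x :: "real^3"
  have g0: "g n x \<ge> 0" for n x by (simp add: g_def)
  have gsum: "summable (\<lambda>n. g n x)" for x
  proof (rule summable_comparison_test')
    show "summable (\<lambda>n. 16 * (1/16::real) ^ n)" by (intro summable_mult summable_geometric) auto
    show "norm (g n x) \<le> 16 * (1/16) ^ n" for n
      by (auto simp: g_def indicator_def power_one_over divide_simps)
  qed
  have int: "integrable lborel (g n)" for n
    unfolding g_def using emeasure_lborel_ball_finite[of 0 "2 ^ n"]
    by (intro integrable_mult_right integrable_real_indicator) (auto simp: less_top)
  have val: "(LINT x|lborel. g n x) = 16 * measure lebesgue (ball (0::real^3) 1) * (1/2) ^ n" for n
  proof -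
    have "(LINT x|lborel. g n x) = 16 / 16 ^ n * measure lborel (ball (0::real^3) (2 ^ n))"
      unfolding g_def by simp
    also have "measure lborel (ball (0::real^3) (2 ^ n)) = (2 ^ n) ^ 3 * measure lebesgue (ball (0::real^3) 1)"
      using content_ball_conv_unit_ball[of "2 ^ n" "0::real^3"] by simp
    also have "(2 ^ n) ^ 3 = (8::real) ^ n" by (rule power_two_cubed)
    also have "16 / 16 ^ n * ((8::real) ^ n * measure lebesgue (ball (0::real^3) 1))
        = 16 * measure lebesgue (ball (0::real^3) 1) * (1 / 2) ^ n"
    proof -
      have "(16::real) ^ n = 8 ^ n * 2 ^ n" by (simp flip: power_mult_distrib)
      then show ?thesis by (simp add: power_divide)
    qed
    finally show ?thesis .
  qed
  have sumint: "integrable lborel (\<lambda>x. \<Sum>n. g n x)"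
  proof (rule integrable_suminf)
    show "AE x in lborel. summable (\<lambda>n. norm (g n x))"
      using gsum g0 by simp
    show "summable (\<lambda>n. LINT x|lborel. norm (g n x))"
      using g0 by (simp add: val summable_mult summable_geometric)
  qed (use int in auto)
  show ?thesis
  proof (rule Bochner_Integration.integrable_bound[OF sumint])
    show "AE x in lborel. norm (1 / (1 + norm x) ^ 4) \<le> norm (\<Sum>n. g n x)"
    proof (rule AE_I2)
      fix x :: "real^3"
      \<comment> \<open>By minimality \<open>2^n / 2 \<le> norm x\<close>, except for
        \<open>n = 0\<close>, where the added 1 gives the bound. The single term of index
        \<open>n\<close> then already dominates.\<close>
      define n where "n = (LEAST n. norm x < 2 ^ n)"
      have n: "norm x < 2 ^ n"
        unfolding n_def by (rule LeastI_ex) (use real_arch_pow[of 2 "norm x"] in auto)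
      have low: "(2 ^ n) / 2 \<le> 1 + norm x"
      proof (cases n)
        case (Suc m)
        then have "\<not> norm x < 2 ^ m" unfolding n_def using not_less_Least by (metis lessI)
        with Suc show ?thesis by simp
      qed (auto simp: add_increasing2)
      have "(2 ^ n / 2) ^ 4 \<le> (1 + norm x) ^ 4"
        using low by (intro power_mono) auto
      also have "(2 ^ n / 2 :: real) ^ 4 = 16 ^ n / 16"
        by (simp add: power_divide flip: power_mult)
           (simp add: power_mult mult.commute[of n])
      finally have "1 / (1 + norm x) ^ 4 \<le> 16 / 16 ^ n"
        by (simp add: divide_simps add_pos_nonneg)
      also have "\<dots> = g n x" using n by (simp add: g_def)
      also have "\<dots> \<le> (\<Sum>n. g n x)"
        using sum_le_suminf[OF gsum, of "{n}" x] g0 by simp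
      finally show "norm (1 / (1 + norm x) ^ 4) \<le> norm (\<Sum>n. g n x)" by simp
    qed
  qed measurable
qed

lemma integrable_decay:
  fixes f :: "real^3 \<Rightarrow> 'b::{banach, second_countable_topology}"
  assumes "f \<in> borel_measurable borel" "\<And>x. norm (f x) \<le> C" "\<And>x. norm x ^ 4 * norm (f x) \<le> D"
  shows "integrable lborel f"
proof (rule Bochner_Integration.integrable_bound)
  show "integrable lborel (\<lambda>x::real^3. 8 * (C + D) * (1 / (1 + norm x) ^ 4))"
    by (intro integrable_mult_right integrable_inverse_power4)
  show "AE x in lborel. norm (f x) \<le> norm (8 * (C + D) * (1 / (1 + norm x) ^ 4))"
  proof (rule AE_I2)
    fix x :: "real^3"
    have "(1 + t) ^ 4 \<le> 8 * (1 + t ^ 4)" if "t \<ge> 0" for t :: real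
    proof -
      have "(1 + t)\<^sup>2 \<le> 2 * (1 + t\<^sup>2)" using zero_le_power2[of "1 - t"] by (simp add: power2_eq_square algebra_simps)
      then have "((1 + t)\<^sup>2)\<^sup>2 \<le> (2 * (1 + t\<^sup>2))\<^sup>2" by (intro power_mono) auto
      also have "\<dots> \<le> 8 * (1 + (t\<^sup>2)\<^sup>2)" using zero_le_power2[of "1 - t\<^sup>2"] by (simp add: power2_eq_square algebra_simps)
      finally show ?thesis by (simp flip: power_mult)
    qed
    from this[of "norm x"] have "(1 + norm x) ^ 4 * norm (f x) \<le> (8 * (1 + norm x ^ 4)) * norm (f x)"
      by (intro mult_right_mono) auto
    also have "\<dots> = 8 * (norm (f x) + norm x ^ 4 * norm (f x))" by (simp add: algebra_simps)
    also have "\<dots> \<le> 8 * (C + D)" using assms(2,3)[of x] by simp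
    finally have "norm (f x) \<le> 8 * (C + D) / (1 + norm x) ^ 4"
      by (subst pos_le_divide_eq) (simp_all only: mult.commute zero_less_power add_pos_nonneg zero_less_one norm_ge_zero)
    also have "\<dots> \<le> norm (8 * (C + D) * (1 / (1 + norm x) ^ 4))"
      by (simp add: divide_right_mono)
    finally show "norm (f x) \<le> norm (8 * (C + D) * (1 / (1 + norm x) ^ 4))" .
  qed
qed (use assms in auto)

lemma
  fixes f :: "real^3 \<Rightarrow> 'b::{banach, second_countable_topology}"
  assumes f: "integrable lborel f" and c: "c \<noteq> 0"
  shows integrable_affine: "integrable lborel (\<lambda>x. f (d + c *\<^sub>R x))"
    and integral_affine: "(LINT x|lborel. f (d + c *\<^sub>R x)) = (LINT x|lborel. f x) /\<^sub>R \<bar>c\<bar> ^ 3"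
proof -
  let ?T = "\<lambda>x::real^3. d + c *\<^sub>R x"
  have [measurable]: "f \<in> borel_measurable borel" using f by auto
  have eq: "lborel = density (distr lborel borel ?T) (\<lambda>_. ennreal (\<bar>c\<bar>^3))"
    using lborel_affine[OF c, of d] by simp
  have "integrable (density (distr lborel borel ?T) (\<lambda>_. ennreal (\<bar>c\<bar>^3))) f"
    using f eq by simp
  then have "integrable (distr lborel borel ?T) (\<lambda>x. \<bar>c\<bar>^3 *\<^sub>R f x)"
    by (subst (asm) integrable_density) auto
  then have "integrable lborel (\<lambda>x. \<bar>c\<bar>^3 *\<^sub>R f (?T x))"
    by (subst (asm) integrable_distr_eq) auto
  then show 1: "integrable lborel (\<lambda>x. f (?T x))"
    using c Bochner_Integration.integrable_scaleR_right[of "1 / \<bar>c\<bar>^3" lborel "\<lambda>x. \<bar>c\<bar>^3 *\<^sub>R f (?T x)"] by simp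
  have "(LINT x|lborel. f x) = (LINT x|density (distr lborel borel ?T) (\<lambda>_. ennreal (\<bar>c\<bar>^3)). f x)"
    using eq by simp
  also have "\<dots> = (LINT x|distr lborel borel ?T. \<bar>c\<bar>^3 *\<^sub>R f x)"
    by (subst integral_density) auto
  also have "\<dots> = (LINT x|lborel. \<bar>c\<bar>^3 *\<^sub>R f (?T x))"
    by (subst integral_distr) auto
  finally show "(LINT x|lborel. f (d + c *\<^sub>R x)) = (LINT x|lborel. f x) /\<^sub>R \<bar>c\<bar> ^ 3"
    using c by simp
qed

text \<open>Sign changes are diagonal maps with determinant of modulus 1. They are used with all
  signs negative, for parity, and with one negative sign, for the mirror symmetry.\<close>

lemma integral_sign_flip:
  fixes f :: "real^3 \<Rightarrow> 'b::{banach, second_countable_topology}" and \<sigma> :: "3 \<Rightarrow> real"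
  assumes [measurable]: "f \<in> borel_measurable borel" and \<sigma>: "\<And>i. \<bar>\<sigma> i\<bar> = 1"
  shows "(LINT x|lborel. f (\<chi> i. \<sigma> i * x $ i)) = (LINT x|lborel. f x)"
proof -
  define c where "c j = (\<Sum>i\<in>UNIV. \<sigma> i * j $ i)" for j :: "real^3"
  have c: "c (axis i 1) = \<sigma> i" for i
    by (simp add: c_def axis_def if_distrib cong: if_cong)
  have c1: "\<bar>c j\<bar> = 1" if "j \<in> Basis" for j
    using that \<sigma> by (auto simp: Basis_vec_def c)
  let ?T = "\<lambda>x::real^3. 0 + (\<Sum>j\<in>Basis. (c j * (x \<bullet> j)) *\<^sub>R j)"
  have T: "?T x = (\<chi> i. \<sigma> i * x $ i)" for x
  proof (rule euclidean_eqI)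
    fix b :: "real^3" assume b: "b \<in> Basis"
    then obtain i where i: "b = axis i 1" by (auto simp: Basis_vec_def)
    have "?T x \<bullet> b = c b * (x \<bullet> b)" using b by simp
    then show "?T x \<bullet> b = (\<chi> i. \<sigma> i * x $ i) \<bullet> b"
      by (simp add: i c inner_axis)
  qed
  have "lborel = density (distr lborel borel ?T) (\<lambda>_. (\<Prod>j\<in>Basis. \<bar>c j\<bar>))"
    by (rule lborel_affine_euclidean) (use c1 in fastforce)
  also have "(\<Prod>j\<in>Basis. \<bar>c j\<bar>) = 1" using c1 by simp
  finally have "lborel = distr lborel borel (\<lambda>x. (\<chi> i. \<sigma> i * x $ i) :: real^3)"
    unfolding T by (simp add: density_1 )
  then have "(LINT x|lborel. f x) = (LINT x|distr lborel borel (\<lambda>x. (\<chi> i. \<sigma> i * x $ i) :: real^3). f x)"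
    by metis
  also have "\<dots> = (LINT x|lborel. f (\<chi> i. \<sigma> i * x $ i))"
  proof (rule integral_distr)
    have "continuous_on UNIV (\<lambda>x. (\<chi> i. \<sigma> i * x $ i) :: real^3)"
      by (intro continuous_intros)
    then show "(\<lambda>x. (\<chi> i. \<sigma> i * x $ i) :: real^3) \<in> lborel \<rightarrow>\<^sub>M borel"
      by (simp add: borel_measurable_continuous_onI)
  qed auto
  finally show ?thesis ..
qed

text \<open>Integration over a unit segment in direction \<open>i\<close> turns the derivative into
  the difference between a translate of \<open>F\<close> and \<open>F\<close>, whose integrals
  agree. Fubini's theorem then replaces a limit of boundary terms at infinity by translation
  invariance.\<close>

lemma integral_partial_deriv_zero:
  fixes F :: "real^3 \<Rightarrow> complex"
  assumes diff: "\<And>x. F differentiable (at x)"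
    and cont: "continuous_on UNIV (partial_deriv i F)"
    and F: "integrable lborel F" and dF: "integrable lborel (partial_deriv i F)"
  shows "(LINT x|lborel. partial_deriv i F x) = 0"
proof -
  let ?e = "axis i 1 :: real^3"
  let ?G = "partial_deriv i F"
  have [measurable]: "?G \<in> borel_measurable borel" using dF by auto
  have shift: "integrable lborel (\<lambda>x. f (x + y))" "(LINT x|lborel. f (x + y)) = (LINT x|lborel. f x)"
    if "integrable lborel f" for f :: "real^3 \<Rightarrow> 'b::{banach, second_countable_topology}" and y
    using integrable_affine[OF that, of 1 y] integral_affine[OF that, of 1 y] by (simp_all add: add.commute)
  let ?H = "\<lambda>(s::real, x). indicator {0..1} s *\<^sub>R ?G (x + s *\<^sub>R ?e)"
  have int: "integrable (lborel \<Otimes>\<^sub>M lborel) ?H"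
  proof (rule lborel_pair.Fubini_integrable)
    show "integrable lborel (\<lambda>s. LINT x|lborel. norm (?H (s, x)))"
      using shift(2)[OF integrable_norm[OF dF]]
      by (simp add: integrable_real_indicator)
    show "AE s in lborel. integrable lborel (\<lambda>x. ?H (s, x))"
      using shift(1)[OF dF] by (intro AE_I2) auto
  qed measurable
  have ftc: "(LINT s|lborel. ?H (s, x)) = F (x + ?e) - F x" for x
  proof -
    have "(LINT s|lborel. indicator {0..1} s *\<^sub>R ?G (x + s *\<^sub>R ?e)) = F (x + 1 *\<^sub>R ?e) - F (x + 0 *\<^sub>R ?e)"
    proof (rule integral_FTC_Icc)
      fix s :: real
      have "((\<lambda>s. F (x + s *\<^sub>R ?e)) has_derivative (\<lambda>h. frechet_derivative F (at (x + s *\<^sub>R ?e)) (h *\<^sub>R ?e))) (at s within {0..1})"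
        by (rule has_derivative_compose[of "\<lambda>s. x + s *\<^sub>R ?e"])
           (use diff frechet_derivative_works in \<open>auto intro!: derivative_eq_intros\<close>)
      moreover have "frechet_derivative F (at (x + s *\<^sub>R ?e)) (h *\<^sub>R ?e) = h *\<^sub>R ?G (x + s *\<^sub>R ?e)" for h
        unfolding partial_deriv_def
        using diff frechet_derivative_works has_derivative_bounded_linear bounded_linear.linear linear_scale by metis
      ultimately show "((\<lambda>s. F (x + s *\<^sub>R ?e)) has_vector_derivative ?G (x + s *\<^sub>R ?e)) (at s within {0..1})"
        by (simp add: has_vector_derivative_def)
      show "continuous_on {0..1} (\<lambda>s. ?G (x + s *\<^sub>R ?e))"
        by (intro continuous_on_compose2[OF cont] continuous_intros) auto
    qed auto
    then show ?thesis by simp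
  qed
  have "(LINT x|lborel. ?G x) = (LINT s|lborel. indicator {0..1::real} s *\<^sub>R (LINT x|lborel. ?G x))"
    by (subst integral_scaleR_left) (auto simp: integrable_real_indicator)
  also have "\<dots> = (LINT s|lborel. LINT x|lborel. ?H (s, x))"
    using shift(2)[OF dF] by simp
  also have "\<dots> = (LINT x|lborel. LINT s|lborel. ?H (s, x))"
    using lborel_pair.Fubini_integral[of "\<lambda>s x. ?H (s, x)"] int by simp
  also have "\<dots> = (LINT x|lborel. F (x + ?e)) - (LINT x|lborel. F x)"
    unfolding ftc using shift(1)[OF F] F by (intro Bochner_Integration.integral_diff)
  also have "\<dots> = 0" using shift(2)[OF F] by simp
  finally show ?thesis .
qed


section \<open>Functions with bounded support\<close>

definition bounded_support :: "(real^3 \<Rightarrow> 'b::zero) \<Rightarrow> bool" where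
  "bounded_support f \<longleftrightarrow> (\<exists>R. \<forall>x. R < norm x \<longrightarrow> f x = 0)"

definition test_fun :: "(real^3 \<Rightarrow> complex) \<Rightarrow> bool" where
  "test_fun h \<longleftrightarrow> smooth h \<and> bounded_support h"

lemma bounded_support_mono:
  "bounded_support f \<Longrightarrow> (\<And>x. f x = 0 \<Longrightarrow> g x = 0) \<Longrightarrow> bounded_support g"
  by (auto simp: bounded_support_def)

lemma bounded_support_add:
  fixes f g :: "real^3 \<Rightarrow> 'b::monoid_add"
  assumes "bounded_support f" "bounded_support g"
  shows "bounded_support (\<lambda>x. f x + g x)"
proof -
  obtain R S where "\<forall>x. R < norm x \<longrightarrow> f x = 0" "\<forall>x. S < norm x \<longrightarrow> g x = 0"
    using assms by (auto simp: bounded_support_def)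
  then show ?thesis
    unfolding bounded_support_def by (intro exI[of _ "max R S"]) auto
qed

lemma bounded_support_affine:
  assumes "bounded_support f" "c \<noteq> 0"
  shows "bounded_support (\<lambda>x. f (d + c *\<^sub>R x))"
proof -
  obtain R where R: "\<And>x. R < norm x \<Longrightarrow> f x = 0"
    using assms by (auto simp: bounded_support_def)
  have "f (d + c *\<^sub>R x) = 0" if "(R + norm d) / \<bar>c\<bar> < norm x" for x
  proof (rule R)
    have "R + norm d < norm (c *\<^sub>R x)"
      using that assms(2) by (simp add: pos_divide_less_eq mult.commute)
    then show "R < norm (d + c *\<^sub>R x)"
      using norm_triangle_ineq4[of "d + c *\<^sub>R x" d] by simp
  qed
  then show ?thesis unfolding bounded_support_def by blast
qed

lemma
  fixes f :: "real^3 \<Rightarrow> complex"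
  assumes "continuous_on UNIV f" "bounded_support f"
  shows bounded_support_integrable: "integrable lborel f"
    and bounded_support_bounded: "\<exists>C. \<forall>x. norm (f x) \<le> C"
proof -
  obtain R where R: "\<And>x. R < norm x \<Longrightarrow> f x = 0"
    using assms by (auto simp: bounded_support_def)
  have eq: "(\<lambda>x. indicator (cball 0 R) x *\<^sub>R f x) = f"
    using R by (force simp: indicator_def)
  have "continuous_on (cball 0 R) f" using assms(1) continuous_on_subset by blast
  then show "integrable lborel f"
    using borel_integrable_compact[of "cball 0 R" f] eq by simp
  have "bounded (f ` cball 0 R)"
    using \<open>continuous_on (cball 0 R) f\<close> by (intro compact_imp_bounded compact_continuous_image) auto
  then obtain C where C: "\<forall>x\<in>cball 0 R. norm (f x) \<le> C"
    by (auto simp: bounded_iff)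
  have "norm (f x) \<le> max C 0" for x
  proof (cases "R < norm x")
    case True
    then show ?thesis using R by simp
  next
    case False
    then show ?thesis using C by (simp add: le_max_iff_disj)
  qed
  then show "\<exists>C. \<forall>x. norm (f x) \<le> C" by blast
qed

lemma bounded_support_partial_deriv:
  fixes f :: "real^3 \<Rightarrow> 'b::real_normed_vector"
  assumes "bounded_support f"
  shows "bounded_support (partial_deriv i f)"
proof -
  obtain R where R: "\<And>x. R < norm x \<Longrightarrow> f x = 0"
    using assms by (auto simp: bounded_support_def)
  have "partial_deriv i f x = 0" if "R < norm x" for x
  proof -
    have "(f has_derivative (\<lambda>_. 0)) (at x)"
    proof (rule has_derivative_transform_within_open[of "\<lambda>_. 0" _ _ _ "{y. R < norm y}"])
      show "open {y::real^3. R < norm y}" by (intro open_Collect_less continuous_intros)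
    qed (use that R in auto)
    then show ?thesis by (simp add: partial_deriv_eqI)
  qed
  then show ?thesis unfolding bounded_support_def by blast
qed

lemma test_fun_smooth: "test_fun h \<Longrightarrow> smooth h"
  and test_fun_bounded_support: "test_fun h \<Longrightarrow> bounded_support h"
  by (simp_all add: test_fun_def)

lemma test_fun_add: "test_fun f \<Longrightarrow> test_fun g \<Longrightarrow> test_fun (\<lambda>x. f x + g x)"
  by (simp add: test_fun_def smooth_add bounded_support_add)

lemma test_fun_cmult: "test_fun f \<Longrightarrow> test_fun (\<lambda>x. c * f x)"
  by (auto simp: test_fun_def intro: bounded_support_mono smooth_bounded_linear[OF bounded_linear_mult_right])

lemma test_fun_minus: "test_fun f \<Longrightarrow> test_fun (\<lambda>x. - f x)"
  using test_fun_cmult[of f "-1"] by simp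

lemma test_fun_diff: "test_fun f \<Longrightarrow> test_fun g \<Longrightarrow> test_fun (\<lambda>x. f x - g x)"
  using test_fun_add[of f "\<lambda>x. - g x"] test_fun_minus[of g] by simp

lemma test_fun_coord: "test_fun f \<Longrightarrow> test_fun (\<lambda>x. complex_of_real (x $ j) * f x)"
  using smooth_coord_mult[of f j]
  by (auto simp: test_fun_def scaleR_conv_of_real elim: bounded_support_mono)

lemma test_fun_affine: "test_fun f \<Longrightarrow> c \<noteq> 0 \<Longrightarrow> test_fun (\<lambda>x. f (d + c *\<^sub>R x))"
  by (simp add: test_fun_def smooth_affine bounded_support_affine)

lemma test_fun_zero: "test_fun (\<lambda>x. 0)"
proof -
  have "smooth (\<lambda>x::real^3. 0::complex)"
  proof (rule smooth_coinduct[where P = "\<lambda>h. h = (\<lambda>x. 0)"])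
    fix g :: "real^3 \<Rightarrow> complex" and i assume "g = (\<lambda>x. 0)"
    then show "partial_deriv i g = (\<lambda>x. 0)"
      using partial_deriv_eqI[OF has_derivative_const] by blast
  qed auto
  then show ?thesis by (simp add: test_fun_def bounded_support_def)
qed

lemma test_fun_sum: "(\<And>k. k \<in> A \<Longrightarrow> test_fun (f k)) \<Longrightarrow> test_fun (\<lambda>x. \<Sum>k\<in>A. f k x)"
  by (induction A rule: infinite_finite_induct) (auto intro: test_fun_zero test_fun_add)

lemma test_fun_partial_deriv: "test_fun f \<Longrightarrow> test_fun (partial_deriv i f)"
  by (simp add: test_fun_def smooth_partial_deriv bounded_support_partial_deriv)

lemma test_fun_partial_derivs: "test_fun f \<Longrightarrow> test_fun (partial_derivs ks f)"
  by (induction ks) (auto intro: test_fun_partial_deriv)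

lemma test_fun_continuous: "test_fun h \<Longrightarrow> continuous_on UNIV h"
  by (simp add: test_fun_def smooth_continuous)

lemma test_fun_integrable: "test_fun h \<Longrightarrow> integrable lborel h"
  by (simp add: test_fun_continuous test_fun_bounded_support bounded_support_integrable)

lemma test_fun_measurable: "test_fun h \<Longrightarrow> h \<in> borel_measurable borel"
  using test_fun_integrable by fastforce

lemma test_fun_bounded: "test_fun h \<Longrightarrow> \<exists>C. \<forall>x. norm (h x) \<le> C"
  by (simp add: test_fun_continuous test_fun_bounded_support bounded_support_bounded)

lemma test_fun_schwartz:
  assumes "test_fun h"
  shows "schwartz h"
  unfolding schwartz_def
proof (intro conjI allI)
  fix k ks
  let ?h = "partial_derivs ks h"
  have h: "test_fun ?h" using assms by (rule test_fun_partial_derivs)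
  have "\<exists>C. \<forall>x. norm (complex_of_real (norm x ^ k) * ?h x) \<le> C"
  proof (rule bounded_support_bounded)
    show "continuous_on UNIV (\<lambda>x. complex_of_real (norm x ^ k) * ?h x)"
      by (intro continuous_intros test_fun_continuous h)
    show "bounded_support (\<lambda>x. complex_of_real (norm x ^ k) * ?h x)"
      using test_fun_bounded_support[OF h] by (rule bounded_support_mono) auto
  qed
  then obtain C where "\<And>x. norm x ^ k * norm (?h x) \<le> C" by (auto simp: norm_mult norm_power)
  then show "bdd_above (range (\<lambda>x. norm x ^ k * norm (?h x)))"
    by (rule bdd_aboveI2)
qed (use assms test_fun_def in auto)

lemma
  assumes "schwartz f"
  shows schwartz_smooth: "smooth f"
    and schwartz_bounded: "\<exists>C. \<forall>x. norm (f x) \<le> C"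
    and schwartz_integrable: "integrable lborel f"
    and schwartz_partial_deriv: "schwartz (partial_deriv i f)"
proof -
  show sm: "smooth f" using assms by (simp add: schwartz_def)
  have bdd: "\<exists>C. \<forall>x. norm x ^ k * norm (partial_derivs ks f x) \<le> C" for k ks
    using assms unfolding schwartz_def bdd_above_def by (meson rangeI)
  obtain C where C: "\<And>x. norm (f x) \<le> C" using bdd[of 0 "[]"] by auto
  then show "\<exists>C. \<forall>x. norm (f x) \<le> C" by blast
  obtain D where D: "\<And>x. norm x ^ 4 * norm (f x) \<le> D" using bdd[of 4 "[]"] by auto
  show "integrable lborel f"
    by (rule integrable_decay[OF smooth_measurable[OF sm] C D])
  have "partial_derivs ks (partial_deriv i f) = partial_derivs (ks @ [i]) f" for ks
    by (simp add: partial_derivs_append)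
  then show "schwartz (partial_deriv i f)"
    using assms smooth_partial_deriv[OF sm] by (auto simp: schwartz_def)
qed

section \<open>The Fourier transform\<close>

lemma borel_measurable_cis [measurable]: "cis \<in> borel_measurable borel"
proof -
  have "continuous_on UNIV cis" unfolding cis_conv_exp by (intro continuous_intros)
  then show ?thesis by (rule borel_measurable_continuous_onI)
qed

lemma integrable_mult_bounded:
  fixes f g :: "real^3 \<Rightarrow> complex"
  assumes "integrable lborel f" "g \<in> borel_measurable borel" "\<And>x. norm (g x) \<le> C"
  shows "integrable lborel (\<lambda>x. g x * f x)" "integrable lborel (\<lambda>x. f x * g x)"
proof -
  show "integrable lborel (\<lambda>x. g x * f x)"
  proof (rule Bochner_Integration.integrable_bound)
    show "integrable lborel (\<lambda>x. C * norm (f x))" using assms by auto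
    show "AE x in lborel. norm (g x * f x) \<le> norm (C * norm (f x))"
    proof (rule AE_I2)
      fix x
      have "0 \<le> C" using assms(3)[of x] norm_ge_zero order_trans by blast
      then show "norm (g x * f x) \<le> norm (C * norm (f x))"
        using assms(3)[of x] by (simp add: norm_mult mult_right_mono)
    qed
    have "f \<in> borel_measurable borel" using assms(1) by auto
    then show "(\<lambda>x. g x * f x) \<in> borel_measurable lborel" using assms(2) by auto
  qed
  then show "integrable lborel (\<lambda>x. f x * g x)" by (simp add: mult.commute)
qed

lemma integrable_cis_mult:
  fixes f :: "real^3 \<Rightarrow> complex"
  assumes "integrable lborel f" "\<phi> \<in> borel_measurable borel"
  shows "integrable lborel (\<lambda>x. cis (\<phi> x) * f x)"
  by (rule integrable_mult_bounded[OF assms(1), of _ 1]) (use assms(2) in auto)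

lemma inv_fourier_eq: "inv_fourier f x = fourier f (- x) / (2 * pi) ^ 3"
  by (simp add: inv_fourier_def fourier_def inner_commute)

lemma fourier_measurable:
  assumes "integrable lborel f"
  shows "fourier f \<in> borel_measurable borel"
proof -
  have [measurable]: "f \<in> borel_measurable borel" using assms by auto
  have "(\<lambda>\<xi>. LINT x|lborel. cis (- (x \<bullet> \<xi>)) * f x) \<in> borel_measurable borel"
    by (rule sigma_finite_measure.borel_measurable_lebesgue_integral[OF sigma_finite_lborel]) measurable
  then show ?thesis by (simp add: fourier_def [abs_def])
qed

lemma inv_fourier_measurable:
  assumes "integrable lborel f"
  shows "inv_fourier f \<in> borel_measurable borel"
proof -
  note [measurable] = fourier_measurable[OF assms]
  show ?thesis unfolding inv_fourier_eq[abs_def] by measurable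
qed

lemma norm_fourier_le: "norm (fourier f \<xi>) \<le> (LINT x|lborel. norm (f x))"
  unfolding fourier_def
  by (rule order_trans[OF integral_norm_bound]) (simp add: norm_mult)

lemma norm_inv_fourier_le: "norm (inv_fourier f \<xi>) \<le> (LINT x|lborel. norm (f x)) / (2 * pi) ^ 3"
  by (auto simp: inv_fourier_eq norm_divide norm_power norm_mult intro!: divide_right_mono norm_fourier_le)

lemma integrable_inv_fourier_mult:
  assumes "integrable lborel f" "integrable lborel w"
  shows "integrable lborel (\<lambda>x. inv_fourier w x * f x)"
  by (rule integrable_mult_bounded(1)[OF assms(1) inv_fourier_measurable[OF assms(2)] norm_inv_fourier_le])

lemma fourier_duality:
  assumes "integrable lborel f" "integrable lborel g"
  shows "(LINT x|lborel. f x * fourier g x) = (LINT x|lborel. fourier f x * g x)"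
proof -
  have [measurable]: "f \<in> borel_measurable borel" "g \<in> borel_measurable borel" using assms by auto
  let ?H = "\<lambda>(x, y). f x * (cis (- (y \<bullet> x)) * g y)"
  have int: "integrable (lborel \<Otimes>\<^sub>M lborel) ?H"
  proof (rule lborel_pair.Fubini_integrable)
    show "integrable lborel (\<lambda>x. LINT y|lborel. norm (?H (x, y)))"
      using assms by (simp add: norm_mult)
    show "AE x in lborel. integrable lborel (\<lambda>y. ?H (x, y))"
      using assms by (auto intro!: AE_I2 integrable_mult_right integrable_cis_mult)
  qed measurable
  have "(LINT x|lborel. f x * fourier g x) = (LINT x|lborel. LINT y|lborel. f x * (cis (- (y \<bullet> x)) * g y))"
    by (simp add: fourier_def integral_mult_right_zero)
  also have "\<dots> = (LINT y|lborel. LINT x|lborel. f x * (cis (- (y \<bullet> x)) * g y))"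
    using lborel_pair.Fubini_integral[of "\<lambda>x y. f x * (cis (- (y \<bullet> x)) * g y)"] int by simp
  also have "\<dots> = (LINT y|lborel. fourier f y * g y)"
  proof (rule Bochner_Integration.integral_cong[OF refl])
    fix y
    have "(LINT x|lborel. f x * (cis (- (y \<bullet> x)) * g y)) = (LINT x|lborel. (cis (- (x \<bullet> y)) * f x) * g y)"
      by (simp add: ac_simps inner_commute)
    then show "(LINT x|lborel. f x * (cis (- (y \<bullet> x)) * g y)) = fourier f y * g y"
      by (simp add: fourier_def)
  qed
  finally show ?thesis .
qed

lemma integral_reflect:
  fixes f :: "real^3 \<Rightarrow> 'b::{banach, second_countable_topology}"
  assumes "f \<in> borel_measurable borel"
  shows "(LINT x|lborel. f (- x)) = (LINT x|lborel. f x)"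
proof -
  have "(\<chi> i. - 1 * x $ i) = - x" for x :: "real^3" by (simp add: vec_eq_iff)
  then show ?thesis using integral_sign_flip[OF assms, of "\<lambda>_. -1"] by simp
qed

lemma inv_fourier_duality:
  assumes "integrable lborel f" "integrable lborel g"
  shows "(LINT x|lborel. f x * inv_fourier g x) = (LINT x|lborel. inv_fourier f x * g x)"
proof -
  have g': "integrable lborel (\<lambda>x. g (- x))"
    using integrable_affine[OF assms(2), of "-1" 0] by simp
  have [measurable]: "f \<in> borel_measurable borel" "g \<in> borel_measurable borel" using assms by auto
  note [measurable] = fourier_measurable[OF assms(1)]
  have eq: "fourier (\<lambda>x. g (- x)) x = fourier g (- x)" for x
    using integral_reflect[of "\<lambda>y. cis (- (y \<bullet> (- x))) * g y"] by (simp add: fourier_def)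
  have "(LINT x|lborel. f x * inv_fourier g x) = (LINT x|lborel. f x * fourier (\<lambda>x. g (- x)) x) / (2 * pi) ^ 3"
    by (simp add: inv_fourier_eq eq)
  also have "\<dots> = (LINT x|lborel. fourier f x * g (- x)) / (2 * pi) ^ 3"
    by (simp add: fourier_duality[OF assms(1) g'])
  also have "(LINT x|lborel. fourier f x * g (- x)) = (LINT x|lborel. fourier f (- x) * g x)"
    using integral_reflect[of "\<lambda>x. fourier f (- x) * g x"] by simp
  finally show ?thesis by (simp add: inv_fourier_eq)
qed

lemma inv_fourier_modulate:
  "inv_fourier (\<lambda>x. cis (- (x \<bullet> \<xi>)) * f x) \<eta> = inv_fourier f (\<eta> - \<xi>)"
  unfolding inv_fourier_def
  by (simp add: cis_mult mult.assoc[symmetric] inner_diff_left inner_commute[of _ \<eta>] inner_commute[of _ \<xi>])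

lemma inv_fourier_dilate:
  assumes "integrable lborel f" "c > 0"
  shows "inv_fourier (\<lambda>x. f (x /\<^sub>R c)) \<eta> = of_real (c ^ 3) * inv_fourier f (c *\<^sub>R \<eta>)"
proof -
  have eq: "(c *\<^sub>R \<eta>) \<bullet> (0 + inverse c *\<^sub>R x) = \<eta> \<bullet> x" for x
    using assms(2) by simp
  have "(LINT x|lborel. cis (\<eta> \<bullet> x) * f (x /\<^sub>R c)) = c ^ 3 *\<^sub>R (LINT x|lborel. cis ((c *\<^sub>R \<eta>) \<bullet> x) * f x)"
    using integral_affine[OF integrable_cis_mult[OF assms(1), of "\<lambda>x. (c *\<^sub>R \<eta>) \<bullet> x"], of "inverse c" 0] assms(2)
    unfolding eq by (simp add: power_inverse)
  then show ?thesis by (simp add: inv_fourier_def scaleR_conv_of_real)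
qed

lemma inv_fourier_add:
  assumes "integrable lborel f" "integrable lborel g"
  shows "inv_fourier (\<lambda>x. f x + g x) \<xi> = inv_fourier f \<xi> + inv_fourier g \<xi>"
  using assms by (simp add: inv_fourier_def distrib_left integrable_cis_mult add_divide_distrib)

lemma inv_fourier_cmult: "inv_fourier (\<lambda>x. c * f x) \<xi> = c * inv_fourier f \<xi>"
  by (simp add: inv_fourier_def mult.left_commute[of _ c])

lemma inv_fourier_sum:
  assumes "\<And>k. k \<in> A \<Longrightarrow> integrable lborel (f k)"
  shows "inv_fourier (\<lambda>x. \<Sum>k\<in>A. f k x) \<xi> = (\<Sum>k\<in>A. inv_fourier (f k) \<xi>)"
  using assms
  by (simp add: inv_fourier_def sum_distrib_left integrable_cis_mult sum_divide_distrib)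

lemma norm_cis_expansion: "norm (cis t - 1 - \<i> * t) \<le> t\<^sup>2"
  using Taylor_exp[of "\<i> * t" 1]
  by (simp add: cis_conv_exp norm_mult power2_eq_square algebra_simps)

text \<open>Differentiation under the integral in explicit form: on a bounded frequency range the
  quadratic remainder of \<open>cis\<close> is uniform, so the error is quadratic in
  \<open>y - x\<close>.\<close>

lemma inv_fourier_has_derivative:
  assumes w: "integrable lborel w" and "bounded_support w"
  shows "(inv_fourier w has_derivative (\<lambda>y. inv_fourier (\<lambda>\<xi>. \<i> * (y \<bullet> \<xi>) * w \<xi>) x)) (at x)"
proof -
  obtain R where R: "\<And>x. R < norm x \<Longrightarrow> w x = 0"
    using assms by (auto simp: bounded_support_def)
  define S where "S = max R 0"
  have S: "\<And>x. S < norm x \<Longrightarrow> w x = 0" "S \<ge> 0" using R by (auto simp: S_def)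
  have [measurable]: "w \<in> borel_measurable borel" using w by auto
  have bd: "norm (y \<bullet> \<xi>) * norm (w \<xi>) \<le> norm y * S * norm (w \<xi>)" for y \<xi>
  proof (cases "S < norm \<xi>")
    case False
    have "norm (y \<bullet> \<xi>) \<le> norm y * norm \<xi>" using Cauchy_Schwarz_ineq2 by auto
    also have "\<dots> \<le> norm y * S" using False by (intro mult_left_mono) auto
    finally show ?thesis by (intro mult_right_mono) auto
  qed (use S in auto)
  have int1: "integrable lborel (\<lambda>\<xi>. \<i> * (y \<bullet> \<xi>) * w \<xi>)" for y
    by (rule Bochner_Integration.integrable_bound[of _ "\<lambda>\<xi>. norm y * S * norm (w \<xi>)"])
       (use w bd S in \<open>auto simp: norm_mult\<close>)
  let ?D = "\<lambda>y. inv_fourier (\<lambda>\<xi>. \<i> * (y \<bullet> \<xi>) * w \<xi>) x"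
  let ?C = "(LINT \<xi>|lborel. norm (w \<xi>))"
  have "norm (?D y) \<le> norm y * (S * ?C / (2 * pi) ^ 3)" for y
  proof -
    have "(LINT \<xi>|lborel. norm (\<i> * (y \<bullet> \<xi>) * w \<xi>)) \<le> (LINT \<xi>|lborel. norm y * S * norm (w \<xi>))"
      by (rule integral_mono) (use integrable_norm[OF int1[of y]] w bd in \<open>auto simp: norm_mult\<close>)
    then have "norm (?D y) \<le> norm y * S * ?C / (2 * pi) ^ 3"
      by (intro order_trans[OF norm_inv_fourier_le] divide_right_mono) (auto simp: w)
    then show ?thesis by simp
  qed
  moreover have "?D (y + z) = ?D y + ?D z" for y z
    using inv_fourier_add[OF int1[of y] int1[of z]] by (simp add: inner_add_left algebra_simps)
  moreover have "?D (c *\<^sub>R y) = c *\<^sub>R ?D y" for c y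
    using inv_fourier_cmult[of "of_real c" "\<lambda>\<xi>. \<i> * (y \<bullet> \<xi>) * w \<xi>" x]
    by (simp add: scaleR_conv_of_real[where 'a = complex] mult_ac)
  ultimately have lin: "bounded_linear ?D"
    by (intro bounded_linear_intro[where K = "S * ?C / (2 * pi) ^ 3"]) auto
  have est: "norm (inv_fourier w y - inv_fourier w x - ?D (y - x)) \<le> (norm (y - x))\<^sup>2 * (S\<^sup>2 * ?C / (2 * pi) ^ 3)" for y
  proof -
    define z where "z = y - x"
    let ?F = "\<lambda>\<xi>. cis (x \<bullet> \<xi>) * ((cis (z \<bullet> \<xi>) - 1 - \<i> * (z \<bullet> \<xi>)) * w \<xi>)"
    have Feq: "?F \<xi> = cis (y \<bullet> \<xi>) * w \<xi> - cis (x \<bullet> \<xi>) * w \<xi> - cis (x \<bullet> \<xi>) * (\<i> * (z \<bullet> \<xi>) * w \<xi>)" for \<xi>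
    proof -
      have "cis (y \<bullet> \<xi>) = cis (x \<bullet> \<xi>) * cis (z \<bullet> \<xi>)"
        by (simp add: cis_mult z_def inner_diff_left)
      then show ?thesis by (simp add: algebra_simps)
    qed
    have i: "integrable lborel (\<lambda>\<xi>. cis (y \<bullet> \<xi>) * w \<xi>)" "integrable lborel (\<lambda>\<xi>. cis (x \<bullet> \<xi>) * w \<xi>)"
      "integrable lborel (\<lambda>\<xi>. cis (x \<bullet> \<xi>) * (\<i> * (z \<bullet> \<xi>) * w \<xi>))"
      by (intro integrable_cis_mult w int1; measurable)+
    have Fint: "integrable lborel ?F" unfolding Feq using i by simp
    have "norm (LINT \<xi>|lborel. ?F \<xi>) \<le> (LINT \<xi>|lborel. norm (?F \<xi>))" by (rule integral_norm_bound)
    also have "\<dots> \<le> (LINT \<xi>|lborel. (norm z)\<^sup>2 * S\<^sup>2 * norm (w \<xi>))"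
    proof (rule integral_mono)
      fix \<xi>
      show "norm (?F \<xi>) \<le> (norm z)\<^sup>2 * S\<^sup>2 * norm (w \<xi>)"
      proof (cases "S < norm \<xi>")
        case False
        have "norm (cis (z \<bullet> \<xi>) - 1 - \<i> * (z \<bullet> \<xi>)) \<le> \<bar>z \<bullet> \<xi>\<bar>\<^sup>2"
          using norm_cis_expansion by simp
        also have "\<dots> \<le> (norm z * S)\<^sup>2"
        proof (rule power_mono)
          have "\<bar>z \<bullet> \<xi>\<bar> \<le> norm z * norm \<xi>" by (rule Cauchy_Schwarz_ineq2)
          also have "\<dots> \<le> norm z * S" using False by (intro mult_left_mono) auto
          finally show "\<bar>z \<bullet> \<xi>\<bar> \<le> norm z * S" .
        qed auto
        finally show ?thesis by (auto simp: norm_mult power_mult_distrib intro!: mult_right_mono)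
      qed (use S in auto)
    qed (use Fint w in auto)
    also have "\<dots> = (norm z)\<^sup>2 * S\<^sup>2 * ?C" by simp
    finally have *: "norm (LINT \<xi>|lborel. ?F \<xi>) / (2 * pi) ^ 3 \<le> (norm z)\<^sup>2 * S\<^sup>2 * ?C / (2 * pi) ^ 3"
      by (intro divide_right_mono) auto
    have eq: "inv_fourier w y - inv_fourier w x - ?D (y - x) = (LINT \<xi>|lborel. ?F \<xi>) / (2 * pi) ^ 3"
      unfolding Feq using i by (simp add: inv_fourier_def diff_divide_distrib z_def)
    have "norm (inv_fourier w y - inv_fourier w x - ?D (y - x)) = norm (LINT \<xi>|lborel. ?F \<xi>) / (2 * pi) ^ 3"
      unfolding eq norm_divide by (simp add: norm_mult norm_power)
    with * show ?thesis by (simp add: z_def mult.assoc)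
  qed
  show ?thesis
  proof (rule has_derivativeI_sandwich[of 1])
    fix y assume "y \<noteq> x"
    then show "norm (inv_fourier w y - inv_fourier w x - ?D (y - x)) / norm (y - x)
        \<le> norm (y - x) * (S\<^sup>2 * ?C / (2 * pi) ^ 3)"
      using est[of y] by (simp add: pos_divide_le_eq power2_eq_square mult_ac)
  next
    show "((\<lambda>y. norm (y - x) * (S\<^sup>2 * ?C / (2 * pi) ^ 3)) \<longlongrightarrow> 0) (at x)"
      by (auto intro!: tendsto_eq_intros)
  qed (use lin in auto)
qed

lemma partial_deriv_inv_fourier:
  assumes "integrable lborel w" and "bounded_support w"
  shows "partial_deriv i (inv_fourier w) = inv_fourier (\<lambda>\<xi>. \<i> * \<xi> $ i * w \<xi>)"
  using partial_deriv_eqI[OF inv_fourier_has_derivative[OF assms]]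
  by (auto simp: inner_axis' fun_eq_iff)

lemma integrable_coord_mult:
  fixes w :: "real^3 \<Rightarrow> complex"
  assumes "integrable lborel w" and "bounded_support w"
  shows "integrable lborel (\<lambda>\<xi>. \<i> * \<xi> $ i * w \<xi>)" "bounded_support (\<lambda>\<xi>. \<i> * \<xi> $ i * w \<xi>)"
proof -
  obtain R where R: "\<And>x. R < norm x \<Longrightarrow> w x = 0"
    using assms by (auto simp: bounded_support_def)
  have [measurable]: "w \<in> borel_measurable borel" using assms by auto
  show "integrable lborel (\<lambda>\<xi>. \<i> * \<xi> $ i * w \<xi>)"
  proof (rule Bochner_Integration.integrable_bound[of _ "\<lambda>\<xi>. R * norm (w \<xi>)"])
    show "AE \<xi> in lborel. norm (\<i> * \<xi> $ i * w \<xi>) \<le> norm (R * norm (w \<xi>))"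
    proof (rule AE_I2)
      fix \<xi> show "norm (\<i> * \<xi> $ i * w \<xi>) \<le> norm (R * norm (w \<xi>))"
        using R[of \<xi>] component_le_norm_cart[of \<xi> i]
        by (cases "R < norm \<xi>") (auto simp: norm_mult intro!: mult_right_mono)
    qed
  qed (use assms in auto)
  show "bounded_support (\<lambda>\<xi>. \<i> * \<xi> $ i * w \<xi>)"
    using assms(2) by (rule bounded_support_mono) auto
qed

lemma smooth_inv_fourier:
  assumes "integrable lborel w" and "bounded_support w"
  shows "smooth (inv_fourier w)"
proof (rule smooth_coinduct[where P = "\<lambda>h. \<exists>w. integrable lborel w \<and> bounded_support w \<and> h = inv_fourier w"])
  fix h i x assume "\<exists>w. integrable lborel w \<and> bounded_support w \<and> h = inv_fourier w"
  then obtain w where w: "integrable lborel w" "bounded_support w" "h = inv_fourier w" by blast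
  show "h differentiable at x"
    using inv_fourier_has_derivative[OF w(1,2)] w(3) by (auto simp: differentiable_def)
  show "\<exists>w. integrable lborel w \<and> bounded_support w \<and> partial_deriv i h = inv_fourier w"
    using integrable_coord_mult[OF w(1,2)] partial_deriv_inv_fourier[OF w(1,2)] w(3) by blast
qed (use assms in blast)

lemma inv_fourier_partial_deriv:
  assumes h: "test_fun h"
  shows "inv_fourier (partial_deriv i h) x = - \<i> * x $ i * inv_fourier h x"
proof -
  let ?F = "\<lambda>\<xi>. cis (x \<bullet> \<xi>) * h \<xi>"
  let ?dh = "partial_deriv i h"
  have D: "(?F has_derivative (\<lambda>y. cis (x \<bullet> \<xi>) * frechet_derivative h (at \<xi>) y
       + \<i> * (x \<bullet> y) * cis (x \<bullet> \<xi>) * h \<xi>)) (at \<xi>)" for \<xi>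
  proof -
    have hd: "(h has_derivative frechet_derivative h (at \<xi>)) (at \<xi>)"
      using h test_fun_smooth smooth_differentiable frechet_derivative_works by blast
    have "((\<lambda>\<xi>. \<i> * complex_of_real (x \<bullet> \<xi>)) has_derivative (\<lambda>y. \<i> * complex_of_real (x \<bullet> y))) (at \<xi>)"
      by (auto intro!: derivative_eq_intros)
    then have "((\<lambda>\<xi>. exp (\<i> * complex_of_real (x \<bullet> \<xi>))) has_derivative
       (\<lambda>y. exp (\<i> * complex_of_real (x \<bullet> \<xi>)) * (\<i> * complex_of_real (x \<bullet> y)))) (at \<xi>)"
      by (rule has_derivative_compose[of _ _ _ _ exp "\<lambda>y. exp (\<i> * complex_of_real (x \<bullet> \<xi>)) * y"])
         (use DERIV_exp[of "\<i> * complex_of_real (x \<bullet> \<xi>)"] in \<open>simp add: has_field_derivative_def\<close>)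
    from has_derivative_mult[OF this hd] show ?thesis
      by (simp add: cis_conv_exp mult_ac)
  qed
  have dF: "partial_deriv i ?F = (\<lambda>\<xi>. cis (x \<bullet> \<xi>) * ?dh \<xi> + \<i> * x $ i * (cis (x \<bullet> \<xi>) * h \<xi>))"
    using partial_deriv_eqI[OF D] by (auto simp: fun_eq_iff partial_deriv_def inner_axis)
  have dh: "test_fun ?dh" using h by (rule test_fun_partial_deriv)
  have i: "integrable lborel (\<lambda>\<xi>. cis (x \<bullet> \<xi>) * ?dh \<xi>)" "integrable lborel ?F"
    by (intro integrable_cis_mult test_fun_integrable h dh; measurable)+
  have "(LINT \<xi>|lborel. partial_deriv i ?F \<xi>) = 0"
  proof (rule integral_partial_deriv_zero)
    show "continuous_on UNIV (partial_deriv i ?F)"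
      unfolding dF unfolding cis_conv_exp
      by (intro continuous_intros test_fun_continuous h dh)
    show "?F differentiable at \<xi>" for \<xi> using D by (auto simp: differentiable_def)
    show "integrable lborel (partial_deriv i ?F)" unfolding dF using i by simp
  qed (rule i)
  then have "(LINT \<xi>|lborel. cis (x \<bullet> \<xi>) * ?dh \<xi>) = - \<i> * x $ i * (LINT \<xi>|lborel. cis (x \<bullet> \<xi>) * h \<xi>)"
    unfolding dF
    by (subst (asm) Bochner_Integration.integral_add)
       (use i in \<open>simp_all add: integrable_mult_right eq_neg_iff_add_eq_0 del: mult_minus_left\<close>)
  then show ?thesis by (simp only: inv_fourier_def times_divide_eq_right)
qed

text \<open>Four derivatives of \<open>h\<close> in direction \<open>i\<close> become multiplication
  of the transform by the fourth power of \<open>x $ i\<close>. The exponent 4 exceeds the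
  dimension, so \<open>integrable_decay\<close> applies.\<close>

lemma
  assumes h: "test_fun h"
  shows inv_fourier_decay: "\<exists>D. \<forall>x. norm x ^ 4 * norm (inv_fourier h x) \<le> D"
    and integrable_inv_fourier: "integrable lborel (inv_fourier h)"
    and smooth_inv_fourier_test: "smooth (inv_fourier h)"
    and inv_fourier_bounded: "\<exists>C. \<forall>x. norm (inv_fourier h x) \<le> C"
proof -
  let ?d = "\<lambda>i. partial_deriv i (partial_deriv i (partial_deriv i (partial_deriv i h)))"
  let ?D = "\<Sum>i\<in>UNIV. (LINT \<xi>|lborel. norm (?d i \<xi>)) / (2 * pi) ^ 3"
  have two: "inv_fourier (partial_deriv i (partial_deriv i g)) x = - (complex_of_real (x $ i))\<^sup>2 * inv_fourier g x"
    if "test_fun g" for g i x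
  proof -
    have "inv_fourier (partial_deriv i (partial_deriv i g)) x = (\<i> * \<i>) * ((complex_of_real (x $ i))\<^sup>2 * inv_fourier g x)"
      unfolding inv_fourier_partial_deriv[OF test_fun_partial_deriv[OF that]] inv_fourier_partial_deriv[OF that]
      by (simp only: power2_eq_square mult_minus_left mult_minus_right minus_minus mult_ac)
    then show ?thesis by simp
  qed
  have "complex_of_real (x $ i ^ 4) * inv_fourier h x = inv_fourier (?d i) x" for i x
    by (simp add: two h test_fun_partial_deriv flip: mult.assoc power_add)
  note eq = this
  have *: "(x $ i) ^ 4 * norm (inv_fourier h x) = norm (inv_fourier (?d i) x)" for i x
    unfolding eq[symmetric] norm_mult norm_of_real by simp
  have "norm x ^ 4 * norm (inv_fourier h x) \<le> 3 * ?D" for x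
  proof -
    have "norm x ^ 4 = ((norm x)\<^sup>2)\<^sup>2" by simp
    also have "(norm x)\<^sup>2 = (\<Sum>i\<in>UNIV. (x $ i)\<^sup>2)"
      by (simp only: power2_norm_eq_inner inner_vec_def) (simp add: power2_eq_square)
    also have "(\<Sum>i\<in>UNIV. (x $ i)\<^sup>2)\<^sup>2 \<le> 3 * (\<Sum>i\<in>UNIV. (x $ i) ^ 4)"
    proof -
      have "(a + b + c)\<^sup>2 \<le> 3 * (a\<^sup>2 + b\<^sup>2 + c\<^sup>2)" for a b c :: real
        using zero_le_power2[of "a - b"] zero_le_power2[of "b - c"] zero_le_power2[of "a - c"]
        by (simp add: power2_eq_square algebra_simps)
      from this[of "(x$1)\<^sup>2" "(x$2)\<^sup>2" "(x$3)\<^sup>2"] show ?thesis by (simp add: sum_3)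
    qed
    finally have "norm x ^ 4 * norm (inv_fourier h x) \<le> 3 * (\<Sum>i\<in>UNIV. (x $ i) ^ 4) * norm (inv_fourier h x)"
      by (intro mult_right_mono) auto
    also have "\<dots> = 3 * (\<Sum>i\<in>UNIV. norm (inv_fourier (?d i) x))"
      by (simp add: * sum_distrib_right mult.assoc)
    also have "\<dots> \<le> 3 * ?D"
      by (intro mult_left_mono sum_mono norm_inv_fourier_le) auto
    finally show ?thesis .
  qed
  then show D: "\<exists>D. \<forall>x. norm x ^ 4 * norm (inv_fourier h x) \<le> D" by blast
  show sm: "smooth (inv_fourier h)"
    using h by (intro smooth_inv_fourier test_fun_integrable test_fun_bounded_support)
  show C: "\<exists>C. \<forall>x. norm (inv_fourier h x) \<le> C"
    using norm_inv_fourier_le by blast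
  show "integrable lborel (inv_fourier h)"
    using C D integrable_decay[OF smooth_measurable[OF sm]] by blast
qed


section \<open>Fourier inversion\<close>

lemma integral_pos_continuous:
  fixes f :: "'a::euclidean_space \<Rightarrow> real"
  assumes cont: "continuous_on UNIV f" and int: "integrable lborel f"
    and nn: "\<And>x. 0 \<le> f x" and pos: "0 < f a"
  shows "0 < (LINT x|lborel. f x)"
proof -
  have "open {x. f a / 2 < f x}"
    using cont by (intro open_Collect_less continuous_intros)
  then obtain e where e: "e > 0" "ball a e \<subseteq> {x. f a / 2 < f x}"
    by (rule openE[of _ a]) (use pos in auto)
  have i: "integrable lborel (\<lambda>x. f a / 2 * indicator (ball a e) x)"
    using emeasure_lborel_ball_finite[of a e]
    by (intro integrable_mult_right integrable_real_indicator) (auto simp: less_top)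
  have "0 < f a / 2 * measure lborel (ball a e)"
    using content_ball_pos[OF e(1), of a] pos by simp
  also have "\<dots> = (LINT x|lborel. f a / 2 * indicator (ball a e) x)" by simp
  also have "\<dots> \<le> (LINT x|lborel. f x)"
  proof (rule integral_mono[OF i int])
    fix x show "f a / 2 * indicator (ball a e) x \<le> f x"
      using e(2) nn[of x] by (cases "x \<in> ball a e") auto
  qed
  finally show ?thesis .
qed

lemma
  assumes "lp_cutoff chi"
  shows cutoff_smooth: "smooth chi"
    and cutoff_support: "closure {\<xi>. chi \<xi> \<noteq> 0} \<subseteq> ball 0 1"
    and cutoff_radial: "norm \<xi> = norm \<eta> \<Longrightarrow> chi \<xi> = chi \<eta>"
    and cutoff_nonneg: "0 \<le> chi \<xi>"
    and cutoff_inner: "norm \<xi> \<le> 1/2 \<Longrightarrow> chi \<xi> = 1"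
proof -
  note c = assms[unfolded lp_cutoff_def]
  show "smooth chi" by (rule c[THEN conjunct1])
  show "closure {\<xi>. chi \<xi> \<noteq> 0} \<subseteq> ball 0 1" by (rule c[THEN conjunct2, THEN conjunct1])
  show "0 \<le> chi \<xi>" by (rule c[THEN conjunct2, THEN conjunct2, THEN conjunct1, rule_format])
  show "norm \<xi> = norm \<eta> \<Longrightarrow> chi \<xi> = chi \<eta>"
    by (rule c[THEN conjunct2, THEN conjunct2, THEN conjunct2, THEN conjunct1, rule_format])
  show "norm \<xi> \<le> 1/2 \<Longrightarrow> chi \<xi> = 1"
    by (rule c[THEN conjunct2, THEN conjunct2, THEN conjunct2, THEN conjunct2, rule_format])
qed

lemma cutoff_even: "lp_cutoff chi \<Longrightarrow> chi (- \<xi>) = chi \<xi>"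
  by (rule cutoff_radial) simp_all

lemma cutoff_test_fun:
  assumes "lp_cutoff chi"
  shows "test_fun (\<lambda>\<xi>. complex_of_real (chi \<xi>))"
proof -
  have "chi \<xi> = 0" if "1 < norm \<xi>" for \<xi>
  proof (rule ccontr)
    assume "chi \<xi> \<noteq> 0"
    then have "\<xi> \<in> closure {\<xi>. chi \<xi> \<noteq> 0}" by (intro subsetD[OF closure_subset]) simp
    then have "\<xi> \<in> ball 0 1" using cutoff_support[OF assms] by blast
    then show False using that by simp
  qed
  then have "bounded_support (\<lambda>\<xi>. complex_of_real (chi \<xi>))"
    unfolding bounded_support_def by auto
  moreover have "smooth (\<lambda>\<xi>. complex_of_real (chi \<xi>))"
    by (rule smooth_bounded_linear[OF bounded_linear_of_real cutoff_smooth[OF assms]])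
  ultimately show "test_fun (\<lambda>\<xi>. complex_of_real (chi \<xi>))"
    by (simp add: test_fun_def)
qed

definition inversion_const :: "(real^3 \<Rightarrow> real) \<Rightarrow> complex" where
  "inversion_const chi = (LINT x|lborel. inv_fourier (\<lambda>\<xi>. complex_of_real (chi \<xi>)) x)"

text \<open>The constant is \<open>1\<close>, but only its positivity is needed; this avoids Gaussian integrals. The
  regularising factor in the proof is \<open>chi\<close> itself.\<close>

lemma fourier_inv_fourier:
  assumes chi: "lp_cutoff chi" and h: "test_fun h"
  shows "fourier (inv_fourier h) \<xi> = inversion_const chi * h \<xi>"
proof -
  define C where "C = (\<lambda>\<xi>. complex_of_real (chi \<xi>))"
  have C: "test_fun C" unfolding C_def by (rule cutoff_test_fun[OF chi])
  define m where "m n = real (Suc n)" for n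
  have m: "m n > 0" for n by (simp add: m_def)
  let ?T = "inv_fourier C"
  let ?k = "\<lambda>n x. cis (- (x \<bullet> \<xi>)) * C (x /\<^sub>R m n)"
  obtain B where B: "\<And>x. norm (C x) \<le> B" using test_fun_bounded[OF C] by blast
  obtain H where H: "\<And>x. norm (h x) \<le> H" using test_fun_bounded[OF h] by blast
  have ih: "integrable lborel (inv_fourier h)" and iT: "integrable lborel ?T"
    using h C integrable_inv_fourier by auto
  note [measurable] = test_fun_measurable[OF C] test_fun_measurable[OF h]
  have mh [measurable]: "inv_fourier h \<in> borel_measurable borel" "?T \<in> borel_measurable borel"
    using ih iT by auto
  \<comment> \<open>Since \<open>chi\<close> is 1 near the origin, the regularising factor at a
    fixed \<open>x\<close> is eventually equal to the pure exponential.\<close>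
  have lim1: "(\<lambda>n. LINT x|lborel. ?k n x * inv_fourier h x) \<longlonglongrightarrow> (LINT x|lborel. cis (- (x \<bullet> \<xi>)) * inv_fourier h x)"
  proof (rule integral_dominated_convergence[where w = "\<lambda>x. B * norm (inv_fourier h x)"])
    show "AE x in lborel. (\<lambda>n. ?k n x * inv_fourier h x) \<longlonglongrightarrow> cis (- (x \<bullet> \<xi>)) * inv_fourier h x"
    proof (rule AE_I2)
      fix x :: "real^3"
      have "\<forall>\<^sub>F n in sequentially. ?k n x * inv_fourier h x = cis (- (x \<bullet> \<xi>)) * inv_fourier h x"
      proof (rule eventually_sequentiallyI)
        fix n assume "nat \<lceil>2 * norm x\<rceil> \<le> n"
        then have "2 * norm x \<le> m n" unfolding m_def by linarith
        then have "norm (x /\<^sub>R m n) \<le> 1/2"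
          using m[of n] by (simp add: field_simps)
        then have "C (x /\<^sub>R m n) = 1" unfolding C_def using cutoff_inner[OF chi] by simp
        then show "?k n x * inv_fourier h x = cis (- (x \<bullet> \<xi>)) * inv_fourier h x" by simp
      qed
      then show "(\<lambda>n. ?k n x * inv_fourier h x) \<longlonglongrightarrow> cis (- (x \<bullet> \<xi>)) * inv_fourier h x"
        by (rule tendsto_eventually)
    qed
    show "AE x in lborel. norm (?k n x * inv_fourier h x) \<le> B * norm (inv_fourier h x)" for n
      using B by (intro AE_I2) (auto simp: norm_mult intro!: mult_right_mono)
  qed (use ih in auto)
  \<comment> \<open>Duality moves the inverse transform from \<open>h\<close> to the regularising
    factor. Its transform is a rescaled copy of the one of \<open>chi\<close>, an approximate
    identity around \<xi> whose total mass is the constant sought.\<close>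
  have eq: "(LINT x|lborel. ?k n x * inv_fourier h x) = (LINT \<zeta>|lborel. ?T \<zeta> * h (\<xi> + \<zeta> /\<^sub>R m n))" for n
  proof -
    have iC: "integrable lborel (\<lambda>x. C (x /\<^sub>R m n))"
      using integrable_affine[OF test_fun_integrable[OF C], of "inverse (m n)" 0] m[of n] by simp
    have ik: "integrable lborel (?k n)"
      by (rule integrable_cis_mult[OF iC]) measurable
    have Ik: "inv_fourier (?k n) \<eta> = of_real (m n ^ 3) * ?T (m n *\<^sub>R (\<eta> - \<xi>))" for \<eta>
      by (simp only: inv_fourier_modulate inv_fourier_dilate[OF test_fun_integrable[OF C] m])
    let ?F = "\<lambda>\<zeta>. ?T \<zeta> * h (\<xi> + \<zeta> /\<^sub>R m n)"
    have iF: "integrable lborel ?F"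
      by (rule integrable_mult_bounded(2)[OF iT _ H]) measurable
    have "(LINT x|lborel. ?k n x * inv_fourier h x) = (LINT \<eta>|lborel. inv_fourier (?k n) \<eta> * h \<eta>)"
      by (rule inv_fourier_duality[OF ik test_fun_integrable[OF h]])
    also have "\<dots> = of_real (m n ^ 3) * (LINT \<eta>|lborel. ?F (- (m n *\<^sub>R \<xi>) + m n *\<^sub>R \<eta>))"
    proof -
      have "?F (- (m n *\<^sub>R \<xi>) + m n *\<^sub>R \<eta>) = ?T (m n *\<^sub>R (\<eta> - \<xi>)) * h \<eta>" for \<eta>
      proof -
        have 1: "- (m n *\<^sub>R \<xi>) + m n *\<^sub>R \<eta> = m n *\<^sub>R (\<eta> - \<xi>)" by (simp add: algebra_simps)
        show ?thesis using m[of n] unfolding 1 by simp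
      qed
      then show ?thesis unfolding Ik by (simp only: mult.assoc integral_mult_right_zero)
    qed
    also have "\<dots> = of_real (m n ^ 3) * ((LINT \<zeta>|lborel. ?F \<zeta>) /\<^sub>R (m n ^ 3))"
      using integral_affine[OF iF, of "m n" "- (m n *\<^sub>R \<xi>)"] m[of n] by simp
    also have "\<dots> = (LINT \<zeta>|lborel. ?F \<zeta>)"
      using m[of n] by (simp add: scaleR_conv_of_real field_simps)
    finally show ?thesis .
  qed
  have lim2: "(\<lambda>n. LINT \<zeta>|lborel. ?T \<zeta> * h (\<xi> + \<zeta> /\<^sub>R m n)) \<longlonglongrightarrow> (LINT \<zeta>|lborel. ?T \<zeta> * h \<xi>)"
  proof (rule integral_dominated_convergence[where w = "\<lambda>x. norm (?T x) * H"])
    show "AE \<zeta> in lborel. (\<lambda>n. ?T \<zeta> * h (\<xi> + \<zeta> /\<^sub>R m n)) \<longlonglongrightarrow> ?T \<zeta> * h \<xi>"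
    proof (rule AE_I2)
      fix \<zeta> :: "real^3"
      have "(\<lambda>n. inverse (m n)) \<longlonglongrightarrow> 0"
        unfolding m_def by (rule LIMSEQ_inverse_real_of_nat)
      then have "(\<lambda>n. \<xi> + \<zeta> /\<^sub>R m n) \<longlonglongrightarrow> \<xi> + 0 *\<^sub>R \<zeta>"
        by (intro tendsto_intros)
      moreover have "isCont h \<xi>"
        using test_fun_continuous[OF h] by (simp add: continuous_on_eq_continuous_at)
      ultimately show "(\<lambda>n. ?T \<zeta> * h (\<xi> + \<zeta> /\<^sub>R m n)) \<longlonglongrightarrow> ?T \<zeta> * h \<xi>"
        by (intro tendsto_intros isCont_tendsto_compose[where g = h]) auto
    qed
    show "AE \<zeta> in lborel. norm (?T \<zeta> * h (\<xi> + \<zeta> /\<^sub>R m n)) \<le> norm (?T \<zeta>) * H" for n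
      using H by (intro AE_I2) (auto simp: norm_mult intro!: mult_left_mono)
  qed (use iT in auto)
  have "(LINT x|lborel. cis (- (x \<bullet> \<xi>)) * inv_fourier h x) = (LINT \<zeta>|lborel. ?T \<zeta> * h \<xi>)"
    using lim1 lim2 unfolding eq by (rule LIMSEQ_unique)
  then show ?thesis
    unfolding fourier_def inversion_const_def C_def by simp
qed

text \<open>A Plancherel identity for \<open>chi\<close> itself: duality applied to
  \<open>chi\<close> and its inverse transform writes the constant as a quotient of two integrals of
  squares. Both are positive, since \<open>chi\<close> is 1 at the origin and its inverse transform
  there is a positive multiple of the integral of \<open>chi\<close>.\<close>

lemma inversion_const_pos:
  assumes chi: "lp_cutoff chi"
  obtains k where "k > 0" "inversion_const chi = complex_of_real k"
proof -
  define C where "C = (\<lambda>\<xi>. complex_of_real (chi \<xi>))"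
  have C: "test_fun C" unfolding C_def by (rule cutoff_test_fun[OF chi])
  let ?T = "inv_fourier C"
  have iT: "integrable lborel ?T" and iC: "integrable lborel C"
    using C integrable_inv_fourier test_fun_integrable by auto
  have contC: "continuous_on UNIV C" and contT: "continuous_on UNIV ?T"
    using C test_fun_continuous smooth_inv_fourier_test smooth_continuous by auto
  have chiC: "chi \<xi> = Re (C \<xi>)" for \<xi> by (simp add: C_def)
  have contchi: "continuous_on UNIV chi"
    unfolding chiC[abs_def] by (intro continuous_intros contC)
  obtain B where B: "\<And>x. norm (C x) \<le> B" using test_fun_bounded[OF C] by blast
  obtain T where T: "\<And>x. norm (?T x) \<le> T" using inv_fourier_bounded[OF C] by blast
  define p where "p = (LINT x|lborel. (norm (?T x))\<^sup>2)"
  define q where "q = (LINT x|lborel. (chi x)\<^sup>2)"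
  have CC: "integrable lborel (\<lambda>x. C x * C x)" and TT: "integrable lborel (\<lambda>x. ?T x * ?T x)"
    using iC B iT T by (auto intro!: integrable_mult_bounded)
  have "chi 0 = 1" using cutoff_inner[OF chi, of 0] by simp
  have q: "q > 0" unfolding q_def
  proof (rule integral_pos_continuous)
    show "integrable lborel (\<lambda>x. (chi x)\<^sup>2)"
      using integrable_Re[OF CC] by (simp add: C_def power2_eq_square)
    show "0 < (chi 0)\<^sup>2" using \<open>chi 0 = 1\<close> by simp
  qed (auto intro!: continuous_intros contchi)
  have "(LINT x|lborel. C x) = of_real (LINT x|lborel. chi x)"
    unfolding C_def by simp
  moreover have "0 < (LINT x|lborel. chi x)"
    using integrable_Re[OF iC] \<open>chi 0 = 1\<close> cutoff_nonneg[OF chi] contchi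
    by (intro integral_pos_continuous[of chi 0]) (auto simp: C_def)
  ultimately have "?T 0 \<noteq> 0" by (simp add: inv_fourier_def)
  have p: "p > 0" unfolding p_def
  proof (rule integral_pos_continuous)
    show "integrable lborel (\<lambda>x. (norm (?T x))\<^sup>2)"
      using integrable_norm[OF TT] by (simp add: norm_mult power2_eq_square)
    show "0 < (norm (?T 0))\<^sup>2" using \<open>?T 0 \<noteq> 0\<close> by simp
  qed (auto intro!: continuous_intros contT)
  have cnjT: "fourier C x = (2 * pi) ^ 3 * cnj (?T x)" for x
  proof -
    have "cnj (LINT \<xi>|lborel. cis (x \<bullet> \<xi>) * C \<xi>) = (LINT \<xi>|lborel. cnj (cis (x \<bullet> \<xi>) * C \<xi>))"
      by (rule Bochner_Integration.integral_cnj[symmetric])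
    also have "\<dots> = fourier C x"
      unfolding fourier_def by (intro Bochner_Integration.integral_cong) (simp_all add: C_def cis_cnj inner_commute)
    finally show ?thesis by (simp add: inv_fourier_def)
  qed
  have "(LINT x|lborel. ?T x * fourier C x) = (LINT x|lborel. fourier ?T x * C x)"
    by (rule fourier_duality[OF iT iC])
  also have "\<dots> = inversion_const chi * (LINT x|lborel. C x * C x)"
    by (simp add: fourier_inv_fourier[OF chi C] mult.assoc)
  also have "(LINT x|lborel. C x * C x) = of_real q"
    unfolding q_def C_def by (simp add: power2_eq_square flip: of_real_mult)
  also have "(LINT x|lborel. ?T x * fourier C x) = of_real ((2 * pi) ^ 3 * p)"
  proof -
    have "?T x * fourier C x = of_real ((2 * pi) ^ 3 * (norm (?T x))\<^sup>2)" for x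
      unfolding of_real_mult complex_norm_square cnjT by (simp add: mult_ac)
    then show ?thesis unfolding p_def by (simp del: of_real_mult of_real_power)
  qed
  finally have "inversion_const chi = of_real ((2 * pi) ^ 3 * p / q)"
    using q by (simp add: field_simps)
  with p q that[of "(2 * pi) ^ 3 * p / q"] show ?thesis by simp
qed

section \<open>Identification of distributions with functions\<close>

text \<open>Uniqueness behind the definite description: two smooth representatives have the same
  integral against every Schwartz function, and a nonzero difference would be detected by a bump,
  for which a translated and dilated cutoff serves.\<close>

lemma smooth_rep_eq:
  assumes chi: "lp_cutoff chi" and G: "smooth G" "represents G T"
  shows "smooth_rep T = G"
  unfolding smooth_rep_def
proof (rule the_equality)
  fix g assume g: "smooth g \<and> represents g T"
  define d where "d x = g x - G x" for x
  have contd: "continuous_on UNIV d"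
    unfolding d_def using g G by (intro continuous_intros smooth_continuous) auto
  have int0: "integrable lborel (\<lambda>x. d x * f x)" "(LINT x|lborel. d x * f x) = 0" if "schwartz f" for f
  proof -
    have *: "integrable lborel (\<lambda>x. g x * f x)" "integrable lborel (\<lambda>x. G x * f x)"
       "(LINT x|lborel. g x * f x) = (LINT x|lborel. G x * f x)"
      using g G that unfolding represents_def distr_of_def by metis+
    then show "integrable lborel (\<lambda>x. d x * f x)" "(LINT x|lborel. d x * f x) = 0"
      unfolding d_def left_diff_distrib by simp_all
  qed
  have "d a = 0" for a
  proof (rule ccontr)
    assume "d a \<noteq> 0"
    \<comment> \<open>The factor \<open>cnj (d a)\<close> makes the real part positive at
      \<open>a\<close>, so that one real bump detects a complex difference.\<close>
    let ?r = "\<lambda>x. Re (d x * cnj (d a))"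
    have ra: "?r a > 0" using \<open>d a \<noteq> 0\<close> by (auto simp: complex_eq_iff sum_squares_gt_zero_iff)
    have contr: "continuous_on UNIV ?r" by (intro continuous_intros contd)
    then have "open {x. 0 < ?r x}" by (intro open_Collect_less[OF continuous_on_const])
    then obtain e where e: "e > 0" "ball a e \<subseteq> {x. 0 < ?r x}"
      by (rule openE[of _ a]) (use ra in auto)
    define b where "b x = chi (- (inverse e *\<^sub>R a) + inverse e *\<^sub>R x)" for x
    have b: "test_fun (\<lambda>x. complex_of_real (b x))"
      unfolding b_def by (rule test_fun_affine[OF cutoff_test_fun[OF chi]]) (use e(1) in simp)
    have barg: "- (inverse e *\<^sub>R a) + inverse e *\<^sub>R x = (x - a) /\<^sub>R e" for x
      by (simp add: algebra_simps)
    have bsupp: "b x = 0" if "\<not> dist a x < e" for x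
    proof -
      have "\<not> norm ((x - a) /\<^sub>R e) < 1"
        using that e(1) by (simp add: dist_norm norm_minus_commute divide_simps)
      then have "(x - a) /\<^sub>R e \<notin> ball 0 1" by simp
      moreover have "{\<xi>. chi \<xi> \<noteq> 0} \<subseteq> ball 0 1"
        by (rule order_trans[OF closure_subset cutoff_support[OF chi]])
      ultimately show ?thesis
        unfolding b_def barg by blast
    qed
    let ?f = "\<lambda>x. cnj (d a) * complex_of_real (b x)"
    have f: "schwartz ?f" using b by (intro test_fun_schwartz test_fun_cmult)
    have Re: "Re (d x * ?f x) = b x * ?r x" for x
      by (simp add: algebra_simps)
    have "0 < (LINT x|lborel. b x * ?r x)"
    proof (rule integral_pos_continuous)
      have "continuous_on UNIV (\<lambda>x. Re (complex_of_real (b x)))"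
        by (rule continuous_on_Re[OF test_fun_continuous[OF b]])
      then have "continuous_on UNIV b" by simp
      then show "continuous_on UNIV (\<lambda>x. b x * ?r x)"
        by (rule continuous_on_mult[OF _ contr])
      show "integrable lborel (\<lambda>x. b x * ?r x)"
        using integrable_Re[OF int0(1)[OF f]] unfolding Re .
      show "0 \<le> b x * ?r x" for x
      proof (cases "dist a x < e")
        case True
        then have "0 < ?r x" using e by auto
        then show ?thesis using cutoff_nonneg[OF chi] by (auto simp: b_def intro!: mult_nonneg_nonneg)
      qed (use bsupp in auto)
      show "0 < b a * ?r a"
        using ra cutoff_inner[OF chi, of 0] by (simp add: b_def)
    qed
    also have "\<dots> = Re (LINT x|lborel. d x * ?f x)"
      using integral_Re[OF int0(1)[OF f]] unfolding Re by simp
    also have "\<dots> = 0" using int0(2)[OF f] by simp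
    finally show False by simp
  qed
  then show "g = G" by (auto simp: d_def)
qed (use G in auto)

lemma bounded_representsI:
  assumes "g \<in> borel_measurable borel" "\<And>x. norm (g x) \<le> C"
    and "\<And>f. schwartz f \<Longrightarrow> T f = distr_of g f"
  shows "represents g T"
  using assms(3) integrable_mult_bounded(1)[OF schwartz_integrable assms(1,2)] by (auto simp: represents_def)

text \<open>Duality is used twice: to move the outer transform from the test function onto
  \<open>g\<close>, and then to move the inverse transform from the test function onto the product
  with the symbol.\<close>

lemma
  assumes g: "integrable lborel g" and m: "test_fun (\<lambda>\<xi>. complex_of_real (m \<xi>))"
  shows integrable_multiplier_symbol: "integrable lborel (\<lambda>\<xi>. m \<xi> * fourier g \<xi>)"
    and bounded_support_multiplier_symbol: "bounded_support (\<lambda>\<xi>. m \<xi> * fourier g \<xi>)"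
    and multiplier_pairing_integrable:
      "integrable lborel f \<Longrightarrow> integrable lborel (\<lambda>\<xi>. fourier g \<xi> * (m \<xi> * inv_fourier f \<xi>))"
    and multiplier_pairing:
      "integrable lborel f \<Longrightarrow> multiplier m (distr_of g) f = (LINT \<xi>|lborel. fourier g \<xi> * (m \<xi> * inv_fourier f \<xi>))"
    and represents_multiplier:
      "represents (inv_fourier (\<lambda>\<xi>. m \<xi> * fourier g \<xi>)) (multiplier m (distr_of g))"
proof -
  have im: "integrable lborel (\<lambda>\<xi>. complex_of_real (m \<xi>))" using m by (rule test_fun_integrable)
  show imF: "integrable lborel (\<lambda>\<xi>. m \<xi> * fourier g \<xi>)"
    by (rule integrable_mult_bounded(2)[OF im fourier_measurable[OF g] norm_fourier_le])
  show "bounded_support (\<lambda>\<xi>. m \<xi> * fourier g \<xi>)"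
    using test_fun_bounded_support[OF m] by (rule bounded_support_mono) auto
  have pair: "integrable lborel (\<lambda>\<xi>. fourier g \<xi> * (m \<xi> * inv_fourier f \<xi>))"
    "multiplier m (distr_of g) f = (LINT \<xi>|lborel. fourier g \<xi> * (m \<xi> * inv_fourier f \<xi>))"
    "multiplier m (distr_of g) f = distr_of (inv_fourier (\<lambda>\<xi>. m \<xi> * fourier g \<xi>)) f"
    if f: "integrable lborel f" for f
  proof -
    have imI: "integrable lborel (\<lambda>\<xi>. m \<xi> * inv_fourier f \<xi>)"
      by (rule integrable_mult_bounded(2)[OF im inv_fourier_measurable[OF f] norm_inv_fourier_le])
    show "integrable lborel (\<lambda>\<xi>. fourier g \<xi> * (m \<xi> * inv_fourier f \<xi>))"
      by (rule integrable_mult_bounded(1)[OF imI fourier_measurable[OF g] norm_fourier_le])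
    show "multiplier m (distr_of g) f = (LINT \<xi>|lborel. fourier g \<xi> * (m \<xi> * inv_fourier f \<xi>))"
      unfolding multiplier_def distr_inv_fourier_def distr_mult_def distr_fourier_def distr_of_def
      by (rule fourier_duality[OF g imI])
    also have "\<dots> = (LINT \<xi>|lborel. (m \<xi> * fourier g \<xi>) * inv_fourier f \<xi>)"
      by (simp add: mult_ac)
    also have "\<dots> = distr_of (inv_fourier (\<lambda>\<xi>. m \<xi> * fourier g \<xi>)) f"
      unfolding distr_of_def by (rule inv_fourier_duality[OF imF f])
    finally show "multiplier m (distr_of g) f = distr_of (inv_fourier (\<lambda>\<xi>. m \<xi> * fourier g \<xi>)) f" .
  qed
  show "integrable lborel f \<Longrightarrow> integrable lborel (\<lambda>\<xi>. fourier g \<xi> * (m \<xi> * inv_fourier f \<xi>))"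
    "integrable lborel f \<Longrightarrow> multiplier m (distr_of g) f = (LINT \<xi>|lborel. fourier g \<xi> * (m \<xi> * inv_fourier f \<xi>))"
    using pair by blast+
  show "represents (inv_fourier (\<lambda>\<xi>. m \<xi> * fourier g \<xi>)) (multiplier m (distr_of g))"
    by (rule bounded_representsI[OF inv_fourier_measurable[OF imF] norm_inv_fourier_le])
       (use pair(3) schwartz_integrable in auto)
qed

lemma cutoff_dilate_test_fun:
  assumes "lp_cutoff chi" "c \<noteq> 0"
  shows "test_fun (\<lambda>\<xi>. complex_of_real (chi (\<xi> /\<^sub>R c)))"
  using test_fun_affine[OF cutoff_test_fun[OF assms(1)], of "inverse c" 0] assms(2) by simp

lemma lp_symbol_test_fun:
  assumes chi: "lp_cutoff chi"
  shows "test_fun (\<lambda>\<xi>. complex_of_real (lp_symbol chi q \<xi>))"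
proof (cases "q = -1")
  case False
  have "lp_freq q * 2 \<noteq> 0" "lp_freq q \<noteq> 0" by (auto simp: lp_freq_def)
  from test_fun_diff[OF this[THEN cutoff_dilate_test_fun[OF chi]]] show ?thesis
    using False by (simp add: lp_symbol_def lp_phi_def mult.commute)
qed (simp add: lp_symbol_def cutoff_test_fun[OF chi])

lemma represents_lp_sum:
  assumes chi: "lp_cutoff chi" and g: "integrable lborel g"
  shows "represents (inv_fourier (\<lambda>\<xi>. chi (\<xi> /\<^sub>R 2 ^ Suc Q) * fourier g \<xi>)) (lp_sum chi (int Q) (distr_of g))"
proof -
  have m: "test_fun (\<lambda>\<xi>. complex_of_real (chi (\<xi> /\<^sub>R 2 ^ Suc Q)))"
    by (rule cutoff_dilate_test_fun[OF chi]) simp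
  have "lp_sum chi (int Q) (distr_of g) f = multiplier (\<lambda>\<xi>. chi (\<xi> /\<^sub>R 2 ^ Suc Q)) (distr_of g) f"
    if f: "schwartz f" for f
  proof -
    note s = lp_symbol_test_fun[OF chi]
    have "lp_sum chi (int Q) (distr_of g) f
        = (\<Sum>q = -1..int Q. LINT \<xi>|lborel. fourier g \<xi> * (lp_symbol chi q \<xi> * inv_fourier f \<xi>))"
      unfolding lp_sum_def lp_block_def
      by (simp add: multiplier_pairing[OF g s schwartz_integrable[OF f]])
    also have "\<dots> = (LINT \<xi>|lborel. (\<Sum>q = -1..int Q. fourier g \<xi> * (lp_symbol chi q \<xi> * inv_fourier f \<xi>)))"
      by (rule Bochner_Integration.integral_sum[symmetric])
         (rule multiplier_pairing_integrable[OF g s schwartz_integrable[OF f]])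
    also have "\<dots> = (LINT \<xi>|lborel. fourier g \<xi> * (chi (\<xi> /\<^sub>R 2 ^ Suc Q) * inv_fourier f \<xi>))"
    proof (rule Bochner_Integration.integral_cong[OF refl])
      fix \<xi>
      \<comment> \<open>The sum telescopes with a shift by one: the blocks up to \<open>Q\<close>
        add up to the cutoff at scale \<open>2^(Q+1)\<close>.\<close>
      have "(\<Sum>q = -1..int Q. lp_symbol chi q \<xi>) = chi (\<xi> /\<^sub>R 2 ^ Suc Q)"
        using sum_lp_symbol[of chi \<xi> "Suc Q"] by (simp add: lp_freq_def del: of_nat_Suc) (simp add: add.commute)
      then show "(\<Sum>q = -1..int Q. fourier g \<xi> * (lp_symbol chi q \<xi> * inv_fourier f \<xi>))
          = fourier g \<xi> * (chi (\<xi> /\<^sub>R 2 ^ Suc Q) * inv_fourier f \<xi>)"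
        by (simp only: sum_distrib_left[symmetric] sum_distrib_right[symmetric] of_real_sum[symmetric])
    qed
    also have "\<dots> = multiplier (\<lambda>\<xi>. chi (\<xi> /\<^sub>R 2 ^ Suc Q)) (distr_of g) f"
      by (rule multiplier_pairing[OF g m schwartz_integrable[OF f], symmetric])
    finally show ?thesis .
  qed
  then show ?thesis
    using represents_multiplier[OF g m] by (simp add: represents_def)
qed

section \<open>Solenoidal fields and trilinear integrals\<close>

lemma partial_deriv_mult:
  fixes f g :: "real^3 \<Rightarrow> complex"
  assumes "f differentiable (at x)" "g differentiable (at x)"
  shows "partial_deriv i (\<lambda>x. f x * g x) x = partial_deriv i f x * g x + f x * partial_deriv i g x"
proof -
  obtain D E where D: "(f has_derivative D) (at x)" and E: "(g has_derivative E) (at x)"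
    using assms by (auto simp: differentiable_def)
  show ?thesis
    using partial_deriv_eqI[OF has_derivative_mult[OF D E]]
    by (simp add: partial_deriv_eqI[OF D] partial_deriv_eqI[OF E] add.commute)
qed

lemma partial_deriv_inv_fourier_test:
  assumes "test_fun w"
  shows "partial_deriv i (inv_fourier w) = inv_fourier (\<lambda>\<xi>. \<i> * \<xi> $ i * w \<xi>)"
    and "test_fun (\<lambda>\<xi>. \<i> * \<xi> $ i * w \<xi>)"
  using partial_deriv_inv_fourier[OF test_fun_integrable test_fun_bounded_support, OF assms assms]
    test_fun_cmult[OF test_fun_coord[OF assms], of \<i>]
  by (auto simp: mult.assoc)

text \<open>Integration by parts. The generality of \<open>h\<close> lets it serve both for the weak
  divergence condition against Schwartz functions and for products of two waves in
  \<open>advection_antisym\<close>.\<close>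

lemma divergence_free_weak:
  fixes W :: "3 \<Rightarrow> real^3 \<Rightarrow> complex"
  assumes W: "\<And>i. test_fun (W i)" and div: "\<And>\<xi>. (\<Sum>i\<in>UNIV. \<xi> $ i * W i \<xi>) = 0"
    and h: "\<And>x. h differentiable (at x)" "\<And>i. continuous_on UNIV (partial_deriv i h)"
      "integrable lborel h" "\<And>i. integrable lborel (partial_deriv i h)"
  shows "(\<Sum>i\<in>UNIV. LINT x|lborel. inv_fourier (W i) x * partial_deriv i h x) = 0"
proof -
  let ?V = "\<lambda>i. inv_fourier (W i)" and ?dV = "\<lambda>i. partial_deriv i (inv_fourier (W i))"
  have dV: "?dV i = inv_fourier (\<lambda>\<xi>. \<i> * \<xi> $ i * W i \<xi>)" and W': "test_fun (\<lambda>\<xi>. \<i> * \<xi> $ i * W i \<xi>)" for i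
    using partial_deriv_inv_fourier_test[OF W] by auto
  have sV: "smooth (?V i)" "smooth (?dV i)" for i
    using smooth_inv_fourier_test W smooth_partial_deriv by auto
  have conth: "continuous_on UNIV h"
    using h(1) by (meson continuous_at_imp_continuous_on differentiable_imp_continuous_within)
  have i1: "integrable lborel (\<lambda>x. ?V i x * h x)" "integrable lborel (\<lambda>x. ?V i x * partial_deriv i h x)" for i
    using h(3,4)
    by (auto intro: integrable_inv_fourier_mult test_fun_integrable[OF W])
  have i2: "integrable lborel (\<lambda>x. ?dV i x * h x)" for i
    unfolding dV
    by (rule integrable_inv_fourier_mult[OF h(3) test_fun_integrable[OF W']])
  have eq: "partial_deriv i (\<lambda>x. ?V i x * h x) = (\<lambda>x. ?dV i x * h x + ?V i x * partial_deriv i h x)" for i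
    using partial_deriv_mult smooth_differentiable[OF sV(1)] h(1) by blast
  have "(LINT x|lborel. ?V i x * partial_deriv i h x) = - (LINT x|lborel. ?dV i x * h x)" for i
  proof -
    have "(LINT x|lborel. partial_deriv i (\<lambda>x. ?V i x * h x) x) = 0"
    proof (rule integral_partial_deriv_zero)
      show "(\<lambda>x. ?V i x * h x) differentiable at x" for x
        using smooth_differentiable[OF sV(1)] h(1) by (rule differentiable_mult)
      show "continuous_on UNIV (partial_deriv i (\<lambda>x. ?V i x * h x))"
        unfolding eq by (intro continuous_intros smooth_continuous sV conth h(2))
      show "integrable lborel (partial_deriv i (\<lambda>x. ?V i x * h x))"
        unfolding eq using i1 i2 by simp
    qed (rule i1)
    then have "(LINT x|lborel. ?dV i x * h x) + (LINT x|lborel. ?V i x * partial_deriv i h x) = 0"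
      unfolding eq by (subst (asm) Bochner_Integration.integral_add) (use i1 i2 in auto)
    then show ?thesis by (simp add: eq_neg_iff_add_eq_0 add.commute)
  qed
  then have "(\<Sum>i\<in>UNIV. LINT x|lborel. ?V i x * partial_deriv i h x) = - (\<Sum>i\<in>UNIV. LINT x|lborel. ?dV i x * h x)"
    by (simp add: sum_negf)
  also have "(\<Sum>i\<in>UNIV. LINT x|lborel. ?dV i x * h x) = (LINT x|lborel. (\<Sum>i\<in>UNIV. ?dV i x) * h x)"
    unfolding sum_distrib_right by (rule Bochner_Integration.integral_sum[symmetric]) (rule i2)
  also have "\<dots> = 0"
  proof -
    have "(\<Sum>i\<in>UNIV. ?dV i x) = 0" for x
    proof -
    have "(\<Sum>i\<in>UNIV. ?dV i x) = inv_fourier (\<lambda>\<xi>. \<Sum>i\<in>UNIV. \<i> * \<xi> $ i * W i \<xi>) x"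
      unfolding dV by (rule inv_fourier_sum[symmetric]) (rule test_fun_integrable[OF W'])
    also have "(\<lambda>\<xi>. \<Sum>i\<in>UNIV. \<i> * \<xi> $ i * W i \<xi>) = (\<lambda>\<xi>. 0)"
      by (simp only: mult.assoc sum_distrib_left[symmetric] div mult_zero_right)
    also have "inv_fourier (\<lambda>\<xi>. 0) x = 0" by (simp add: inv_fourier_def)
    finally show ?thesis .
    qed
    then show ?thesis by simp
  qed
  finally show ?thesis by simp
qed

text \<open>The integral of a product is its transform at frequency zero, so the three frequencies
  must sum to zero. Fourier inversion is applied to the third factor alone, hence a single inversion
  constant; the power of \<open>2 * pi\<close> comes from two normalisations.\<close>

lemma integral_triple_product:
  assumes chi: "lp_cutoff chi" and W: "test_fun W1" "test_fun W2" "test_fun W3"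
  shows "(LINT x|lborel. inv_fourier W1 x * inv_fourier W2 x * inv_fourier W3 x)
    = inversion_const chi / (2 * pi) ^ 6 * (LINT \<xi>|lborel. LINT \<eta>|lborel. W1 \<xi> * W2 \<eta> * W3 (- \<xi> - \<eta>))"
proof -
  let ?h = "inv_fourier W3"
  have i: "integrable lborel W1" "integrable lborel W2" "integrable lborel ?h"
    using W test_fun_integrable integrable_inv_fourier by auto
  have ih2: "integrable lborel (\<lambda>x. inv_fourier W2 x * ?h x)"
    by (rule integrable_inv_fourier_mult[OF i(3,2)])
  have ich: "integrable lborel (\<lambda>x. cis (\<xi> \<bullet> x) * ?h x)" for \<xi>
    by (rule integrable_cis_mult[OF i(3)]) measurable
  have shift: "inv_fourier (\<lambda>x. cis (\<xi> \<bullet> x) * ?h x) \<eta> = inversion_const chi * W3 (- \<xi> - \<eta>) / (2 * pi) ^ 3" for \<xi> \<eta>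
  proof -
    have "inv_fourier (\<lambda>x. cis (\<xi> \<bullet> x) * ?h x) \<eta> = inv_fourier ?h (\<eta> + \<xi>)"
      using inv_fourier_modulate[of "- \<xi>" ?h \<eta>] by (simp add: inner_commute)
    moreover have "- (\<eta> + \<xi>) = - \<xi> - \<eta>" by simp
    ultimately show ?thesis
      by (simp only: inv_fourier_eq[of ?h] fourier_inv_fourier[OF chi W(3)])
  qed
  have inner: "inv_fourier (\<lambda>x. inv_fourier W2 x * ?h x) \<xi>
      = inversion_const chi / (2 * pi) ^ 6 * (LINT \<eta>|lborel. W2 \<eta> * W3 (- \<xi> - \<eta>))" for \<xi>
  proof -
    have "(LINT x|lborel. cis (\<xi> \<bullet> x) * (inv_fourier W2 x * ?h x))
        = (LINT x|lborel. inv_fourier W2 x * (cis (\<xi> \<bullet> x) * ?h x))"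
      by (simp add: mult.left_commute)
    also have "\<dots> = (LINT \<eta>|lborel. W2 \<eta> * inv_fourier (\<lambda>x. cis (\<xi> \<bullet> x) * ?h x) \<eta>)"
      by (rule inv_fourier_duality[OF i(2) ich, symmetric])
    also have "\<dots> = inversion_const chi / (2 * pi) ^ 3 * (LINT \<eta>|lborel. W2 \<eta> * W3 (- \<xi> - \<eta>))"
    proof -
      have "W2 \<eta> * inv_fourier (\<lambda>x. cis (\<xi> \<bullet> x) * ?h x) \<eta>
          = inversion_const chi / (2 * pi) ^ 3 * (W2 \<eta> * W3 (- \<xi> - \<eta>))" for \<eta>
        unfolding shift by simp
      then show ?thesis by (simp only: integral_mult_right_zero)
    qed
    finally show ?thesis
      unfolding inv_fourier_def[of "\<lambda>x. inv_fourier W2 x * ?h x"] by (simp add: power_mult_distrib flip: power_add)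
  qed
  have "(LINT x|lborel. inv_fourier W1 x * inv_fourier W2 x * ?h x)
      = (LINT x|lborel. inv_fourier W1 x * (inv_fourier W2 x * ?h x))"
    by (simp add: mult.assoc)
  also have "\<dots> = (LINT \<xi>|lborel. W1 \<xi> * inv_fourier (\<lambda>x. inv_fourier W2 x * ?h x) \<xi>)"
    by (rule inv_fourier_duality[OF i(1) ih2, symmetric])
  also have "\<dots> = (LINT \<xi>|lborel. inversion_const chi / (2 * pi) ^ 6 * (LINT \<eta>|lborel. W1 \<xi> * W2 \<eta> * W3 (- \<xi> - \<eta>)))"
    unfolding inner by (simp add: mult.assoc mult.left_commute)
  finally show ?thesis by (simp only: integral_mult_right_zero)
qed


section \<open>Trilinear form in Fourier variables\<close>

definition flip :: "(3 \<Rightarrow> real) \<Rightarrow> real^3 \<Rightarrow> real^3" where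
  "flip \<sigma> x = (\<chi> i. \<sigma> i * x $ i)"

lemma flip_nth [simp]: "flip \<sigma> x $ i = \<sigma> i * x $ i"
  by (simp add: flip_def)

lemma flip_flip:
  assumes "\<And>i. \<bar>\<sigma> i\<bar> = 1"
  shows "flip \<sigma> (flip \<sigma> x) = x"
proof -
  have "\<sigma> i * \<sigma> i = 1" for i by (metis assms abs_mult_self_eq mult_1)
  then show ?thesis by (simp add: vec_eq_iff mult.assoc[symmetric])
qed

lemma inner_flip: "flip \<sigma> x \<bullet> y = x \<bullet> flip \<sigma> y"
  by (simp add: inner_vec_def mult_ac)

lemma inv_fourier_flip:
  assumes \<sigma>: "\<And>i. \<bar>\<sigma> i\<bar> = 1" and w: "integrable lborel w"
  shows "inv_fourier w (flip \<sigma> x) = inv_fourier (\<lambda>\<xi>. w (flip \<sigma> \<xi>)) x"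
proof -
  have [measurable]: "w \<in> borel_measurable borel" using w by auto
  have "(LINT \<xi>|lborel. cis (x \<bullet> flip \<sigma> \<xi>) * w \<xi>)
      = (LINT \<xi>|lborel. cis (x \<bullet> flip \<sigma> (flip \<sigma> \<xi>)) * w (flip \<sigma> \<xi>))"
  proof -
    have "continuous_on UNIV (\<lambda>\<xi>. flip \<sigma> \<xi>)"
      unfolding flip_def by (intro continuous_intros)
    then have [measurable]: "flip \<sigma> \<in> borel_measurable borel" by (rule borel_measurable_continuous_onI)
    show ?thesis
      unfolding flip_def by (rule integral_sign_flip[of _ \<sigma>, symmetric, OF _ \<sigma>]) (unfold flip_def[symmetric], measurable)
  qed
  then show ?thesis by (simp add: inv_fourier_def inner_flip flip_flip[of \<sigma>, OF \<sigma>])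
qed

text \<open>The trilinear form of the Euler equations, the integral of
  \<open>(f . grad l) . g\<close>. It has no complex conjugation, so it expands linearly over modes
  in every slot.\<close>

definition advection :: "(3 \<Rightarrow> real^3 \<Rightarrow> complex) \<Rightarrow> (3 \<Rightarrow> real^3 \<Rightarrow> complex) \<Rightarrow> (3 \<Rightarrow> real^3 \<Rightarrow> complex) \<Rightarrow> complex" where
  "advection f g l = (\<Sum>i\<in>UNIV. \<Sum>j\<in>UNIV. LINT x|lborel. f i x * g j x * partial_deriv i (l j) x)"

lemma advection_integrable:
  assumes "test_fun u" "test_fun v" "test_fun w"
  shows "integrable lborel (\<lambda>x. inv_fourier u x * inv_fourier v x * partial_deriv i (inv_fourier w) x)"
proof -
  note w = partial_deriv_inv_fourier_test[OF assms(3), of i]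
  have "integrable lborel (partial_deriv i (inv_fourier w))"
    unfolding w(1) by (rule integrable_inv_fourier[OF w(2)])
  then have "integrable lborel (\<lambda>x. inv_fourier v x * partial_deriv i (inv_fourier w) x)"
    by (rule integrable_inv_fourier_mult[OF _ test_fun_integrable[OF assms(2)]])
  then have "integrable lborel (\<lambda>x. inv_fourier u x * (inv_fourier v x * partial_deriv i (inv_fourier w) x))"
    by (rule integrable_inv_fourier_mult[OF _ test_fun_integrable[OF assms(1)]])
  then show ?thesis by (simp add: mult.assoc)
qed

text \<open>The two forms add up to the integral of \<open>u . grad (v . w)\<close>, which vanishes
  for solenoidal \<open>u\<close>. This is the source of the cancellation of all pairs lying below
  the cutoff.\<close>

lemma advection_antisym:
  fixes U V W :: "3 \<Rightarrow> real^3 \<Rightarrow> complex"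
  assumes U: "\<And>i. test_fun (U i)" and div: "\<And>\<xi>. (\<Sum>i\<in>UNIV. \<xi> $ i * U i \<xi>) = 0"
    and V: "\<And>i. test_fun (V i)" and W: "\<And>i. test_fun (W i)"
  shows "advection (\<lambda>i. inv_fourier (U i)) (\<lambda>i. inv_fourier (V i)) (\<lambda>i. inv_fourier (W i))
    = - advection (\<lambda>i. inv_fourier (U i)) (\<lambda>i. inv_fourier (W i)) (\<lambda>i. inv_fourier (V i))"
proof -
  let ?u = "\<lambda>i. inv_fourier (U i)" and ?v = "\<lambda>i. inv_fourier (V i)" and ?w = "\<lambda>i. inv_fourier (W i)"
  have j: "(\<Sum>i\<in>UNIV. (LINT x|lborel. ?u i x * ?v j x * partial_deriv i (?w j) x)
      + (LINT x|lborel. ?u i x * ?w j x * partial_deriv i (?v j) x)) = 0" for j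
  proof -
    let ?h = "\<lambda>x. ?v j x * ?w j x"
    have s: "smooth (?v j)" "smooth (?w j)" using V W smooth_inv_fourier_test by auto
    have dh: "partial_deriv i ?h = (\<lambda>x. partial_deriv i (?v j) x * ?w j x + ?v j x * partial_deriv i (?w j) x)" for i
      using partial_deriv_mult s smooth_differentiable by blast
    have ih: "integrable lborel ?h"
      by (rule integrable_inv_fourier_mult[OF integrable_inv_fourier[OF W] test_fun_integrable[OF V]])
    have aux: "integrable lborel (\<lambda>x. inv_fourier p x * partial_deriv i (inv_fourier q) x)"
      if "test_fun p" "test_fun q" for p q i
      unfolding partial_deriv_inv_fourier_test(1)[OF that(2)]
      by (intro integrable_inv_fourier_mult integrable_inv_fourier partial_deriv_inv_fourier_test(2)
          test_fun_integrable that)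
    have idh: "integrable lborel (partial_deriv i ?h)" for i
      unfolding dh using aux[OF V W] aux[OF W V] by (auto simp: mult.commute)
    have split: "(LINT x|lborel. ?u i x * partial_deriv i ?h x)
        = (LINT x|lborel. ?u i x * ?v j x * partial_deriv i (?w j) x)
        + (LINT x|lborel. ?u i x * ?w j x * partial_deriv i (?v j) x)" for i
      unfolding Bochner_Integration.integral_add[OF advection_integrable[OF U V W] advection_integrable[OF U W V], symmetric] dh
      by (simp add: algebra_simps)
    have "(\<Sum>i\<in>UNIV. LINT x|lborel. ?u i x * partial_deriv i ?h x) = 0"
    proof (rule divergence_free_weak[OF U div _ _ ih idh])
      show "?h differentiable at x" for x
        using s smooth_differentiable by (intro differentiable_mult)
      show "continuous_on UNIV (partial_deriv i ?h)" for i
        unfolding dh by (intro continuous_intros smooth_continuous smooth_partial_deriv s)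
    qed
    then show ?thesis unfolding split .
  qed
  have "advection ?u ?v ?w + advection ?u ?w ?v = (\<Sum>j\<in>UNIV. \<Sum>i\<in>UNIV.
      (LINT x|lborel. ?u i x * ?v j x * partial_deriv i (?w j) x)
      + (LINT x|lborel. ?u i x * ?w j x * partial_deriv i (?v j) x))"
    unfolding advection_def sum.distrib by (subst sum.swap, subst (2) sum.swap) simp
  also have "\<dots> = 0" unfolding j by simp
  finally show ?thesis by (simp add: eq_neg_iff_add_eq_0)
qed

lemma triple_product_integrable:
  assumes W: "test_fun W1" "test_fun W2" "test_fun W3"
  shows "integrable (lborel :: ((real^3) \<times> (real^3)) measure) (\<lambda>(\<xi>, \<eta>). W1 \<xi> * W2 \<eta> * W3 (- \<xi> - \<eta>))"
proof -
  obtain R1 R2 where R: "\<And>x. R1 < norm x \<Longrightarrow> W1 x = 0" "\<And>x. R2 < norm x \<Longrightarrow> W2 x = 0"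
    using W(1,2) by (auto simp: test_fun_def bounded_support_def)
  let ?f = "\<lambda>(\<xi>, \<eta>). W1 \<xi> * W2 \<eta> * W3 (- \<xi> - \<eta>)"
  let ?S = "cball 0 R1 \<times> cball 0 R2 :: ((real^3) \<times> (real^3)) set"
  have "continuous_on UNIV ?f"
    unfolding case_prod_unfold
    by (intro continuous_intros continuous_on_compose2[OF test_fun_continuous[OF W(1)]]
        continuous_on_compose2[OF test_fun_continuous[OF W(2)]] continuous_on_compose2[OF test_fun_continuous[OF W(3)]]) auto
  then have "integrable lborel (\<lambda>z. indicator ?S z *\<^sub>R ?f z)"
    by (intro borel_integrable_compact compact_Times) (auto intro: continuous_on_subset)
  also have "(\<lambda>z. indicator ?S z *\<^sub>R ?f z) = ?f"
    using R by (force simp: indicator_def fun_eq_iff)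
  finally show ?thesis .
qed

lemma advection_fourier:
  assumes chi: "lp_cutoff chi" and U: "\<And>i. test_fun (U i)" and V: "\<And>i. test_fun (V i)" and W: "\<And>i. test_fun (W i)"
  shows "advection (\<lambda>i. inv_fourier (U i)) (\<lambda>i. inv_fourier (V i)) (\<lambda>i. inv_fourier (W i))
    = inversion_const chi / (2 * pi) ^ 6 * (LINT z|lborel. (\<Sum>i\<in>UNIV. \<Sum>j\<in>UNIV.
        U i (fst z) * V j (snd z) * (\<i> * (- fst z - snd z) $ i * W j (- fst z - snd z))))"
proof -
  let ?K = "inversion_const chi / (2 * pi) ^ 6"
  let ?f = "\<lambda>i j z. U i (fst z) * V j (snd z) * (\<i> * (- fst z - snd z) $ i * W j (- fst z - snd z))"
  note w = partial_deriv_inv_fourier_test[OF W]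
  have int: "integrable lborel (?f i j)" for i j
    using triple_product_integrable[OF U V w(2)] by (simp add: case_prod_unfold)
  have "(LINT x|lborel. inv_fourier (U i) x * inv_fourier (V j) x * partial_deriv i (inv_fourier (W j)) x)
      = ?K * (LINT z|lborel. ?f i j z)" for i j
  proof -
    have "(LINT \<xi>|lborel. LINT \<eta>|lborel. U i \<xi> * V j \<eta> * (\<i> * (- \<xi> - \<eta>) $ i * W j (- \<xi> - \<eta>))) = (LINT z|lborel. ?f i j z)"
      using lborel_pair.integral_fst'[of "?f i j"] int by (simp add: lborel_prod)
    then show ?thesis
      unfolding w(1) integral_triple_product[OF chi U V w(2)] by simp
  qed
  then have "advection (\<lambda>i. inv_fourier (U i)) (\<lambda>i. inv_fourier (V i)) (\<lambda>i. inv_fourier (W i))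
      = ?K * (\<Sum>i\<in>UNIV. \<Sum>j\<in>UNIV. LINT z|lborel. ?f i j z)"
    by (simp add: advection_def sum_distrib_left)
  also have "(\<Sum>i\<in>UNIV. \<Sum>j\<in>UNIV. LINT z|lborel. ?f i j z) = (LINT z|lborel. (\<Sum>i\<in>UNIV. \<Sum>j\<in>UNIV. ?f i j z))"
    by (simp only: Bochner_Integration.integral_sum Bochner_Integration.integrable_sum int)
  finally show ?thesis .
qed

text \<open>A selection rule: changing variables by the reflection reproduces the form with the
  factor \<open>cu * cv * cw\<close>, so a factor -1 forces it to vanish. The signs from the
  components and from the derivative occur in pairs and cancel.\<close>

lemma advection_flip:
  fixes U V W :: "3 \<Rightarrow> real^3 \<Rightarrow> complex"
  assumes \<sigma>: "\<And>i. \<bar>\<sigma> i\<bar> = 1"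
    and U: "\<And>i. test_fun (U i)" and V: "\<And>i. test_fun (V i)" and W: "\<And>i. test_fun (W i)"
    and u: "\<And>i \<xi>. U i (flip \<sigma> \<xi>) = of_real (cu * \<sigma> i) * U i \<xi>"
    and v: "\<And>i \<xi>. V i (flip \<sigma> \<xi>) = of_real (cv * \<sigma> i) * V i \<xi>"
    and w: "\<And>i \<xi>. W i (flip \<sigma> \<xi>) = of_real (cw * \<sigma> i) * W i \<xi>"
  shows "advection (\<lambda>i. inv_fourier (U i)) (\<lambda>i. inv_fourier (V i)) (\<lambda>i. inv_fourier (W i))
    = of_real (cu * cv * cw) * advection (\<lambda>i. inv_fourier (U i)) (\<lambda>i. inv_fourier (V i)) (\<lambda>i. inv_fourier (W i))"
proof -
  have fl: "inv_fourier f (flip \<sigma> x) = c * inv_fourier f x"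
    if "test_fun f" "\<And>\<xi>. f (flip \<sigma> \<xi>) = c * f \<xi>" for f c x
    using inv_fourier_flip[of \<sigma> f x, OF \<sigma> test_fun_integrable[OF that(1)]] that(2) inv_fourier_cmult by simp
  let ?I = "\<lambda>i j x. inv_fourier (U i) x * inv_fourier (V j) x * partial_deriv i (inv_fourier (W j)) x"
  have "(LINT x|lborel. ?I i j x) = of_real (cu * cv * cw) * (LINT x|lborel. ?I i j x)" for i j
  proof -
    let ?J = "?I i j"
    note dw = partial_deriv_inv_fourier_test[OF W, of i j]
    have "\<i> * flip \<sigma> \<xi> $ i * W j (flip \<sigma> \<xi>) = of_real (cw * \<sigma> i * \<sigma> j) * (\<i> * \<xi> $ i * W j \<xi>)" for \<xi>
      by (simp add: w mult_ac)
    note fw = fl[OF dw(2) this]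
    have ss: "\<sigma> i * \<sigma> i = 1" for i using \<sigma>[of i] by (metis abs_mult_self_eq mult_1)
    have "?J (flip \<sigma> x) = of_real (cu * cv * cw * ((\<sigma> i * \<sigma> i) * (\<sigma> j * \<sigma> j))) * ?J x" for x
      unfolding dw(1) fw fl[OF U u] fl[OF V v] of_real_mult by (simp only: mult_ac)
    then have J: "?J (flip \<sigma> x) = of_real (cu * cv * cw) * ?J x" for x
      unfolding ss by simp
    have "?J \<in> borel_measurable borel"
      using advection_integrable[OF U V W] by auto
    from integral_sign_flip[of ?J \<sigma>, OF this \<sigma>] have "(LINT x|lborel. ?J x) = (LINT x|lborel. ?J (flip \<sigma> x))"
      by (simp add: flip_def)
    then show ?thesis unfolding J by simp
  qed
  then show ?thesis
    unfolding advection_def by (simp only: sum_distrib_left)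
qed


section \<open>The triad of modes\<close>

text \<open>One dyadic scale carries three modes, two of scalar type (third velocity component) and one of
  planar type, with wave vectors \<open>\<plusminus>B\<close>, \<open>\<plusminus>B'\<close>, \<open>\<plusminus>A\<close> of equal length and \<open>B + B' = A / 2\<close>. Thus the first
  two interact with the third one of the next larger scale.\<close>

datatype mode = Scalar | Planar | Source

text \<open>The triangle with sides 1, 1 and 1/2 fixes the numbers: the two equal sides have cosine
  1/4 with the base, hence sine \<open>sqrt 15 / 4\<close>.\<close>

fun center :: "mode \<Rightarrow> real^3" where
  "center Scalar = vector [1/4, sqrt 15 / 4, 0]"
| "center Planar = vector [1/4, - sqrt 15 / 4, 0]"
| "center Source = vector [1, 0, 0]"

text \<open>Together with \<open>reflection\<close> this gives the sign pairs (1,-1), (-1,1) and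
  (-1,-1). The product of three of them is (1,1) exactly when all three modes are different.\<close>

fun parity :: "mode \<Rightarrow> real" where
  "parity Scalar = 1" | "parity Planar = -1" | "parity Source = -1"

fun reflection :: "mode \<Rightarrow> real" where
  "reflection Scalar = -1" | "reflection Planar = 1" | "reflection Source = -1"

text \<open>Up to sign these are cross products of \<xi> with the third and the second axis. They
  are orthogonal to \<xi>, linear and odd; at the wave vectors, which are horizontal, the second one
  points along the third axis.\<close>

fun polarization :: "mode \<Rightarrow> real^3 \<Rightarrow> real^3" where
  "polarization Planar \<xi> = vector [- \<xi>$2, \<xi>$1, 0]"
| "polarization _ \<xi> = vector [- \<xi>$3, 0, \<xi>$1]"

text \<open>Polarizations are odd, so the even amplitude of \<open>Scalar\<close> gives an odd
  symbol, which must be imaginary for the wave to be real. The other two symbols are even and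
  real.\<close>

fun phase :: "mode \<Rightarrow> complex" where
  "phase Scalar = \<i>" | "phase _ = 1"

lemma polarization_orthogonal: "(\<Sum>i\<in>UNIV. \<xi> $ i * polarization M \<xi> $ i) = 0"
  by (cases M) (simp_all add: sum_3)

lemma mode_signs [simp]:
  "\<bar>parity M\<bar> = 1" "parity M * parity M = 1" "parity M * (parity M * c) = c" "center M $ 3 = 0"
  by (cases M; simp)+

lemma norm_center: "norm (center M) = 1"
proof -
  have "center M \<bullet> center M = 1"
    by (cases M) (simp_all add: inner_vec_def sum_3 power2_eq_square[symmetric] power_divide)
  then show ?thesis by (simp add: norm_eq_sqrt_inner)
qed

lemma three_modes:
  assumes "parity L * parity M * parity N = 1" "reflection L * reflection M * reflection N = 1"
  shows "distinct [L, M, N]"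
  using assms by (cases L; cases M; cases N; simp)

lemma cutoff_radius:
  assumes chi: "lp_cutoff chi"
  obtains r where "1/2 < r" "r < 1" "\<And>\<xi>. r \<le> norm \<xi> \<Longrightarrow> chi \<xi> = 0"
proof -
  let ?K = "closure {\<xi>. chi \<xi> \<noteq> 0}"
  have "bounded ?K" by (rule bounded_subset[OF bounded_ball cutoff_support[OF chi]])
  then have K: "compact ?K" by (simp add: compact_eq_bounded_closed)
  have "0 \<in> ?K"
    using cutoff_inner[OF chi, of 0] by (intro subsetD[OF closure_subset]) simp
  then have "?K \<noteq> {}" by (metis empty_iff)
  have "\<exists>x\<in>?K. \<forall>y\<in>?K. norm y \<le> norm x"
    by (rule continuous_attains_sup[OF K \<open>?K \<noteq> {}\<close> continuous_on_norm_id])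
  then obtain x where x: "x \<in> ?K" "\<And>y. y \<in> ?K \<Longrightarrow> norm y \<le> norm x" by (metis (no_types))
  have "norm x < 1" using x(1) cutoff_support[OF chi] by auto
  \<comment> \<open>The entry 3/4 secures \<open>1/2 < r\<close>, and the mean of
    \<open>norm x\<close> and 1 exceeds every norm in the support while staying below 1.\<close>
  show thesis
  proof (rule that[of "max (3/4) ((norm x + 1) / 2)"])
    fix \<xi> :: "real^3" assume *: "max (3/4) ((norm x + 1) / 2) \<le> norm \<xi>"
    show "chi \<xi> = 0"
    proof (rule ccontr)
      assume "chi \<xi> \<noteq> 0"
      then have "\<xi> \<in> ?K" by (intro subsetD[OF closure_subset]) simp
      with x(2)[of \<xi>] * \<open>norm x < 1\<close> show False by simp
    qed
  qed (use \<open>norm x < 1\<close> in auto)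
qed

section \<open>Waves of a single mode and level, and their selection rules\<close>

locale flux_modes =
  fixes chi :: "real^3 \<Rightarrow> real" and r :: real
  assumes chi: "lp_cutoff chi" and r: "1/2 < r" "r < 1"
    and chi_outside: "\<And>\<xi>. r \<le> norm \<xi> \<Longrightarrow> chi \<xi> = 0"
begin

text \<open>The common length of the wave vectors at level 0, midway between the radius where
  \<open>chi\<close> has vanished and 1. The bump radius \<open>\<epsilon>\<close> is small against
  this gap, so the bumps stay in the shell between \<open>r\<close> and 1, and
  \<open>1/2 < r\<close> makes it less than 1/2000, the tolerance of the triad estimates.\<close>

definition \<rho> :: real where "\<rho> = (1 + r) / 2"
definition \<epsilon> :: real where "\<epsilon> = (1 - r) / 1000"
text \<open>The amplitude ratio of consecutive levels. Everything rests on
  \<open>\<tau>^3 = 4\<close>: then \<open>\<tau>^3 * 2 = 8\<close> for the flux and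
  \<open>\<tau>^3 / 8 = 1/2\<close> for the cubed \<open>L^3\<close> norm.\<close>

definition \<tau> :: real where "\<tau> = 2 powr (2/3)"

lemma constants: "3/4 < \<rho>" "\<rho> < 1" "0 < \<epsilon>" "\<epsilon> < 1/2000" "r < \<rho> * (1 - \<epsilon>)" "\<rho> * (1 + \<epsilon>) < 1" "0 < \<tau>"
proof -
  show 1: "3/4 < \<rho>" "\<rho> < 1" "0 < \<epsilon>" "\<epsilon> < 1/2000" "0 < \<tau>"
    using r by (auto simp: \<rho>_def \<epsilon>_def \<tau>_def)
  have "\<rho> * \<epsilon> \<le> \<epsilon>" using 1 by (simp add: mult_left_le_one_le)
  moreover have "\<rho> + \<epsilon> < 1" "r < \<rho> - \<epsilon>" using r by (simp_all add: \<rho>_def \<epsilon>_def field_simps)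
  ultimately show "r < \<rho> * (1 - \<epsilon>)" "\<rho> * (1 + \<epsilon>) < 1" by (simp_all add: algebra_simps)
qed

lemma tau_cubed: "\<tau> ^ 3 = 4"
proof -
  have "\<tau> ^ 3 = \<tau> powr 3" using constants(7) by (simp add: powr_numeral)
  also have "\<dots> = 2 powr (2/3 * 3)" by (simp only: \<tau>_def powr_powr)
  finally show ?thesis by simp
qed

definition amplitude :: "mode \<Rightarrow> real^3 \<Rightarrow> real" where
  "amplitude M \<xi> = chi ((\<xi> - center M) /\<^sub>R \<epsilon>) + parity M * chi ((\<xi> + center M) /\<^sub>R \<epsilon>)"

text \<open>Per level the wave is multiplied by \<open>\<tau>\<close> and dilated by 2; on the
  Fourier side the dilation contributes the Jacobian 1/8.\<close>

definition symbol :: "mode \<times> nat \<Rightarrow> 3 \<Rightarrow> real^3 \<Rightarrow> complex" where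
  "symbol p j \<xi> = phase (fst p) * of_real ((\<tau> / 8) ^ snd p *
     (polarization (fst p) (\<xi> /\<^sub>R (\<rho> * 2 ^ snd p)) $ j * amplitude (fst p) (\<xi> /\<^sub>R (\<rho> * 2 ^ snd p))))"

definition wave :: "mode \<times> nat \<Rightarrow> 3 \<Rightarrow> real^3 \<Rightarrow> complex" where
  "wave p j = inv_fourier (symbol p j)"

definition freqs :: "mode \<times> nat \<Rightarrow> (real^3) set" where
  "freqs p = {\<xi>. \<exists>s\<in>{1, -1}. norm (\<xi> /\<^sub>R (\<rho> * 2 ^ snd p) - s *\<^sub>R center (fst p)) < \<epsilon>}"

lemma chi_zero: "1 \<le> norm \<xi> \<Longrightarrow> chi \<xi> = 0"
  using chi_outside r by simp

lemma amplitude_nonzero: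
  assumes "amplitude M \<xi> \<noteq> 0"
  obtains s where "s \<in> {1, -1}" "norm (\<xi> - s *\<^sub>R center M) < \<epsilon>"
proof -
  have "chi (\<eta> /\<^sub>R \<epsilon>) = 0" if "\<not> norm \<eta> < \<epsilon>" for \<eta>
    using that constants(3) by (intro chi_zero) (simp add: divide_simps)
  then have "norm (\<xi> - center M) < \<epsilon> \<or> norm (\<xi> + center M) < \<epsilon>"
    using assms by (force simp: amplitude_def)
  then show ?thesis
    using that[of 1] that[of "-1"] by auto
qed

lemma symbol_nonzero: "symbol p j \<xi> \<noteq> 0 \<Longrightarrow> \<xi> \<in> freqs p"
  by (auto simp: symbol_def freqs_def elim!: amplitude_nonzero)

lemma freqs_shell:
  assumes "\<xi> \<in> freqs p"
  shows "r * 2 ^ snd p < norm \<xi>" "norm \<xi> < 2 ^ snd p"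
proof -
  define n where "n = norm (\<xi> /\<^sub>R (\<rho> * 2 ^ snd p))"
  have pos: "0 < \<rho> * 2 ^ snd p" using constants by simp
  obtain s where s: "s \<in> {1, -1::real}" "norm (\<xi> /\<^sub>R (\<rho> * 2 ^ snd p) - s *\<^sub>R center (fst p)) < \<epsilon>"
    using assms unfolding freqs_def by blast
  have "norm (s *\<^sub>R center (fst p)) = 1" using s(1) norm_center by auto
  then have n: "1 - \<epsilon> < n" "n < 1 + \<epsilon>"
    using s(2) norm_triangle_ineq2[of "\<xi> /\<^sub>R (\<rho> * 2 ^ snd p)" "s *\<^sub>R center (fst p)"]
      norm_triangle_ineq2[of "s *\<^sub>R center (fst p)" "\<xi> /\<^sub>R (\<rho> * 2 ^ snd p)"]
    unfolding n_def by (auto simp: norm_minus_commute)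
  have x: "norm \<xi> = \<rho> * n * 2 ^ snd p"
    unfolding n_def norm_scaleR using pos constants(1) by (simp add: field_simps)
  have "r < \<rho> * n" "\<rho> * n < 1"
    using mult_strict_left_mono[OF n(1), of \<rho>] mult_strict_left_mono[OF n(2), of \<rho>] constants by linarith+
  then show "r * 2 ^ snd p < norm \<xi>" "norm \<xi> < 2 ^ snd p"
    unfolding x by simp_all
qed

lemma test_fun_amplitude: "test_fun (\<lambda>\<xi>. complex_of_real (amplitude M \<xi>))"
proof -
  have e: "inverse \<epsilon> \<noteq> 0" using constants(3) by simp
  have "test_fun (\<lambda>\<xi>. complex_of_real (chi (d + inverse \<epsilon> *\<^sub>R \<xi>)))" for d
    by (rule test_fun_affine[OF cutoff_test_fun[OF chi] e])
  from test_fun_add[OF this test_fun_cmult[OF this], of "- (center M /\<^sub>R \<epsilon>)" "parity M" "center M /\<^sub>R \<epsilon>"]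
  show ?thesis by (simp add: amplitude_def algebra_simps)
qed

lemma test_fun_polarized: "test_fun (\<lambda>\<xi>. complex_of_real (polarization M \<xi> $ j * amplitude M \<xi>))"
  using exhaust_3[of j] test_fun_coord[OF test_fun_amplitude] test_fun_minus[OF test_fun_coord[OF test_fun_amplitude]]
  by (cases M) (auto simp: test_fun_zero)

lemma test_fun_symbol [intro]: "test_fun (symbol p j)"
proof -
  have "test_fun (\<lambda>\<xi>. complex_of_real (polarization M (0 + inverse c *\<^sub>R \<xi>) $ j * amplitude M (0 + inverse c *\<^sub>R \<xi>)))"
    if "c \<noteq> 0" for M c
    by (rule test_fun_affine[OF test_fun_polarized]) (use that in simp)
  moreover have "\<rho> * 2 ^ snd p \<noteq> 0" using constants(1) by simp
  ultimately have "test_fun (\<lambda>\<xi>. complex_of_real (polarization (fst p) (0 + inverse (\<rho> * 2 ^ snd p) *\<^sub>R \<xi>) $ j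
      * amplitude (fst p) (0 + inverse (\<rho> * 2 ^ snd p) *\<^sub>R \<xi>)))" by blast
  from test_fun_cmult[OF this, of "phase (fst p) * of_real ((\<tau> / 8) ^ snd p)"] show ?thesis
    by (simp add: symbol_def[abs_def] mult_ac)
qed

lemma symbol_solenoidal: "(\<Sum>i\<in>UNIV. \<xi> $ i * symbol p i \<xi>) = 0"
proof -
  let ?c = "\<rho> * 2 ^ snd p"
  have c: "?c \<noteq> 0" using constants(1) by simp
  have "(\<Sum>i\<in>UNIV. \<xi> $ i * symbol p i \<xi>) = phase (fst p) * of_real ((\<tau> / 8) ^ snd p * amplitude (fst p) (\<xi> /\<^sub>R ?c) * ?c *
     (\<Sum>i\<in>UNIV. (\<xi> /\<^sub>R ?c) $ i * polarization (fst p) (\<xi> /\<^sub>R ?c) $ i))"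
    unfolding symbol_def of_real_mult of_real_sum sum_distrib_left
    using c by (intro sum.cong) (auto simp: field_simps)
  also have "\<dots> = 0" unfolding polarization_orthogonal by simp
  finally show ?thesis .
qed

lemma polarization_minus: "polarization M (- \<xi>) = - polarization M \<xi>"
  by (cases M) (auto simp: vec_eq_iff forall_3)

lemma amplitude_minus: "amplitude M (- \<xi>) = parity M * amplitude M \<xi>"
proof -
  have "chi ((- \<xi> - center M) /\<^sub>R \<epsilon>) = chi ((\<xi> + center M) /\<^sub>R \<epsilon>)"
    "chi ((- \<xi> + center M) /\<^sub>R \<epsilon>) = chi ((\<xi> - center M) /\<^sub>R \<epsilon>)"
    using cutoff_even[OF chi, of "(\<xi> + center M) /\<^sub>R \<epsilon>"] cutoff_even[OF chi, of "(\<xi> - center M) /\<^sub>R \<epsilon>"]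
    by (simp_all add: algebra_simps)
  then show ?thesis unfolding amplitude_def by (simp add: algebra_simps)
qed

lemma symbol_minus: "symbol p j (- \<xi>) = - of_real (parity (fst p)) * symbol p j \<xi>"
  unfolding symbol_def scaleR_minus_right polarization_minus amplitude_minus by simp

lemma cnj_symbol: "cnj (symbol p j \<xi>) = symbol p j (- \<xi>)"
  unfolding symbol_minus unfolding symbol_def by (cases "fst p") simp_all

abbreviation mirror :: "3 \<Rightarrow> real" where "mirror \<equiv> (\<lambda>i. if i = 3 then -1 else 1)"

lemma polarization_mirror: "polarization M (flip mirror \<xi>) $ j = reflection M * mirror j * polarization M \<xi> $ j"
  using exhaust_3[of j] by (cases M) auto

lemma amplitude_mirror: "amplitude M (flip mirror \<xi>) = amplitude M \<xi>"
proof -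
  have "norm (flip mirror \<xi>) = norm \<xi>" for \<xi>
    by (simp add: norm_eq_sqrt_inner inner_vec_def sum_3)
  then have "chi (flip mirror \<xi>) = chi \<xi>" for \<xi> by (rule cutoff_radial[OF chi])
  moreover have "(flip mirror \<xi> - center M) /\<^sub>R \<epsilon> = flip mirror ((\<xi> - center M) /\<^sub>R \<epsilon>)"
    "(flip mirror \<xi> + center M) /\<^sub>R \<epsilon> = flip mirror ((\<xi> + center M) /\<^sub>R \<epsilon>)"
    by (auto simp: vec_eq_iff forall_3)
  ultimately show ?thesis unfolding amplitude_def by simp
qed

lemma symbol_mirror: "symbol p j (flip mirror \<xi>) = of_real (reflection (fst p) * mirror j) * symbol p j \<xi>"
proof -
  have "flip mirror \<xi> /\<^sub>R c = flip mirror (\<xi> /\<^sub>R c)" for c by (simp add: vec_eq_iff)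
  then show ?thesis
    unfolding symbol_def by (simp only: polarization_mirror amplitude_mirror of_real_mult mult_ac)
qed

lemma wave_real: "cnj (wave p j x) = wave p j x"
proof -
  have s: "integrable lborel (symbol p j)" by (intro test_fun_integrable test_fun_symbol)
  then have [measurable]: "symbol p j \<in> borel_measurable borel" by auto
  have "cnj (LINT \<xi>|lborel. cis (x \<bullet> \<xi>) * symbol p j \<xi>) = (LINT \<xi>|lborel. cnj (cis (x \<bullet> \<xi>) * symbol p j \<xi>))"
    by (rule Bochner_Integration.integral_cnj[symmetric])
  also have "\<dots> = (LINT \<xi>|lborel. cis (x \<bullet> (- \<xi>)) * symbol p j (- \<xi>))"
    by (intro Bochner_Integration.integral_cong) (simp_all add: cis_cnj cnj_symbol)
  also have "\<dots> = (LINT \<xi>|lborel. cis (x \<bullet> \<xi>) * symbol p j \<xi>)"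
    by (rule integral_reflect) measurable
  finally show ?thesis by (simp add: wave_def inv_fourier_def)
qed

lemma of_real_wave: "complex_of_real (Re (wave p j x)) = wave p j x"
  using wave_real[of p j x] by (metis Reals_cnj_iff of_real_Re)

definition transfer :: "mode \<times> nat \<Rightarrow> mode \<times> nat \<Rightarrow> mode \<times> nat \<Rightarrow> complex" where
  "transfer p p' p'' = advection (wave p) (wave p') (wave p'')"

lemma transfer_antisym: "transfer p p' p'' = - transfer p p'' p'"
  unfolding transfer_def wave_def
  using advection_antisym[of "symbol p" "symbol p'" "symbol p''"] test_fun_symbol symbol_solenoidal by blast

text \<open>The three modes realise the three nontrivial characters of the group generated by the
  symmetries \<open>x \<mapsto> -x\<close> and \<open>x\<^sub>3 \<mapsto> -x\<^sub>3\<close>; hence only distinct modes interact. In particular a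
  mode does not interact with itself across distant scales.\<close>

lemma transfer_distinct:
  assumes "transfer p p' p'' \<noteq> 0"
  shows "distinct [fst p, fst p', fst p'']"
proof (rule three_modes)
  have "transfer p p' p'' = of_real (parity (fst p) * parity (fst p') * parity (fst p'')) * transfer p p' p''"
  proof -
    have f: "flip (\<lambda>_. -1) \<xi> = - \<xi>" for \<xi> by (simp add: vec_eq_iff)
    have s: "symbol p i (flip (\<lambda>_. -1) \<xi>) = of_real (parity (fst p) * -1) * symbol p i \<xi>" for p i \<xi>
      unfolding f symbol_minus by simp
    show ?thesis
      unfolding transfer_def wave_def
      by (rule advection_flip[of "\<lambda>_. -1" "symbol p" "symbol p'" "symbol p''",
            OF _ test_fun_symbol test_fun_symbol test_fun_symbol s s s]) simp
  qed
  with assms show "parity (fst p) * parity (fst p') * parity (fst p'') = 1"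
    by (metis mult_cancel_right1 of_real_eq_1_iff mult.commute)
  have "transfer p p' p'' = of_real (reflection (fst p) * reflection (fst p') * reflection (fst p'')) * transfer p p' p''"
    unfolding transfer_def wave_def
    by (rule advection_flip[of mirror "symbol p" "symbol p'" "symbol p''",
          OF _ test_fun_symbol test_fun_symbol test_fun_symbol symbol_mirror symbol_mirror symbol_mirror]) simp
  with assms show "reflection (fst p) * reflection (fst p') * reflection (fst p'') = 1"
    by (metis mult_cancel_right1 of_real_eq_1_iff mult.commute)
qed

lemma transfer_resonance:
  assumes "transfer p p' p'' \<noteq> 0"
  obtains \<xi> \<eta> where "\<xi> \<in> freqs p" "\<eta> \<in> freqs p'" "- \<xi> - \<eta> \<in> freqs p''"
proof (rule ccontr)
  assume "\<not> thesis"
  then have *: "\<xi> \<in> freqs p \<Longrightarrow> \<eta> \<in> freqs p' \<Longrightarrow> - \<xi> - \<eta> \<notin> freqs p''" for \<xi> \<eta>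
    using that by blast
  have zero: "symbol p i (fst z) * symbol p' j (snd z) * (\<i> * (- fst z - snd z) $ i * symbol p'' j (- fst z - snd z)) = 0" for i j z
    using *[of "fst z" "snd z"] symbol_nonzero by (metis mult_eq_0_iff)
  then have "transfer p p' p'' = 0"
    unfolding transfer_def wave_def
    by (simp only: advection_fourier[OF chi test_fun_symbol test_fun_symbol test_fun_symbol] zero
        sum.neutral_const Bochner_Integration.integral_zero mult_zero_right)
  with assms show False by simp
qed

end


section \<open>Arithmetic of perturbed triads\<close>

lemma sqrt_15_bounds: "96/100 < sqrt 15 / 4" "sqrt 15 / 4 < 97/100"
proof -
  have "sqrt ((96/25)\<^sup>2) < sqrt 15" "sqrt 15 < sqrt ((97/25)\<^sup>2)"
    by (simp_all only: real_sqrt_less_iff) (simp_all add: power2_eq_square)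
  then show "96/100 < sqrt 15 / 4" "sqrt 15 / 4 < 97/100" by simp_all
qed

text \<open>\<open>A\<close>, \<open>B\<close>, \<open>C\<close> stand for the dyadic scales, and
  the \<open>e\<close> and \<open>f\<close> for deviations inside the bumps. The second coordinate
  of \<open>Source\<close> is small, so the second equation forces equal signs and nearly equal
  \<open>A\<close> and \<open>B\<close>; the first equation then puts \<open>C\<close> near a
  quarter of \<open>A + B\<close>. The windows are coarse, but narrow enough for powers of
  two.\<close>

lemma triad_arithmetic:
  fixes A B C h s1 s2 s3 :: real
  assumes pos: "0 < A" "0 < B" "0 < C" and h: "96/100 < h" "h < 97/100"
    and s: "s1 \<in> {1, -1}" "s2 \<in> {1, -1}" "s3 \<in> {1, -1}"
    and e: "\<bar>e1\<bar> < 1/2000" "\<bar>e2\<bar> < 1/2000" "\<bar>e3\<bar> < 1/2000"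
    and f: "\<bar>f1\<bar> < 1/2000" "\<bar>f2\<bar> < 1/2000" "\<bar>f3\<bar> < 1/2000"
    and x: "A * (s1 / 4 + e1) + B * (s2 / 4 + e2) + C * (s3 + e3) = 0"
    and y: "A * (s1 * h + f1) + B * (- (s2 * h) + f2) + C * f3 = 0"
  shows "s1 = s2" "s3 = - s1" "A < 2 * B" "B < 2 * A" "24 * (A + B) < 100 * C" "100 * C < 26 * (A + B)"
proof -
  have bd: "\<bar>a * c\<bar> \<le> a / 2000" if "0 < a" "\<bar>c\<bar> < 1/2000" for a c :: real
    using mult_left_mono[of "\<bar>c\<bar>" "1/2000" a] that by (simp add: abs_mult)
  note b0 = bd[OF pos(1) e(1)] bd[OF pos(2) e(2)] bd[OF pos(3) e(3)]
    bd[OF pos(1) f(1)] bd[OF pos(2) f(2)] bd[OF pos(3) f(3)]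
  note b = b0[THEN abs_le_D1] b0[THEN abs_le_D2]
  have hA: "96 * A < 100 * (A * h)" "96 * B < 100 * (B * h)"
    using mult_strict_left_mono[OF h(1) pos(1)] mult_strict_left_mono[OF h(1) pos(2)] by simp_all
  have x': "s1 * A / 4 + s2 * B / 4 + s3 * C + A * e1 + B * e2 + C * e3 = 0"
    using x by (simp add: algebra_simps)
  have y': "s1 * (A * h) - s2 * (B * h) + A * f1 + B * f2 + C * f3 = 0"
    using y by (simp add: algebra_simps)
  have s': "s1 = 1 \<or> s1 = -1" "s2 = 1 \<or> s2 = -1" "s3 = 1 \<or> s3 = -1"
    using s by auto
  \<comment> \<open>An upper bound for \<open>C\<close> comes first, because the error
    \<open>C * f3\<close> in the second equation has to be absorbed by \<open>A + B\<close> before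
    signs can be compared.\<close>
  show up: "100 * C < 26 * (A + B)"
    using s' x' b pos by (elim disjE; simp only: mult_1 mult_minus1 minus_minus; argo)
  show s12: "s1 = s2"
    using s'(1,2) y' b pos hA up by (elim disjE; simp only: mult_1 mult_minus1 minus_minus; argo)
  show s13: "s3 = - s1"
    using s' x' b pos s12 by (elim disjE; simp only: mult_1 mult_minus1 minus_minus; argo)
  show "24 * (A + B) < 100 * C"
    using s'(1) x' b pos unfolding s13 s12[symmetric] by (elim disjE; simp only: mult_1 mult_minus1 minus_minus; argo)
  have d: "\<bar>A * h - B * h\<bar> \<le> (A + B + C) / 2000"
    using s'(1) y' b unfolding s12[symmetric] by (elim disjE; simp only: mult_1 mult_minus1 minus_minus; argo)
  show "A < 2 * B"
  proof (rule ccontr)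
    assume "\<not> A < 2 * B"
    then have "(A - B) * (96/100) \<le> (A - B) * h" using h pos by (intro mult_left_mono) auto
    then have "96 * (A - B) \<le> 100 * (A * h - B * h)" by (simp add: left_diff_distrib)
    with d up pos \<open>\<not> A < 2 * B\<close> show False by argo
  qed
  show "B < 2 * A"
  proof (rule ccontr)
    assume "\<not> B < 2 * A"
    then have "(B - A) * (96/100) \<le> (B - A) * h" using h pos by (intro mult_left_mono) auto
    then have "96 * (B - A) \<le> 100 * (B * h - A * h)" by (simp add: left_diff_distrib)
    with d up pos \<open>\<not> B < 2 * A\<close> show False by argo
  qed
qed

text \<open>The polynomial is the symbol of the interaction; at the exact triad it equals \<open>sqrt 15 / 16\<close>.\<close>

lemma interaction_positive:
  fixes u1 u2 v1 v3 w1 w2 w3 s h :: real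
  assumes s: "s \<in> {1, -1}" and h: "96/100 < h" "h < 97/100"
    and u: "\<bar>u1 - s / 4\<bar> < 1/2000" "\<bar>u2 + s * h\<bar> < 1/2000"
    and v: "\<bar>v1 - s / 4\<bar> < 1/2000" "\<bar>v3\<bar> < 1/2000"
    and w: "\<bar>w1 + s\<bar> < 1/2000" "\<bar>w2\<bar> < 1/2000" "\<bar>w3\<bar> < 1/2000"
  shows "0 < (u1 * w2 - u2 * w1) * (v3 * w3 + v1 * w1) + (v1 * w3 - v3 * w1) * (u2 * w3)"
proof -
  \<comment> \<open>For \<open>s = 1\<close> only the product of \<open>- (u2 * w1)\<close> and
    \<open>v1 * w1\<close> is large; every other term of the expansion contains \<open>v3\<close>,
    \<open>w2\<close> or \<open>w3\<close>.\<close>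
  have *: "0 < (u1 * w2 - u2 * w1) * (v3 * w3 + v1 * w1) + (v1 * w3 - v3 * w1) * (u2 * w3)"
    if u: "\<bar>u1 - 1 / 4\<bar> < 1/2000" "\<bar>u2 + h\<bar> < 1/2000"
    and v: "\<bar>v1 - 1 / 4\<bar> < 1/2000" "\<bar>v3\<bar> < 1/2000"
    and w: "\<bar>w1 + 1\<bar> < 1/2000" "\<bar>w2\<bar> < 1/2000" "\<bar>w3\<bar> < 1/2000"
    for u1 u2 v1 v3 w1 w2 w3 :: real
  proof -
    have prod: "\<bar>a * b\<bar> \<le> A * B" if "\<bar>a\<bar> \<le> A" "\<bar>b\<bar> \<le> B" for a b A B :: real
      unfolding abs_mult using that by (intro mult_mono) auto
    have 1: "95/100 \<le> u2 * w1"
    proof -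
      have "955/1000 \<le> - u2" "999/1000 \<le> - w1" using u w h by linarith+
      from mult_mono[OF this] this show ?thesis by simp
    qed
    have 2: "24/100 \<le> - (v1 * w1)"
    proof -
      have "249/1000 \<le> v1" "999/1000 \<le> - w1" using v w by linarith+
      from mult_mono[OF this] this show ?thesis by simp
    qed
    have u1: "\<bar>u1\<bar> \<le> 1" using u(1) by linarith
    have u2: "\<bar>u2\<bar> \<le> 1" using u(2) h by linarith
    have v1: "\<bar>v1\<bar> \<le> 1" using v(1) by linarith
    have w1: "\<bar>w1\<bar> \<le> 2" using w(1) by linarith
    note small = v(2)[THEN less_imp_le] w(2,3)[THEN less_imp_le]
    have 3: "\<bar>u1 * w2\<bar> \<le> 1 * (1/2000)" by (rule prod[OF u1 small(2)])
    have 4: "\<bar>v3 * w3\<bar> \<le> 1/2000 * (1/2000)" by (rule prod[OF small(1) small(3)])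
    have 5: "\<bar>v1 * w3\<bar> \<le> 1 * (1/2000)" by (rule prod[OF v1 small(3)])
    have 6: "\<bar>v3 * w1\<bar> \<le> 1/2000 * 2" by (rule prod[OF small(1) w1])
    have 7: "\<bar>u2 * w3\<bar> \<le> 1 * (1/2000)" by (rule prod[OF u2 small(3)])
    have a: "94/100 \<le> - (u1 * w2 - u2 * w1)" using 1 3 by linarith
    have b: "23/100 \<le> - (v3 * w3 + v1 * w1)" using 2 4 by linarith
    have "94/100 * (23/100) \<le> - (u1 * w2 - u2 * w1) * - (v3 * w3 + v1 * w1)"
      by (rule mult_mono) (use a b in auto)
    moreover have "\<bar>(v1 * w3 - v3 * w1) * (u2 * w3)\<bar> \<le> 1 * (1/2000)"
    proof (rule prod)
      show "\<bar>v1 * w3 - v3 * w1\<bar> \<le> 1" using 5 6 by linarith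
      show "\<bar>u2 * w3\<bar> \<le> 1/2000" using 7 by simp
    qed
    ultimately show ?thesis unfolding minus_mult_minus by linarith
  qed
  show ?thesis
  proof (cases "s = 1")
    case True
    show ?thesis by (rule *) (use u v w in \<open>simp_all add: True\<close>)
  next
    case False
    \<comment> \<open>The polynomial is homogeneous of degree four, so reversing the signs of all
      variables reduces this case to \<open>s = 1\<close>.\<close>
    then have "s = -1" using s by simp
    have "\<bar>- u1 - 1 / 4\<bar> < 1/2000" using u(1) unfolding \<open>s = -1\<close> by linarith
    moreover have "\<bar>- u2 + h\<bar> < 1/2000" using u(2) unfolding \<open>s = -1\<close> by linarith
    moreover have "\<bar>- v1 - 1 / 4\<bar> < 1/2000" using v(1) unfolding \<open>s = -1\<close> by linarith
    moreover have "\<bar>- v3\<bar> < 1/2000" using v(2) by simp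
    moreover have "\<bar>- w1 + 1\<bar> < 1/2000" using w(1) unfolding \<open>s = -1\<close> by linarith
    moreover have "\<bar>- w2\<bar> < 1/2000" "\<bar>- w3\<bar> < 1/2000" using w(2,3) by simp_all
    ultimately have "0 < (- u1 * - w2 - - u2 * - w1) * (- v3 * - w3 + - v1 * - w1)
        + (- v1 * - w3 - - v3 * - w1) * (- u2 * - w3)" by (rule *)
    then show ?thesis by (simp only: minus_mult_minus)
  qed
qed

lemma UNIV_mode: "(UNIV :: mode set) = {Scalar, Planar, Source}"
  using mode.exhaust by auto

section \<open>Resonant triads, scaling and the sum of all transfers\<close>

context flux_modes begin

lemma freqs_elim:
  assumes "\<xi> \<in> freqs p"
  obtains s e where "s \<in> {1, -1}" "\<And>i. \<bar>e $ i\<bar> < 1/2000"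
    "\<xi> = (\<rho> * 2 ^ snd p) *\<^sub>R (s *\<^sub>R center (fst p) + e)"
proof -
  obtain s where s: "s \<in> {1, -1::real}" "norm (\<xi> /\<^sub>R (\<rho> * 2 ^ snd p) - s *\<^sub>R center (fst p)) < \<epsilon>"
    using assms unfolding freqs_def by blast
  show thesis
  proof (rule that[OF s(1)])
    show "\<bar>(\<xi> /\<^sub>R (\<rho> * 2 ^ snd p) - s *\<^sub>R center (fst p)) $ i\<bar> < 1/2000" for i
      using component_le_norm_cart[of "\<xi> /\<^sub>R (\<rho> * 2 ^ snd p) - s *\<^sub>R center (fst p)" i] s(2) constants(4)
      by linarith
    have id: "c *\<^sub>R (v + (x /\<^sub>R c - v)) = x" if "c \<noteq> 0" for c and v x :: "real^3"
      using that by simp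
    have "\<rho> * 2 ^ snd p \<noteq> 0" using constants(1) by simp
    from id[OF this] show "\<xi> = (\<rho> * 2 ^ snd p) *\<^sub>R (s *\<^sub>R center (fst p) + (\<xi> /\<^sub>R (\<rho> * 2 ^ snd p) - s *\<^sub>R center (fst p)))"
      by (rule sym)
  qed
qed

text \<open>Levels are powers of two, so inequalities with strict factors of two determine the
  exponents, although \<open>triad_arithmetic\<close> gives only approximate ratios.\<close>

lemma resonance_scales:
  assumes "\<xi> \<in> freqs (Scalar, a)" "\<eta> \<in> freqs (Planar, b)" "\<zeta> \<in> freqs (Source, c)" "\<xi> + \<eta> + \<zeta> = 0"
  shows "a = Suc c" "b = Suc c"
proof -
  obtain s1 e1 where 1: "s1 \<in> {1, -1::real}" "\<And>i. \<bar>e1 $ i\<bar> < 1/2000"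
    "\<xi> = (\<rho> * 2 ^ a) *\<^sub>R (s1 *\<^sub>R center Scalar + e1)" using freqs_elim[OF assms(1)] by auto
  obtain s2 e2 where 2: "s2 \<in> {1, -1::real}" "\<And>i. \<bar>e2 $ i\<bar> < 1/2000"
    "\<eta> = (\<rho> * 2 ^ b) *\<^sub>R (s2 *\<^sub>R center Planar + e2)" using freqs_elim[OF assms(2)] by auto
  obtain s3 e3 where 3: "s3 \<in> {1, -1::real}" "\<And>i. \<bar>e3 $ i\<bar> < 1/2000"
    "\<zeta> = (\<rho> * 2 ^ c) *\<^sub>R (s3 *\<^sub>R center Source + e3)" using freqs_elim[OF assms(3)] by auto
  have "\<rho> \<noteq> 0" using constants(1) by simp
  have sum0: "(2 ^ a * (s1 *\<^sub>R center Scalar + e1) $ i + 2 ^ b * (s2 *\<^sub>R center Planar + e2) $ i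
      + 2 ^ c * (s3 *\<^sub>R center Source + e3) $ i) = 0" for i
  proof -
    have "(\<xi> + \<eta> + \<zeta>) $ i = \<rho> * (2 ^ a * (s1 *\<^sub>R center Scalar + e1) $ i + 2 ^ b * (s2 *\<^sub>R center Planar + e2) $ i
      + 2 ^ c * (s3 *\<^sub>R center Source + e3) $ i)"
      unfolding 1(3) 2(3) 3(3) by (simp add: algebra_simps)
    then show ?thesis using assms(4) \<open>\<rho> \<noteq> 0\<close> by simp
  qed
  have x: "2 ^ a * (s1 / 4 + e1 $ 1) + 2 ^ b * (s2 / 4 + e2 $ 1) + 2 ^ c * (s3 + e3 $ 1) = 0"
    using sum0[of 1] by simp
  have y: "2 ^ a * (s1 * (sqrt 15 / 4) + e1 $ 2) + 2 ^ b * (- (s2 * (sqrt 15 / 4)) + e2 $ 2) + 2 ^ c * e3 $ 2 = 0"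
    using sum0[of 2] by simp
  have pos: "(2::real) ^ a > 0" "(2::real) ^ b > 0" "(2::real) ^ c > 0" by simp_all
  note t = triad_arithmetic[OF pos sqrt_15_bounds 1(1) 2(1) 3(1) 1(2)[of 1] 2(2)[of 1] 3(2)[of 1] 1(2)[of 2] 2(2)[of 2] 3(2)[of 2] x y]
  have "(2::real) ^ a < 2 ^ Suc b" "(2::real) ^ b < 2 ^ Suc a" using t(3,4) by simp_all
  then have "a < Suc b" "b < Suc a"
    by (metis one_less_numeral_iff power_strict_increasing_iff semiring_norm(76))+
  then have "a = b" by simp
  \<comment> \<open>Once \<open>a = b\<close>, the bounds put \<open>2^c\<close> between 48 and 52
    hundredths of \<open>2^a\<close>, which leaves only the exponent one lower.\<close>
  have "(2::real) ^ c < 2 ^ a" "(2::real) ^ a < 2 ^ Suc (Suc c)"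
    using t(5,6) pos unfolding \<open>a = b\<close> power_Suc by argo+
  then have "c < a" "a < Suc (Suc c)"
    by (metis one_less_numeral_iff power_strict_increasing_iff semiring_norm(76))+
  then show "a = Suc c" "b = Suc c" using \<open>a = b\<close> by simp_all
qed

text \<open>Stated for the unordered triad, since the resonance condition is symmetric in the three
  slots. Which slot holds the low mode is decided only in \<open>transfer_sum\<close>, by the
  levels.\<close>

lemma transfer_nonzero:
  assumes "transfer p p' p'' \<noteq> 0"
  obtains c where "{p, p', p''} = {(Scalar, Suc c), (Planar, Suc c), (Source, c)}"
proof -
  obtain \<xi> \<eta> where f: "\<xi> \<in> freqs p" "\<eta> \<in> freqs p'" "- \<xi> - \<eta> \<in> freqs p''"
    using transfer_resonance[OF assms] by blast
  obtain M a N b L c where p: "p = (M, a)" "p' = (N, b)" "p'' = (L, c)" by (metis prod.exhaust)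
  have d: "distinct [M, N, L]" using transfer_distinct[OF assms] p by simp
  have perm: "\<exists>c. X = Suc c \<and> Y = Suc c \<and> Z = c"
    if "\<xi> \<in> freqs (Scalar, X)" "\<eta> \<in> freqs (Planar, Y)" "\<zeta> \<in> freqs (Source, Z)" "\<xi> + \<eta> + \<zeta> = 0" for \<xi> \<eta> \<zeta> X Y Z
    using resonance_scales[OF that] by blast
  have z: "\<xi> + \<eta> + (- \<xi> - \<eta>) = 0" "\<xi> + (- \<xi> - \<eta>) + \<eta> = 0" "\<eta> + \<xi> + (- \<xi> - \<eta>) = 0"
    "\<eta> + (- \<xi> - \<eta>) + \<xi> = 0" "(- \<xi> - \<eta>) + \<xi> + \<eta> = 0" "(- \<xi> - \<eta>) + \<eta> + \<xi> = 0" by simp_all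
  have "M = Scalar \<and> N = Planar \<and> L = Source \<or> M = Scalar \<and> N = Source \<and> L = Planar
      \<or> M = Planar \<and> N = Scalar \<and> L = Source \<or> M = Source \<and> N = Scalar \<and> L = Planar
      \<or> M = Planar \<and> N = Source \<and> L = Scalar \<or> M = Source \<and> N = Planar \<and> L = Scalar"
    using d by (cases M; cases N; cases L; simp)
  then have "\<exists>c. {p, p', p''} = {(Scalar, Suc c), (Planar, Suc c), (Source, c)}"
  proof (elim disjE conjE)
    assume m: "M = Scalar" "N = Planar" "L = Source"
    show ?thesis
      using perm[OF _ _ _ z(1), of a b c] f unfolding p m by (intro exI[of _ c]) auto
  next
    assume m: "M = Scalar" "N = Source" "L = Planar"
    show ?thesis
      using perm[OF _ _ _ z(2), of a c b] f unfolding p m by (intro exI[of _ b]) auto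
  next
    assume m: "M = Planar" "N = Scalar" "L = Source"
    show ?thesis
      using perm[OF _ _ _ z(3), of b a c] f unfolding p m by (intro exI[of _ c]) auto
  next
    assume m: "M = Source" "N = Scalar" "L = Planar"
    show ?thesis
      using perm[OF _ _ _ z(4), of b c a] f unfolding p m by (intro exI[of _ a]) auto
  next
    assume m: "M = Planar" "N = Source" "L = Scalar"
    show ?thesis
      using perm[OF _ _ _ z(5), of c a b] f unfolding p m by (intro exI[of _ b]) auto
  next
    assume m: "M = Source" "N = Planar" "L = Scalar"
    show ?thesis
      using perm[OF _ _ _ z(6), of c b a] f unfolding p m by (intro exI[of _ a]) auto
  qed
  then show thesis using that by blast
qed

lemma wave_shift: "wave (M, a + n) j x = of_real (\<tau> ^ n) * wave (M, a) j (2 ^ n *\<^sub>R x)"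
proof -
  have "symbol (M, a + n) j \<xi> = of_real ((\<tau> / 8) ^ n) * symbol (M, a) j (\<xi> /\<^sub>R 2 ^ n)" for \<xi>
  proof -
    have "\<xi> /\<^sub>R (\<rho> * 2 ^ (a + n)) = (\<xi> /\<^sub>R 2 ^ n) /\<^sub>R (\<rho> * 2 ^ a)"
      by (simp add: power_add mult_ac)
    then show ?thesis
      unfolding symbol_def fst_conv snd_conv by (simp add: power_add mult_ac)
  qed
  then have eq: "symbol (M, a + n) j = (\<lambda>\<xi>. of_real ((\<tau> / 8) ^ n) * symbol (M, a) j (\<xi> /\<^sub>R 2 ^ n))"
    by blast
  have "wave (M, a + n) j x = of_real ((\<tau> / 8) ^ n) * (of_real ((2 ^ n) ^ 3) * wave (M, a) j (2 ^ n *\<^sub>R x))"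
    unfolding wave_def
    by (simp only: eq inv_fourier_cmult inv_fourier_dilate[OF test_fun_integrable[OF test_fun_symbol]] zero_less_power zero_less_numeral)
  moreover have "(\<tau> / 8) ^ n * (2 ^ n) ^ 3 = \<tau> ^ n"
    by (simp add: power_two_cubed power_divide)
  ultimately show ?thesis by (metis mult.assoc of_real_mult)
qed

lemma smooth_wave: "smooth (wave p j)"
  unfolding wave_def by (rule smooth_inv_fourier_test[OF test_fun_symbol])

lemma partial_deriv_wave_shift:
  "partial_deriv i (wave (M, a + n) j) x = of_real (\<tau> ^ n * 2 ^ n) * partial_deriv i (wave (M, a) j) (2 ^ n *\<^sub>R x)"
proof -
  have "wave (M, a + n) j = (\<lambda>x. of_real (\<tau> ^ n) * wave (M, a) j (0 + 2 ^ n *\<^sub>R x))"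
    using wave_shift by auto
  then have "partial_deriv i (wave (M, a + n) j) x
      = of_real (\<tau> ^ n) * partial_deriv i (\<lambda>x. wave (M, a) j (0 + 2 ^ n *\<^sub>R x)) x"
    by (simp only: partial_deriv_bounded_linear[OF bounded_linear_mult_right
        smooth_differentiable[OF smooth_affine[OF smooth_wave]]])
  also have "partial_deriv i (\<lambda>x. wave (M, a) j (0 + 2 ^ n *\<^sub>R x)) x = 2 ^ n *\<^sub>R partial_deriv i (wave (M, a) j) (0 + 2 ^ n *\<^sub>R x)"
    by (rule partial_deriv_affine) (rule smooth_differentiable[OF smooth_wave])
  finally show ?thesis by (simp add: scaleR_conv_of_real)
qed

text \<open>Three amplitudes \<open>\<tau>^n\<close> and one derivative \<open>2^n\<close>
  compensate the Jacobian \<open>8^(-n)\<close> of the dilation, because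
  \<open>\<tau>^3 * 2 = 8\<close>.\<close>

lemma transfer_shift: "transfer (M, a + n) (N, b + n) (L, c + n) = transfer (M, a) (N, b) (L, c)"
proof -
  let ?J = "\<lambda>i j x. wave (M, a) i x * wave (N, b) j x * partial_deriv i (wave (L, c) j) x"
  have "(LINT x|lborel. wave (M, a + n) i x * wave (N, b + n) j x * partial_deriv i (wave (L, c + n) j) x)
      = (LINT x|lborel. ?J i j x)" for i j
  proof -
    have int: "integrable lborel (?J i j)"
      unfolding wave_def by (rule advection_integrable[OF test_fun_symbol test_fun_symbol test_fun_symbol])
    have "(\<tau> ^ n) * (\<tau> ^ n) * (\<tau> ^ n * 2 ^ n) = (\<tau> ^ 3) ^ n * 2 ^ n"
      by (simp add: power3_eq_cube power_mult_distrib)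
    also have "\<dots> = 8 ^ n" unfolding tau_cubed by (simp flip: power_mult_distrib)
    finally have t: "(\<tau> ^ n) * (\<tau> ^ n) * (\<tau> ^ n * 2 ^ n) = 8 ^ n" .
    have "wave (M, a + n) i x * wave (N, b + n) j x * partial_deriv i (wave (L, c + n) j) x
        = of_real ((\<tau> ^ n) * (\<tau> ^ n) * (\<tau> ^ n * 2 ^ n)) * ?J i j (0 + 2 ^ n *\<^sub>R x)" for x
      unfolding wave_shift partial_deriv_wave_shift of_real_mult by (simp add: mult_ac)
    then have "(LINT x|lborel. wave (M, a + n) i x * wave (N, b + n) j x * partial_deriv i (wave (L, c + n) j) x)
        = of_real (8 ^ n) * (LINT x|lborel. ?J i j (0 + 2 ^ n *\<^sub>R x))"
      unfolding t by (simp only: integral_mult_right_zero)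
    also have "(LINT x|lborel. ?J i j (0 + 2 ^ n *\<^sub>R x)) = (LINT x|lborel. ?J i j x) /\<^sub>R \<bar>2 ^ n\<bar> ^ 3"
      by (rule integral_affine[OF int]) simp
    also have "\<bar>2 ^ n\<bar> ^ 3 = (8::real) ^ n" by (simp add: power_two_cubed)
    finally show ?thesis by (simp add: scaleR_conv_of_real)
  qed
  then show ?thesis unfolding transfer_def advection_def by simp
qed

definition flux_const :: complex where
  "flux_const = transfer (Scalar, 1) (Planar, 1) (Source, 0) + transfer (Planar, 1) (Scalar, 1) (Source, 0)"

text \<open>For fixed \<open>p\<close>, the pairs with both remaining slots at levels up to
  \<open>Q\<close> cancel by antisymmetry. What is left has its second slot above \<open>Q\<close>
  and its third at most \<open>Q\<close>, a condition met by just two orderings of one resonant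
  triad.\<close>

lemma transfer_sum:
  assumes "Suc Q \<le> N"
  shows "(\<Sum>p\<in>UNIV \<times> {..N}. \<Sum>p'\<in>UNIV \<times> {..N}. \<Sum>p''\<in>UNIV \<times> {..Q}. transfer p p' p'') = flux_const"
proof -
  let ?I = "\<lambda>n. (UNIV :: mode set) \<times> {..n::nat}"
  have fin: "finite (?I n)" for n by (simp add: UNIV_mode)
  have sub: "?I Q \<subseteq> ?I N" using assms by auto
  have low: "(\<Sum>p'\<in>?I Q. \<Sum>p''\<in>?I Q. transfer p p' p'') = 0" for p
  proof -
    have "(\<Sum>p'\<in>?I Q. \<Sum>p''\<in>?I Q. transfer p p' p'') = (\<Sum>p'\<in>?I Q. \<Sum>p''\<in>?I Q. - transfer p p'' p')"
      by (intro sum.cong refl transfer_antisym)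
    also have "\<dots> = - (\<Sum>p'\<in>?I Q. \<Sum>p''\<in>?I Q. transfer p p'' p')" by (simp add: sum_negf)
    also have "(\<Sum>p'\<in>?I Q. \<Sum>p''\<in>?I Q. transfer p p'' p') = (\<Sum>p'\<in>?I Q. \<Sum>p''\<in>?I Q. transfer p p' p'')"
      by (rule sum.swap)
    finally show ?thesis by simp
  qed
  let ?t1 = "((Scalar, Suc Q), (Planar, Suc Q), (Source, Q))" and ?t2 = "((Planar, Suc Q), (Scalar, Suc Q), (Source, Q))"
  let ?P = "?I N \<times> (?I N - ?I Q) \<times> ?I Q"
  let ?T = "\<lambda>(p, p', p''). transfer p p' p''"
  have "(\<Sum>p\<in>?I N. \<Sum>p'\<in>?I N. \<Sum>p''\<in>?I Q. transfer p p' p'')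
      = (\<Sum>p\<in>?I N. \<Sum>p'\<in>?I N - ?I Q. \<Sum>p''\<in>?I Q. transfer p p' p'')"
    unfolding sum.subset_diff[OF sub fin] low by simp
  also have "\<dots> = sum ?T ?P"
    by (simp only: sum.cartesian_product split_def)
  also have "\<dots> = sum ?T {?t1, ?t2}"
  proof (rule sum.mono_neutral_right)
    show "{?t1, ?t2} \<subseteq> ?P" using assms by auto
    show "\<forall>t\<in>?P - {?t1, ?t2}. ?T t = 0"
    proof (rule ballI, rule ccontr)
      fix t assume t: "t \<in> ?P - {?t1, ?t2}" "?T t \<noteq> 0"
      obtain p p' p'' where eq: "t = (p, p', p'')" by (metis prod_cases3)
      from t(2) have "transfer p p' p'' \<noteq> 0" by (simp add: eq)
      then obtain c where c: "{p, p', p''} = {(Scalar, Suc c), (Planar, Suc c), (Source, c)}"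
        by (rule transfer_nonzero)
      have d: "distinct [fst p, fst p', fst p'']" by (rule transfer_distinct) fact
      \<comment> \<open>A triad occupies only the levels \<open>c\<close> and \<open>Suc c\<close>,
        so a slot above \<open>Q\<close> together with one at most \<open>Q\<close> gives
        \<open>c = Q\<close> and places \<open>Source\<close> in the differentiated slot.\<close>
      have "snd p' > Q" "snd p'' \<le> Q" using t(1) by (auto simp: eq mem_Times_iff)
      moreover have "p' \<in> {(Scalar, Suc c), (Planar, Suc c), (Source, c)}"
        "p'' \<in> {(Scalar, Suc c), (Planar, Suc c), (Source, c)}" "p \<in> {(Scalar, Suc c), (Planar, Suc c), (Source, c)}"
        using c by blast+
      ultimately have "t = ?t1 \<or> t = ?t2" using d unfolding eq by auto
      then show False using t(1) by blast
    qed
  qed (use fin in auto)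
  also have "\<dots> = flux_const"
    using transfer_shift[of Scalar 1 Q Planar 1 Source 0] transfer_shift[of Planar 1 Q Scalar 1 Source 0]
    by (simp add: flux_const_def)
  finally show ?thesis .
qed

end


section \<open>Positivity of the resonant contribution\<close>

context flux_modes begin

text \<open>The two centers are at distance 2, so only the bump at
  \<open>s *\<^sub>R center M\<close> contributes; an odd amplitude carries the sign
  \<open>s\<close> there, the even one none.\<close>

lemma amplitude_sign:
  assumes s: "s \<in> {1, -1}" and near: "norm (\<xi> - s *\<^sub>R center M) < \<epsilon>"
  shows "0 \<le> (if M = Scalar then 1 else s) * amplitude M \<xi>"
proof -
  have far: "chi ((\<xi> + s *\<^sub>R center M) /\<^sub>R \<epsilon>) = 0"
  proof (rule chi_zero)
    have "norm (2 *\<^sub>R s *\<^sub>R center M) = 2" using s by (auto simp: norm_center)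
    moreover have "2 *\<^sub>R s *\<^sub>R center M = (\<xi> + s *\<^sub>R center M) - (\<xi> - s *\<^sub>R center M)"
      by (simp only: vec_eq_iff vector_scaleR_component vector_add_component vector_minus_component real_scaleR_def) simp
    then have "norm (2 *\<^sub>R s *\<^sub>R center M) \<le> norm (\<xi> + s *\<^sub>R center M) + norm (\<xi> - s *\<^sub>R center M)"
      using norm_triangle_ineq4 by metis
    ultimately have "\<epsilon> \<le> norm (\<xi> + s *\<^sub>R center M)" using near constants(4) by linarith
    then show "1 \<le> norm ((\<xi> + s *\<^sub>R center M) /\<^sub>R \<epsilon>)"
      using constants(3) by (simp add: divide_simps)
  qed
  have nn: "0 \<le> chi \<eta>" for \<eta> by (rule cutoff_nonneg[OF chi])
  show ?thesis
  proof (cases M)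
    case Scalar
    then show ?thesis by (simp add: amplitude_def nn)
  qed (use s far nn in \<open>auto simp: amplitude_def\<close>)
qed

abbreviation triple_symbol where
  "triple_symbol p p' p'' z \<equiv> (\<Sum>i\<in>UNIV. \<Sum>j\<in>UNIV. symbol p i (fst z) * symbol p' j (snd z)
     * (\<i> * (- fst z - snd z) $ i * symbol p'' j (- fst z - snd z)))"

text \<open>The swap in the second term makes the first argument the frequency of
  \<open>Planar\<close> in both orderings, so that the two transfers can be combined pointwise
  before any sign is discussed.\<close>

definition flux_density :: "(real^3) \<times> (real^3) \<Rightarrow> complex" where
  "flux_density z = triple_symbol (Planar, 1) (Scalar, 1) (Source, 0) z
     + triple_symbol (Scalar, 1) (Planar, 1) (Source, 0) (prod.swap z)"

lemma triple_symbol_integrable: "integrable lborel (triple_symbol p p' p'')"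
proof -
  have "integrable lborel (\<lambda>z. symbol p i (fst z) * symbol p' j (snd z)
     * (\<i> * (- fst z - snd z) $ i * symbol p'' j (- fst z - snd z)))" for i j
    using triple_product_integrable[OF test_fun_symbol test_fun_symbol
        partial_deriv_inv_fourier_test(2)[OF test_fun_symbol], of p i p' j i p'' j]
    by (simp add: case_prod_unfold)
  then show ?thesis by (intro Bochner_Integration.integrable_sum)
qed

lemma continuous_triple_symbol: "continuous_on UNIV (triple_symbol p p' p'')"
proof -
  have c: "continuous_on UNIV (\<lambda>z::(real^3) \<times> (real^3). symbol q k (f z))"
    if "continuous_on UNIV f" for q k f
    using that by (intro continuous_on_compose2[OF test_fun_continuous[OF test_fun_symbol]]) auto
  show ?thesis by (intro continuous_intros c)
qed

lemma
  shows flux_density_integrable: "integrable lborel flux_density"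
    and flux_const_eq: "flux_const = inversion_const chi / (2 * pi) ^ 6 * (LINT z|lborel. flux_density z)"
proof -
  let ?K = "inversion_const chi / (2 * pi) ^ 6"
  have swap: "integrable lborel (\<lambda>z. f (prod.swap z))" "(LINT z|lborel. f (prod.swap z)) = (LINT z|lborel. f z)"
    if "integrable lborel f" for f :: "(real^3) \<times> (real^3) \<Rightarrow> complex"
    using lborel_pair.integrable_product_swap[of f] lborel_pair.integral_product_swap[of f] that
    by (simp_all add: lborel_prod case_prod_unfold prod.swap_def)
  have T: "transfer p p' p'' = ?K * (LINT z|lborel. triple_symbol p p' p'' z)" for p p' p''
    unfolding transfer_def wave_def
    by (rule advection_fourier[OF chi test_fun_symbol test_fun_symbol test_fun_symbol])
  note s = swap[OF triple_symbol_integrable[of "(Scalar, 1)" "(Planar, 1)" "(Source, 0)"]]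
  note i = triple_symbol_integrable[of "(Planar, 1)" "(Scalar, 1)" "(Source, 0)"]
  show "integrable lborel flux_density"
    unfolding flux_density_def by (rule Bochner_Integration.integrable_add[OF i s(1)])
  have "(LINT z|lborel. flux_density z) = (LINT z|lborel. triple_symbol (Planar, 1) (Scalar, 1) (Source, 0) z)
     + (LINT z|lborel. triple_symbol (Scalar, 1) (Planar, 1) (Source, 0) z)"
    unfolding flux_density_def Bochner_Integration.integral_add[OF i s(1)] s(2) ..
  then show "flux_const = ?K * (LINT z|lborel. flux_density z)"
    unfolding flux_const_def T by (simp add: distrib_left add.commute)
qed

text \<open>The first product in the bracket is the \<open>Planar\<close> polarization against
  \<open>w\<close> times the \<open>Scalar\<close> polarization against the \<open>Source\<close>
  polarization; the second exchanges \<open>Planar\<close> and \<open>Scalar\<close>. The minus sign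
  is the \<i> of the derivative times the \<i> of the \<open>Scalar\<close> phase.\<close>

lemma flux_density_formula:
  fixes \<xi> \<eta> :: "real^3"
  defines "u \<equiv> \<xi> /\<^sub>R (\<rho> * 2)" and "v \<equiv> \<eta> /\<^sub>R (\<rho> * 2)" and "w \<equiv> (- \<xi> - \<eta>) /\<^sub>R \<rho>"
  shows "flux_density (\<xi>, \<eta>) = of_real ((\<tau> / 8)\<^sup>2 * \<rho> *
     (- (amplitude Planar u * amplitude Scalar v * amplitude Source w) *
     ((u$1 * w$2 - u$2 * w$1) * (v$3 * w$3 + v$1 * w$1) + (v$1 * w$3 - v$3 * w$1) * (u$2 * w$3))))"
proof -
  have \<rho>: "\<rho> \<noteq> 0" using constants(1) by simp
  define \<zeta> where "\<zeta> = - \<xi> - \<eta>"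
  have w: "\<zeta> $ i = \<rho> * w $ i" for i using \<rho> by (simp add: w_def \<zeta>_def)
  have sP: "symbol (Planar, 1) i \<xi> = of_real (\<tau> / 8 * (polarization Planar u $ i * amplitude Planar u))" for i
    by (simp add: symbol_def u_def)
  have sS: "symbol (Scalar, 1) i \<eta> = \<i> * of_real (\<tau> / 8 * (polarization Scalar v $ i * amplitude Scalar v))" for i
    by (simp add: symbol_def v_def)
  have sA: "symbol (Source, 0) i \<zeta> = of_real (polarization Source w $ i * amplitude Source w)" for i
    by (simp add: symbol_def w_def \<zeta>_def)
  have z: "- \<eta> - \<xi> = \<zeta>" "- \<xi> - \<eta> = \<zeta>" by (simp_all add: \<zeta>_def)
  show ?thesis
    unfolding flux_density_def fst_conv snd_conv prod.swap_def z sP sS sA w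
    by (simp add: sum_3 complex_eq_iff power2_eq_square algebra_simps)
qed

text \<open>Where no amplitude vanishes, the resonance ties the three signs together:
  \<open>Planar\<close> and \<open>Source\<close> lie at opposite signs, so their odd amplitudes
  have a nonpositive product. This offsets the minus sign in the formula, while the polynomial is
  positive for either choice of the common sign.\<close>

lemma flux_density_nonneg:
  obtains g where "g \<ge> 0" "flux_density z = of_real g"
proof -
  obtain \<xi> \<eta> where z: "z = (\<xi>, \<eta>)" by (cases z)
  define u v w where uvw: "u = \<xi> /\<^sub>R (\<rho> * 2)" "v = \<eta> /\<^sub>R (\<rho> * 2)" "w = (- \<xi> - \<eta>) /\<^sub>R \<rho>"
  have \<rho>: "\<rho> > 0" using constants(1) by simp
  let ?a = "amplitude Planar u * amplitude Scalar v * amplitude Source w"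
  let ?p = "(u$1 * w$2 - u$2 * w$1) * (v$3 * w$3 + v$1 * w$1) + (v$1 * w$3 - v$3 * w$1) * (u$2 * w$3)"
  \<comment> \<open>The frequencies sum to zero; after rescaling, the levels 1, 1, 0 enter with
    weights 2, 2, 1, the values of \<open>A\<close>, \<open>B\<close>, \<open>C\<close> used in
    \<open>triad_arithmetic\<close> below.\<close>
  have sum0: "2 * v $ i + 2 * u $ i + w $ i = 0" for i
    using \<rho> by (simp add: uvw field_simps)
  have "0 \<le> - ?a * ?p"
  proof (cases "?a = 0")
    case False
    then obtain s1 s2 s3 where s: "s1 \<in> {1, -1}" "s2 \<in> {1, -1}" "s3 \<in> {1, -1}"
      and near: "norm (v - s1 *\<^sub>R center Scalar) < \<epsilon>" "norm (u - s2 *\<^sub>R center Planar) < \<epsilon>"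
        "norm (w - s3 *\<^sub>R center Source) < \<epsilon>"
      by (metis amplitude_nonzero mult_eq_0_iff)
    have comp: "\<bar>e $ i\<bar> < 1/2000" if "norm e < \<epsilon>" for e :: "real^3" and i
      using component_le_norm_cart[of e i] that constants(4) by linarith
    note n = near[THEN comp]
    have x: "2 * (s1 / 4 + (v - s1 *\<^sub>R center Scalar) $ 1) + 2 * (s2 / 4 + (u - s2 *\<^sub>R center Planar) $ 1)
        + 1 * (s3 + (w - s3 *\<^sub>R center Source) $ 1) = 0"
      using sum0[of 1] by simp
    have y: "2 * (s1 * (sqrt 15 / 4) + (v - s1 *\<^sub>R center Scalar) $ 2) + 2 * (- (s2 * (sqrt 15 / 4)) + (u - s2 *\<^sub>R center Planar) $ 2)
        + 1 * (w - s3 *\<^sub>R center Source) $ 2 = 0"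
      using sum0[of 2] by simp
    have signs: "s1 = s2" "s3 = - s1"
      using triad_arithmetic[OF _ _ _ sqrt_15_bounds s n(1)[of 1] n(2)[of 1] n(3)[of 1] n(1)[of 2] n(2)[of 2] n(3)[of 2] x y]
      by simp_all
    have "0 < ?p"
    proof (rule interaction_positive[OF s(1) sqrt_15_bounds])
      show "\<bar>u $ 1 - s1 / 4\<bar> < 1/2000" "\<bar>u $ 2 + s1 * (sqrt 15 / 4)\<bar> < 1/2000"
        using n(2)[of 1] n(2)[of 2] signs by simp_all
      show "\<bar>v $ 1 - s1 / 4\<bar> < 1/2000" "\<bar>v $ 3\<bar> < 1/2000"
        using n(1)[of 1] n(1)[of 3] by simp_all
      show "\<bar>w $ 1 + s1\<bar> < 1/2000" "\<bar>w $ 2\<bar> < 1/2000" "\<bar>w $ 3\<bar> < 1/2000"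
        using n(3)[of 1] n(3)[of 2] n(3)[of 3] signs by simp_all
    qed
    moreover have "0 \<le> - ?a"
    proof -
      have nn: "0 \<le> s1 * amplitude Planar u" "0 \<le> amplitude Scalar v" "0 \<le> - s1 * amplitude Source w"
        using amplitude_sign[OF s(2) near(2)] amplitude_sign[OF s(1) near(1)] amplitude_sign[OF s(3) near(3)] signs by simp_all
      have "0 \<le> (s1 * amplitude Planar u) * amplitude Scalar v * (- s1 * amplitude Source w)"
        by (rule mult_nonneg_nonneg[OF mult_nonneg_nonneg[OF nn(1,2)] nn(3)])
      also have "\<dots> = - ?a" using s(1) by auto
      finally show ?thesis .
    qed
    ultimately show ?thesis by (intro mult_nonneg_nonneg) auto
  next
    case True
    show ?thesis unfolding True by simp
  qed
  moreover have "0 \<le> (\<tau> / 8)\<^sup>2 * \<rho>" using \<rho> by simp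
  ultimately have "0 \<le> (\<tau> / 8)\<^sup>2 * \<rho> * (- ?a * ?p)"
    by (rule mult_nonneg_nonneg[rotated])
  then show thesis
    using that flux_density_formula[of \<xi> \<eta>] unfolding uvw[symmetric] z by blast
qed

lemma flux_density_at_triad:
  "flux_density ((2 * \<rho>) *\<^sub>R center Planar, (2 * \<rho>) *\<^sub>R center Scalar) = of_real ((\<tau> / 8)\<^sup>2 * \<rho> * (sqrt 15 / 16))"
proof -
  have \<rho>: "\<rho> > 0" using constants(1) by simp
  have w: "(- ((2 * \<rho>) *\<^sub>R center Planar) - (2 * \<rho>) *\<^sub>R center Scalar) /\<^sub>R \<rho> = - center Source"
    using \<rho> by (simp add: vec_eq_iff forall_3 field_simps)
  have uv: "((2 * \<rho>) *\<^sub>R center M) /\<^sub>R (\<rho> * 2) = center M" for M using \<rho> by (simp add: mult.commute)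
  have far: "chi ((2 *\<^sub>R center M) /\<^sub>R \<epsilon>) = 0" for M
    using constants(3,4) by (intro chi_zero) (simp add: norm_center divide_simps)
  have at: "amplitude M (center M) = 1" for M
    using cutoff_inner[OF chi, of 0] far[of M] by (simp add: amplitude_def scaleR_2)
  have at': "amplitude Source (- center Source) = -1"
    unfolding amplitude_minus at by simp
  show ?thesis
    unfolding flux_density_formula w uv at at' by (simp add: power2_eq_square)
qed

lemma flux_const_pos:
  obtains c where "c > 0" "flux_const = of_real c"
proof -
  obtain k where k: "k > 0" "inversion_const chi = complex_of_real k"
    by (rule inversion_const_pos[OF chi])
  have nn: "0 \<le> Re (flux_density z)" and re: "flux_density z = of_real (Re (flux_density z))" for z
    using flux_density_nonneg[of z] by (metis Re_complex_of_real)+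
  have "0 < (LINT z|lborel. Re (flux_density z))"
  proof (rule integral_pos_continuous)
    have "continuous_on UNIV (\<lambda>z. triple_symbol p p' p'' (prod.swap z))" for p p' p''
      by (rule continuous_on_compose2[OF continuous_triple_symbol]) (auto intro: continuous_on_swap)
    then show "continuous_on UNIV (\<lambda>z. Re (flux_density z))"
      unfolding flux_density_def by (intro continuous_on_Re continuous_on_add continuous_triple_symbol)
    show "integrable lborel (\<lambda>z. Re (flux_density z))"
      by (rule integrable_Re[OF flux_density_integrable])
    show "0 < Re (flux_density ((2 * \<rho>) *\<^sub>R center Planar, (2 * \<rho>) *\<^sub>R center Scalar))"
      unfolding flux_density_at_triad using constants by simp
  qed (rule nn)
  moreover have "(LINT z|lborel. flux_density z) = of_real (LINT z|lborel. Re (flux_density z))"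
  proof -
    have "(LINT z|lborel. flux_density z) = (LINT z|lborel. complex_of_real (Re (flux_density z)))"
      by (rule Bochner_Integration.integral_cong[OF refl re])
    then show ?thesis by (simp only: integral_complex_of_real)
  qed
  ultimately show thesis
    using that[of "k / (2 * pi) ^ 6 * (LINT z|lborel. Re (flux_density z))"] k
    by (simp add: flux_const_eq)
qed

end


section \<open>The velocity field\<close>

lemma inv_fourier_integrable_sum:
  assumes "\<And>k. k \<in> A \<Longrightarrow> test_fun (f k)"
  shows "inv_fourier (\<lambda>\<xi>. \<Sum>k\<in>A. f k \<xi>) x = (\<Sum>k\<in>A. inv_fourier (f k) x)"
  using assms by (intro inv_fourier_sum test_fun_integrable)

context flux_modes begin

definition level_symbol :: "nat \<Rightarrow> 3 \<Rightarrow> real^3 \<Rightarrow> complex" where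
  "level_symbol a j \<xi> = (\<Sum>M\<in>UNIV. symbol (M, a) j \<xi>)"

definition head_symbol :: "nat \<Rightarrow> 3 \<Rightarrow> real^3 \<Rightarrow> complex" where
  "head_symbol N j \<xi> = (\<Sum>a\<le>N. level_symbol a j \<xi>)"

definition level :: "nat \<Rightarrow> 3 \<Rightarrow> real^3 \<Rightarrow> complex" where
  "level a j = inv_fourier (level_symbol a j)"

definition head :: "nat \<Rightarrow> 3 \<Rightarrow> real^3 \<Rightarrow> complex" where
  "head N j = inv_fourier (head_symbol N j)"

definition magnitude :: "nat \<Rightarrow> real^3 \<Rightarrow> real" where
  "magnitude a x = (\<Sum>j\<in>UNIV. norm (level a j x))"

text \<open>At the origin the summands are \<open>\<tau>^a\<close> times a constant, so convergence
  is claimed only for nonzero \<open>x\<close>. There this function dominates all partial sums at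
  once and drives every passage to the limit.\<close>

definition majorant :: "real^3 \<Rightarrow> real" where
  "majorant x = (\<Sum>a. magnitude a x)"

definition velocity :: "real^3 \<Rightarrow> real^3" where
  "velocity x = (\<chi> j. \<Sum>a. Re (level a j x))"

abbreviation velocity_complex :: "3 \<Rightarrow> real^3 \<Rightarrow> complex" where
  "velocity_complex j x \<equiv> complex_of_real (velocity x $ j)"

lemma test_fun_level_symbol [intro]: "test_fun (level_symbol a j)"
  unfolding level_symbol_def[abs_def] by (intro test_fun_sum test_fun_symbol)

lemma test_fun_head_symbol [intro]: "test_fun (head_symbol N j)"
  unfolding head_symbol_def[abs_def] by (intro test_fun_sum test_fun_level_symbol)

lemma head_symbol_eq: "head_symbol N j \<xi> = (\<Sum>p\<in>UNIV \<times> {..N}. symbol p j \<xi>)"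
proof -
  have "head_symbol N j \<xi> = (\<Sum>M\<in>UNIV. \<Sum>a\<le>N. symbol (M, a) j \<xi>)"
    unfolding head_symbol_def level_symbol_def by (rule sum.swap)
  then show ?thesis by (simp add: sum.cartesian_product)
qed

lemma head_eq_waves: "head N j x = (\<Sum>p\<in>UNIV \<times> {..N}. wave p j x)"
  unfolding head_def head_symbol_eq[abs_def] wave_def
  by (rule inv_fourier_integrable_sum) (rule test_fun_symbol)

lemma head_eq_levels: "head N j x = (\<Sum>a\<le>N. level a j x)"
  unfolding head_def head_symbol_def[abs_def] level_def
  by (rule inv_fourier_integrable_sum) (rule test_fun_level_symbol)

lemma level_eq_waves: "level a j x = (\<Sum>M\<in>UNIV. wave (M, a) j x)"
  unfolding level_def level_symbol_def[abs_def] wave_def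
  by (rule inv_fourier_integrable_sum) (rule test_fun_symbol)

lemma level_scale: "level a j x = of_real (\<tau> ^ a) * level 0 j (2 ^ a *\<^sub>R x)"
  unfolding level_eq_waves sum_distrib_left using wave_shift[of _ 0 a] by simp

lemma magnitude_scale: "magnitude a x = \<tau> ^ a * magnitude 0 (2 ^ a *\<^sub>R x)"
  unfolding magnitude_def level_scale[of a] using constants(7)
  by (simp add: norm_mult sum_distrib_left norm_power)

lemma of_real_level: "complex_of_real (Re (level a j x)) = level a j x"
  unfolding level_eq_waves Re_sum of_real_sum of_real_wave ..

lemma level_symbol_nonzero:
  assumes "level_symbol a j \<xi> \<noteq> 0"
  shows "r * 2 ^ a < norm \<xi>" "norm \<xi> < 2 ^ a"
proof -
  obtain M where "symbol (M, a) j \<xi> \<noteq> 0"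
    using assms unfolding level_symbol_def by (metis sum.neutral)
  from freqs_shell[OF symbol_nonzero[OF this]] show "r * 2 ^ a < norm \<xi>" "norm \<xi> < 2 ^ a"
    by simp_all
qed

lemma head_symbol_solenoidal: "(\<Sum>i\<in>UNIV. \<xi> $ i * head_symbol N i \<xi>) = 0"
  unfolding head_symbol_eq sum_distrib_left
  by (subst sum.swap) (simp add: symbol_solenoidal)

lemma magnitude_nonneg: "0 \<le> magnitude a x"
  by (simp add: magnitude_def sum_nonneg)

lemma norm_level_le: "norm (level a j x) \<le> magnitude a x"
  unfolding magnitude_def by (rule member_le_sum) auto

lemma continuous_level: "continuous_on UNIV (level a j)"
  unfolding level_def by (intro smooth_continuous smooth_inv_fourier_test test_fun_level_symbol)

lemma measurable_level [measurable]: "level a j \<in> borel_measurable borel"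
  using continuous_level by (rule borel_measurable_continuous_onI)

lemma measurable_magnitude [measurable]: "magnitude a \<in> borel_measurable borel"
  unfolding magnitude_def[abs_def] by measurable

lemma measurable_majorant [measurable]: "majorant \<in> borel_measurable borel"
  unfolding majorant_def[abs_def] by measurable

lemma measurable_velocity_component [measurable]: "(\<lambda>x. velocity x $ j) \<in> borel_measurable borel"
  unfolding velocity_def by simp measurable

lemma measurable_velocity: "velocity \<in> borel_measurable borel"
proof -
  have "(\<lambda>x. velocity x \<bullet> b) \<in> borel_measurable borel" if "b \<in> Basis" for b
    using that by (auto simp: Basis_vec_def inner_axis)
  then show ?thesis by (subst borel_measurable_euclidean_space) blast
qed

section \<open>Convergence and integrability of the dyadic series\<close>

lemma magnitude_zero_bounds:
  obtains S D where "\<And>x. magnitude 0 x \<le> S" "\<And>x. norm x ^ 4 * magnitude 0 x \<le> D" "0 \<le> S" "0 \<le> D"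
proof -
  have "\<exists>C. \<forall>x. norm (level 0 j x) \<le> C" for j
    unfolding level_def by (rule inv_fourier_bounded[OF test_fun_level_symbol])
  then obtain C where C: "\<And>j x. norm (level 0 j x) \<le> C j" by metis
  have "\<exists>D. \<forall>x. norm x ^ 4 * norm (level 0 j x) \<le> D" for j
    unfolding level_def by (rule inv_fourier_decay[OF test_fun_level_symbol])
  then obtain D where D: "\<And>j x. norm x ^ 4 * norm (level 0 j x) \<le> D j" by metis
  have 1: "magnitude 0 x \<le> (\<Sum>j\<in>UNIV. C j)" for x unfolding magnitude_def by (intro sum_mono C)
  have 2: "norm x ^ 4 * magnitude 0 x \<le> (\<Sum>j\<in>UNIV. D j)" for x
    unfolding magnitude_def sum_distrib_left by (intro sum_mono D)
  show thesis
  proof (rule that[OF 1 2])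
    show "0 \<le> (\<Sum>j\<in>UNIV. C j)" using magnitude_nonneg 1 order_trans by blast
    show "0 \<le> (\<Sum>j\<in>UNIV. D j)" using 2[of 0] by simp
  qed
qed

lemma integrable_magnitude_zero: "integrable lborel (magnitude 0)"
  unfolding magnitude_def level_def
  by (intro Bochner_Integration.integrable_sum integrable_norm integrable_inv_fourier test_fun_level_symbol)

lemma integrable_magnitude_zero_power: "integrable lborel (\<lambda>x. magnitude 0 x ^ Suc n)"
proof -
  obtain S D where S: "\<And>x. magnitude 0 x \<le> S" and "0 \<le> S" by (rule magnitude_zero_bounds) blast
  show ?thesis
  proof (rule Bochner_Integration.integrable_bound)
    show "integrable lborel (\<lambda>x. S ^ n * magnitude 0 x)" using integrable_magnitude_zero by simp
    show "AE x in lborel. norm (magnitude 0 x ^ Suc n) \<le> norm (S ^ n * magnitude 0 x)"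
      using S magnitude_nonneg \<open>0 \<le> S\<close>
      by (intro AE_I2) (auto simp: abs_mult mult.commute[of "magnitude 0 _"] intro!: mult_right_mono power_mono)
  qed measurable
qed

text \<open>By scaling, the ratio per level is \<open>\<tau> / 8\<close> in \<open>L^1\<close>,
  \<open>\<tau>^2 / 8\<close> for squares and exactly 1/2 for cubes. The first two give summability,
  the last one the Besov rate.\<close>

lemma
  shows integrable_magnitude_power: "integrable lborel (\<lambda>x. magnitude a x ^ Suc n)"
    and integral_magnitude_power: "(LINT x|lborel. magnitude a x ^ Suc n) = (\<tau> ^ Suc n / 8) ^ a * (LINT x|lborel. magnitude 0 x ^ Suc n)"
proof -
  have eq: "magnitude a x ^ Suc n = (\<tau> ^ Suc n) ^ a * magnitude 0 (0 + 2 ^ a *\<^sub>R x) ^ Suc n" for x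
    unfolding magnitude_scale[of a] power_mult_distrib by (simp only: power_mult[symmetric] mult.commute add_0)
  have c: "(2::real) ^ a \<noteq> 0" by simp
  have e8: "\<bar>2 ^ a\<bar> ^ 3 = (8::real) ^ a" by (simp add: power_two_cubed)
  show "integrable lborel (\<lambda>x. magnitude a x ^ Suc n)"
    unfolding eq by (intro integrable_mult_right integrable_affine[OF integrable_magnitude_zero_power c])
  show "(LINT x|lborel. magnitude a x ^ Suc n) = (\<tau> ^ Suc n / 8) ^ a * (LINT x|lborel. magnitude 0 x ^ Suc n)"
    unfolding eq integral_mult_right_zero integral_affine[OF integrable_magnitude_zero_power c] e8
    by (simp add: power_divide field_simps)
qed

lemma tau_bounds: "\<tau> < 2" "\<tau>\<^sup>2 < 4"
proof -
  show "\<tau> < 2"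
  proof (rule ccontr)
    assume "\<not> \<tau> < 2"
    then have "2 ^ 3 \<le> \<tau> ^ 3" by (intro power_mono) auto
    then show False by (simp add: tau_cubed)
  qed
  then have "\<tau>\<^sup>2 < 2\<^sup>2" using constants(7) by (intro power_strict_mono) auto
  then show "\<tau>\<^sup>2 < 4" by simp
qed

text \<open>Fourth-order decay evaluated at \<open>2^a *\<^sub>R x\<close> yields
  \<open>16^(-a)\<close>, which beats the growth \<open>\<tau>^a\<close> of the amplitudes.\<close>

lemma magnitude_decay:
  assumes "x \<noteq> 0"
  obtains K where "0 \<le> K" "\<And>a. magnitude a x \<le> K * (\<tau> / 16) ^ a"
proof -
  obtain S D where D: "\<And>x. norm x ^ 4 * magnitude 0 x \<le> D" "0 \<le> D" by (rule magnitude_zero_bounds) blast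
  show thesis
  proof (rule that[of "D / norm x ^ 4"])
    show "0 \<le> D / norm x ^ 4" using D(2) by simp
    fix a
    have "(2 ^ a) ^ 4 = ((2::real) ^ 4) ^ a" by (simp only: power_mult[symmetric] mult.commute)
    then have "norm (2 ^ a *\<^sub>R x) ^ 4 = 16 ^ a * norm x ^ 4" by (simp add: power_mult_distrib)
    with D(1)[of "2 ^ a *\<^sub>R x"] have "magnitude 0 (2 ^ a *\<^sub>R x) \<le> D / (16 ^ a * norm x ^ 4)"
      using assms by (simp add: pos_le_divide_eq mult.commute)
    then have "magnitude a x \<le> \<tau> ^ a * (D / (16 ^ a * norm x ^ 4))"
      unfolding magnitude_scale[of a] using constants(7) by (intro mult_left_mono) auto
    then show "magnitude a x \<le> D / norm x ^ 4 * (\<tau> / 16) ^ a"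
      by (simp add: power_divide mult_ac)
  qed
qed

lemma summable_magnitude: "x \<noteq> 0 \<Longrightarrow> summable (\<lambda>a. magnitude a x)"
proof -
  assume "x \<noteq> 0"
  then obtain K where K: "\<And>a. magnitude a x \<le> K * (\<tau> / 16) ^ a" by (rule magnitude_decay) blast
  show ?thesis
  proof (rule summable_comparison_test')
    show "summable (\<lambda>a. K * (\<tau> / 16) ^ a)"
      using constants(7) tau_bounds by (intro summable_mult summable_geometric) auto
    show "norm (magnitude a x) \<le> K * (\<tau> / 16) ^ a" for a using K magnitude_nonneg by simp
  qed
qed

lemma level_sums:
  assumes "x \<noteq> 0"
  shows "(\<lambda>a. level a j x) sums velocity_complex j x"
proof -
  have "summable (\<lambda>a. Re (level a j x))"
    by (rule summable_comparison_test'[OF summable_magnitude[OF assms]])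
       (use norm_level_le abs_Re_le_cmod order_trans in \<open>fastforce\<close>)
  then have "(\<lambda>a. Re (level a j x)) sums (velocity x $ j)"
    unfolding velocity_def by (simp add: summable_sums)
  then have "(\<lambda>a. complex_of_real (Re (level a j x))) sums velocity_complex j x"
    by (rule sums_of_real)
  then show ?thesis unfolding of_real_level .
qed

lemma head_tendsto: "x \<noteq> 0 \<Longrightarrow> (\<lambda>N. head N j x) \<longlonglongrightarrow> velocity_complex j x"
  unfolding head_eq_levels using level_sums[of x j] by (simp add: sums_def_le)

lemma norm_head_le:
  assumes "x \<noteq> 0"
  shows "norm (head N j x) \<le> majorant x"
proof -
  have "norm (head N j x) \<le> (\<Sum>a\<le>N. magnitude a x)"
    unfolding head_eq_levels by (rule sum_norm_le) (rule norm_level_le)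
  also have "\<dots> \<le> majorant x"
    unfolding majorant_def by (rule sum_le_suminf[OF summable_magnitude[OF assms]]) (auto simp: magnitude_nonneg)
  finally show ?thesis .
qed

lemma majorant_nonneg: "x \<noteq> 0 \<Longrightarrow> 0 \<le> majorant x"
  using norm_head_le[of x 0 1] norm_ge_zero order_trans by blast

lemma norm_velocity_le: "x \<noteq> 0 \<Longrightarrow> norm (velocity_complex j x) \<le> majorant x"
  by (rule LIMSEQ_le_const2[OF tendsto_norm[OF head_tendsto]]) (auto intro: norm_head_le)

lemma integrable_majorant: "integrable lborel majorant"
  unfolding majorant_def
proof (rule integrable_suminf)
  show "integrable lborel (magnitude a)" for a using integrable_magnitude_power[of a 0] by simp
  show "AE x in lborel. summable (\<lambda>a. norm (magnitude a x))"
    by (rule eventually_mono[OF AE_lborel_singleton[of 0]]) (simp add: magnitude_nonneg summable_magnitude)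
  have "(LINT x|lborel. norm (magnitude a x)) = (\<tau> / 8) ^ a * (LINT x|lborel. magnitude 0 x)" for a
    using integral_magnitude_power[of a 0] by (simp add: magnitude_nonneg)
  then show "summable (\<lambda>a. LINT x|lborel. norm (magnitude a x))"
    using constants(7) tau_bounds by (auto intro!: summable_mult2 summable_geometric)
qed

text \<open>Cauchy--Schwarz with geometric weights gives \<open>majorant\<^sup>2 \<le> C * sum (magnitude a / s ^ a)\<^sup>2\<close>.\<close>

lemma integrable_majorant_square: "integrable lborel (\<lambda>x. (majorant x)\<^sup>2)"
proof -
  \<comment> \<open>Both \<open>s\<^sup>2\<close> and
    \<open>\<tau>\<^sup>2 / (8 * s\<^sup>2)\<close> must be below 1; as
    \<open>\<tau>\<^sup>2 < 4\<close>, any \<open>s\<close> with square between 1/2 and 1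
    serves.\<close>
  define s :: real where "s = 9/10"
  have s: "0 < s" "s\<^sup>2 < 1" by (simp_all add: s_def power2_eq_square)
  let ?g = "\<lambda>a x. (magnitude a x / s ^ a)\<^sup>2"
  have g: "?g a x = (magnitude a x) ^ Suc 1 * (1 / s\<^sup>2) ^ a" for a x
    by (simp add: power_divide power2_eq_square power_mult_distrib)
  have sumg: "summable (\<lambda>a. ?g a x)" if "x \<noteq> 0" for x
  proof -
    obtain K where K: "0 \<le> K" "\<And>a. magnitude a x \<le> K * (\<tau> / 16) ^ a" by (rule magnitude_decay[OF \<open>x \<noteq> 0\<close>]) blast
    show ?thesis
    proof (rule summable_comparison_test')
      have "\<tau> / 16 / s < 1" using tau_bounds by (simp add: s_def)
      then have "(\<tau> / 16 / s)\<^sup>2 < 1\<^sup>2" using constants(7) s by (intro power_strict_mono) auto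
      then show "summable (\<lambda>a. K\<^sup>2 * ((\<tau> / 16 / s)\<^sup>2) ^ a)"
        by (intro summable_mult summable_geometric) simp
      fix a
      have "magnitude a x / s ^ a \<le> K * (\<tau> / 16 / s) ^ a"
        using K(2)[of a] s by (simp add: power_divide field_simps)
      then have "?g a x \<le> (K * (\<tau> / 16 / s) ^ a)\<^sup>2"
        using magnitude_nonneg s by (intro power_mono) auto
      also have "\<dots> = K\<^sup>2 * ((\<tau> / 16 / s)\<^sup>2) ^ a"
        by (simp only: power_mult_distrib power_mult[symmetric] mult.commute)
      finally show "norm (?g a x) \<le> K\<^sup>2 * ((\<tau> / 16 / s)\<^sup>2) ^ a" by simp
    qed
  qed
  have intg: "integrable lborel (\<lambda>x. \<Sum>a. ?g a x)"
  proof (rule integrable_suminf)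
    show "integrable lborel (?g a)" for a
      unfolding g by (rule integrable_mult_left) (rule integrable_magnitude_power)
    show "AE x in lborel. summable (\<lambda>a. norm (?g a x))"
      by (rule eventually_mono[OF AE_lborel_singleton[of 0]]) (use sumg in simp)
    have "(LINT x|lborel. norm (?g a x)) = (\<tau>\<^sup>2 / 8 / s\<^sup>2) ^ a * (LINT x|lborel. (magnitude 0 x)\<^sup>2)" for a
    proof -
      have "(LINT x|lborel. norm (?g a x)) = (LINT x|lborel. ?g a x)" by simp
      also have "\<dots> = (\<tau> ^ Suc 1 / 8) ^ a * (LINT x|lborel. magnitude 0 x ^ Suc 1) * (1 / s\<^sup>2) ^ a"
        unfolding g integral_mult_left_zero integral_magnitude_power[of a 1] ..
      finally show ?thesis by (simp add: power_divide numeral_2_eq_2)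
    qed
    moreover have "norm (\<tau>\<^sup>2 / 8 / s\<^sup>2) < 1" using tau_bounds by (simp add: s_def power2_eq_square)
    ultimately show "summable (\<lambda>a. LINT x|lborel. norm (?g a x))"
      by (auto intro!: summable_mult2 summable_geometric)
  qed
  let ?C = "\<Sum>a. (s\<^sup>2) ^ a"
  have sC: "summable (\<lambda>a. (s\<^sup>2) ^ a)" using s by (intro summable_geometric) auto
  have bound: "(majorant x)\<^sup>2 \<le> ?C * (\<Sum>a. ?g a x)" if "x \<noteq> 0" for x
  proof (rule LIMSEQ_le_const2)
    show "(\<lambda>n. (\<Sum>a<n. magnitude a x)\<^sup>2) \<longlonglongrightarrow> (majorant x)\<^sup>2"
      unfolding majorant_def using summable_LIMSEQ[OF summable_magnitude[OF that]] by (rule tendsto_power)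
    have "(\<Sum>a<n. magnitude a x)\<^sup>2 \<le> ?C * (\<Sum>a. ?g a x)" for n
    proof -
      have "(\<Sum>a<n. magnitude a x)\<^sup>2 = (\<Sum>a<n. s ^ a * (magnitude a x / s ^ a))\<^sup>2" using s by simp
      also have "\<dots> \<le> (\<Sum>a<n. (s ^ a)\<^sup>2) * (\<Sum>a<n. ?g a x)" by (rule Cauchy_Schwarz_ineq_sum)
      also have "(\<Sum>a<n. (s ^ a)\<^sup>2) = (\<Sum>a<n. (s\<^sup>2) ^ a)" by (simp only: power_mult[symmetric] mult.commute)
      also have "(\<Sum>a<n. (s\<^sup>2) ^ a) * (\<Sum>a<n. ?g a x) \<le> ?C * (\<Sum>a. ?g a x)"
      proof (rule mult_mono)
        show "(\<Sum>a<n. (s\<^sup>2) ^ a) \<le> ?C" by (rule sum_le_suminf[OF sC]) auto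
        show "(\<Sum>a<n. ?g a x) \<le> (\<Sum>a. ?g a x)" by (rule sum_le_suminf[OF sumg[OF that]]) auto
        show "0 \<le> ?C" by (rule suminf_nonneg[OF sC]) auto
      qed (auto intro: sum_nonneg)
      finally show ?thesis .
    qed
    then show "\<exists>N. \<forall>n\<ge>N. (\<Sum>a<n. magnitude a x)\<^sup>2 \<le> ?C * (\<Sum>a. ?g a x)" by blast
  qed
  show ?thesis
  proof (rule Bochner_Integration.integrable_bound)
    show "integrable lborel (\<lambda>x. ?C * (\<Sum>a. ?g a x))" by (rule integrable_mult_right) (rule intg)
    show "AE x in lborel. norm ((majorant x)\<^sup>2) \<le> norm (?C * (\<Sum>a. ?g a x))"
      by (rule eventually_mono[OF AE_lborel_singleton[of 0]]) (use bound in force)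
  qed measurable
qed

lemma integrable_velocity: "integrable lborel (velocity_complex j)"
proof (rule Bochner_Integration.integrable_bound[OF integrable_majorant])
  show "AE x in lborel. norm (velocity_complex j x) \<le> norm (majorant x)"
    by (rule eventually_mono[OF AE_lborel_singleton[of 0]])
       (use norm_velocity_le majorant_nonneg in \<open>force simp del: norm_of_real\<close>)
qed measurable

lemma integrable_velocity_product: "integrable lborel (\<lambda>x. velocity_complex i x * velocity_complex j x)"
proof (rule Bochner_Integration.integrable_bound[OF integrable_majorant_square])
  show "AE x in lborel. norm (velocity_complex i x * velocity_complex j x) \<le> norm ((majorant x)\<^sup>2)"
  proof (rule eventually_mono[OF AE_lborel_singleton[of 0]])
    fix x :: "real^3" assume "x \<noteq> 0"
    then show "norm (velocity_complex i x * velocity_complex j x) \<le> norm ((majorant x)\<^sup>2)"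
      using mult_mono[OF norm_velocity_le[of x i] norm_velocity_le[of x j]] majorant_nonneg[of x]
      by (simp add: norm_mult power2_eq_square del: norm_of_real)
  qed
qed measurable

lemma velocity_in_L2: "in_Lp 2 velocity"
proof -
  have "integrable lborel (\<lambda>x. (velocity x $ j)\<^sup>2)" for j
    using integrable_Re[OF integrable_velocity_product[of j j]] by (simp add: power2_eq_square)
  then have "integrable lborel (\<lambda>x. \<Sum>j\<in>UNIV. (velocity x $ j)\<^sup>2)"
    by (intro Bochner_Integration.integrable_sum)
  also have "(\<lambda>x. \<Sum>j\<in>UNIV. (velocity x $ j)\<^sup>2) = (\<lambda>x. norm (velocity x) powr 2)"
  proof
    fix x
    have "norm (velocity x) powr 2 = (norm (velocity x))\<^sup>2" by simp
    also have "\<dots> = velocity x \<bullet> velocity x" by (rule power2_norm_eq_inner)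
    finally show "(\<Sum>j\<in>UNIV. (velocity x $ j)\<^sup>2) = norm (velocity x) powr 2"
      by (simp add: inner_vec_def power2_eq_square)
  qed
  finally show ?thesis
    using measurable_velocity by (simp add: in_Lp_def)
qed

section \<open>Passage from partial sums to the field\<close>

lemma head_integral_tendsto:
  assumes g: "g \<in> borel_measurable borel" "\<And>x. norm (g x) \<le> C"
  shows "(\<lambda>N. LINT x|lborel. g x * head N j x) \<longlonglongrightarrow> (LINT x|lborel. g x * velocity_complex j x)"
proof -
  note [measurable] = g(1)
  have [measurable]: "head N j \<in> borel_measurable borel" for N
    unfolding head_def by (intro inv_fourier_measurable test_fun_integrable test_fun_head_symbol)
  show ?thesis
  proof (rule integral_dominated_convergence[where w = "\<lambda>x. C * majorant x"])
    show "AE x in lborel. (\<lambda>N. g x * head N j x) \<longlonglongrightarrow> g x * velocity_complex j x"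
      by (rule eventually_mono[OF AE_lborel_singleton[of 0]]) (intro tendsto_mult_left head_tendsto)
    show "AE x in lborel. norm (g x * head N j x) \<le> C * majorant x" for N
    proof (rule eventually_mono[OF AE_lborel_singleton[of 0]])
      fix x :: "real^3" assume "x \<noteq> 0"
      have "0 \<le> C" using g(2)[of 0] norm_ge_zero order_trans by blast
      then show "norm (g x * head N j x) \<le> C * majorant x"
        unfolding norm_mult by (intro mult_mono g(2) norm_head_le \<open>x \<noteq> 0\<close>) auto
    qed
    show "integrable lborel (\<lambda>x. C * majorant x)" using integrable_majorant by simp
  qed measurable
qed

lemma head_product_integral_tendsto:
  assumes g: "g \<in> borel_measurable borel" "\<And>x. norm (g x) \<le> C"
  shows "(\<lambda>N. LINT x|lborel. head N i x * head N j x * g x)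
    \<longlonglongrightarrow> (LINT x|lborel. velocity_complex i x * velocity_complex j x * g x)"
proof -
  note [measurable] = g(1)
  have [measurable]: "head N j \<in> borel_measurable borel" for N j
    unfolding head_def by (intro inv_fourier_measurable test_fun_integrable test_fun_head_symbol)
  show ?thesis
  proof (rule integral_dominated_convergence[where w = "\<lambda>x. (majorant x)\<^sup>2 * C"])
    show "AE x in lborel. (\<lambda>N. head N i x * head N j x * g x) \<longlonglongrightarrow> velocity_complex i x * velocity_complex j x * g x"
      by (rule eventually_mono[OF AE_lborel_singleton[of 0]]) (intro tendsto_mult tendsto_const head_tendsto)
    show "AE x in lborel. norm (head N i x * head N j x * g x) \<le> (majorant x)\<^sup>2 * C" for N
    proof (rule eventually_mono[OF AE_lborel_singleton[of 0]])
      fix x :: "real^3" assume "x \<noteq> 0"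
      then show "norm (head N i x * head N j x * g x) \<le> (majorant x)\<^sup>2 * C"
        unfolding norm_mult power2_eq_square
        by (intro mult_mono g(2) norm_head_le mult_nonneg_nonneg majorant_nonneg) auto
    qed
    show "integrable lborel (\<lambda>x. (majorant x)\<^sup>2 * C)" using integrable_majorant_square by simp
  qed measurable
qed

lemma velocity_divergence_free: "divergence_free velocity"
  unfolding divergence_free_def
proof (intro allI impI)
  fix f assume f: "schwartz f"
  have df: "schwartz (partial_deriv i f)" for i using f by (rule schwartz_partial_deriv)
  have lim: "(\<lambda>N. LINT x|lborel. partial_deriv i f x * head N i x) \<longlonglongrightarrow> (LINT x|lborel. partial_deriv i f x * velocity_complex i x)" for i
    using schwartz_bounded[OF df] head_integral_tendsto[OF smooth_measurable[OF schwartz_smooth[OF df]]] by blast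
  have zero: "(\<Sum>i\<in>UNIV. LINT x|lborel. partial_deriv i f x * head N i x) = 0" for N
    using divergence_free_weak[OF test_fun_head_symbol head_symbol_solenoidal smooth_differentiable[OF schwartz_smooth[OF f]]
        smooth_continuous[OF schwartz_smooth[OF df]] schwartz_integrable[OF f] schwartz_integrable[OF df], of N]
    by (simp add: head_def mult.commute)
  have "(\<lambda>N. \<Sum>i\<in>UNIV. LINT x|lborel. partial_deriv i f x * head N i x) \<longlonglongrightarrow> (\<Sum>i\<in>UNIV. LINT x|lborel. partial_deriv i f x * velocity_complex i x)"
    by (intro tendsto_sum lim)
  then have "(\<Sum>i\<in>UNIV. LINT x|lborel. partial_deriv i f x * velocity_complex i x) = 0"
    unfolding zero by (simp add: LIMSEQ_const_iff)
  then show "(\<Sum>i\<in>UNIV. distr_deriv i (comp_distr velocity i) f) = 0"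
    unfolding distr_deriv_def comp_distr_def distr_of_def by (simp add: sum_negf mult.commute)
qed

end


section \<open>Energy flux and Besov regularity\<close>

lemma tempered_distr_of:
  assumes g: "integrable lborel g"
  shows "tempered (distr_of g)"
  unfolding tempered_def
proof (intro conjI allI impI)
  have int: "integrable lborel (\<lambda>x. g x * f x)" if "schwartz f" for f
    using schwartz_bounded[OF that] integrable_mult_bounded(2)[OF g smooth_measurable[OF schwartz_smooth[OF that]]] by blast
  show "distr_of g (\<lambda>x. f x + h x) = distr_of g f + distr_of g h" if "schwartz f" "schwartz h" for f h
    using int that by (simp add: distr_of_def distrib_left)
  show "distr_of g (\<lambda>x. c * f x) = c * distr_of g f" for c f
    by (simp add: distr_of_def mult.left_commute)
  let ?A = "LINT x|lborel. norm (g x)"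
  have "norm (distr_of g f) \<le> ?A * (\<Sum>k\<le>0. \<Sum>ks | length ks \<le> 0. schwartz_seminorm k ks f)"
    if f: "schwartz f" for f
  proof -
    have "bdd_above (range (\<lambda>x. norm x ^ 0 * norm (partial_derivs [] f x)))"
      by (rule f[unfolded schwartz_def, THEN conjunct2, THEN spec, THEN spec])
    then have sup: "norm (f x) \<le> schwartz_seminorm 0 [] f" for x
      unfolding schwartz_seminorm_def using cSUP_upper[of x UNIV "\<lambda>x. norm x ^ 0 * norm (partial_derivs [] f x)"] by simp
    have "norm (distr_of g f) \<le> (LINT x|lborel. norm (g x * f x))"
      unfolding distr_of_def by (rule integral_norm_bound)
    also have "\<dots> \<le> (LINT x|lborel. norm (g x) * schwartz_seminorm 0 [] f)"
      using integrable_norm[OF int[OF f]] g sup by (intro integral_mono) (auto simp: norm_mult intro!: mult_left_mono)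
    finally show ?thesis by simp
  qed
  then show "\<exists>C N. \<forall>f. schwartz f \<longrightarrow>
      norm (distr_of g f) \<le> C * (\<Sum>k\<le>N. \<Sum>ks | length ks \<le> N. schwartz_seminorm k ks f)"
    by blast
qed

context flux_modes begin

lemma partial_deriv_wave: "partial_deriv i (wave p j) = inv_fourier (\<lambda>\<xi>. \<i> * \<xi> $ i * symbol p j \<xi>)"
  unfolding wave_def by (rule partial_deriv_inv_fourier_test(1)[OF test_fun_symbol])

lemma partial_deriv_head: "partial_deriv i (head N j) x = (\<Sum>p\<in>UNIV \<times> {..N}. partial_deriv i (wave p j) x)"
proof -
  have "partial_deriv i (head N j) x = inv_fourier (\<lambda>\<xi>. \<i> * \<xi> $ i * head_symbol N j \<xi>) x"
    unfolding head_def by (simp only: partial_deriv_inv_fourier_test(1)[OF test_fun_head_symbol])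
  also have "\<dots> = (\<Sum>p\<in>UNIV \<times> {..N}. inv_fourier (\<lambda>\<xi>. \<i> * \<xi> $ i * symbol p j \<xi>) x)"
    unfolding head_symbol_eq sum_distrib_left
    by (rule inv_fourier_integrable_sum) (rule partial_deriv_inv_fourier_test(2)[OF test_fun_symbol])
  finally show ?thesis unfolding partial_deriv_wave .
qed

lemma advection_head:
  assumes "Suc Q \<le> N"
  shows "advection (head N) (head N) (head Q) = flux_const"
proof -
  let ?I = "\<lambda>n. (UNIV :: mode set) \<times> {..n::nat}"
  let ?J = "\<lambda>i j p p' p'' x. wave p i x * wave p' j x * partial_deriv i (wave p'' j) x"
  have int: "integrable lborel (?J i j p p' p'')" for i j p p' p''
    unfolding wave_def by (rule advection_integrable[OF test_fun_symbol test_fun_symbol test_fun_symbol])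
  have "(LINT x|lborel. head N i x * head N j x * partial_deriv i (head Q j) x)
      = (\<Sum>p\<in>?I N. \<Sum>p'\<in>?I N. \<Sum>p''\<in>?I Q. LINT x|lborel. ?J i j p p' p'' x)" for i j
  proof -
    have "head N i x * head N j x * partial_deriv i (head Q j) x = (\<Sum>p\<in>?I N. \<Sum>p'\<in>?I N. \<Sum>p''\<in>?I Q. ?J i j p p' p'' x)" for x
      unfolding head_eq_waves partial_deriv_head sum_product unfolding sum_distrib_left sum_distrib_right
      by (intro sum.cong[OF refl] sum.swap)
    then show ?thesis
      by (simp only: Bochner_Integration.integral_sum Bochner_Integration.integrable_sum int)
  qed
  then have "advection (head N) (head N) (head Q)
      = (\<Sum>i\<in>UNIV. \<Sum>j\<in>UNIV. \<Sum>p\<in>?I N. \<Sum>p'\<in>?I N. \<Sum>p''\<in>?I Q. LINT x|lborel. ?J i j p p' p'' x)"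
    unfolding advection_def by simp
  also have "\<dots> = (\<Sum>p\<in>?I N. \<Sum>p'\<in>?I N. \<Sum>p''\<in>?I Q. \<Sum>i\<in>UNIV. \<Sum>j\<in>UNIV. LINT x|lborel. ?J i j p p' p'' x)"
    by (simp only: sum.swap[of _ "?I N" "UNIV :: 3 set"] sum.swap[of _ "?I Q" "UNIV :: 3 set"])
  also have "\<dots> = flux_const"
    using transfer_sum[OF assms] unfolding transfer_def advection_def .
  finally show ?thesis .
qed

section \<open>Littlewood-Paley pieces and flux of the field\<close>

lemma fourier_velocity_tendsto:
  "(\<lambda>N. inversion_const chi * head_symbol N j \<xi>) \<longlonglongrightarrow> fourier (velocity_complex j) \<xi>"
proof -
  have m: "(\<lambda>x. cis (- (x \<bullet> \<xi>))) \<in> borel_measurable borel" by measurable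
  have "(\<lambda>N. LINT x|lborel. cis (- (x \<bullet> \<xi>)) * head N j x) \<longlonglongrightarrow> (LINT x|lborel. cis (- (x \<bullet> \<xi>)) * velocity_complex j x)"
    by (rule head_integral_tendsto[OF m, of 1]) simp
  moreover have "(LINT x|lborel. cis (- (x \<bullet> \<xi>)) * head N j x) = inversion_const chi * head_symbol N j \<xi>" for N
    using fourier_inv_fourier[OF chi test_fun_head_symbol] by (simp add: head_def fourier_def)
  ultimately show ?thesis by (simp add: fourier_def)
qed

text \<open>A multiplier of bounded support sees only finitely many levels, so the sequence
  converging to the filtered transform is eventually constant and the limit becomes an
  identity.\<close>

lemma multiplier_velocity:
  assumes "\<And>N. N0 \<le> N \<Longrightarrow> of_real (m \<xi>) * head_symbol N j \<xi> = h"
  shows "of_real (m \<xi>) * fourier (velocity_complex j) \<xi> = inversion_const chi * h"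
proof -
  have "(\<lambda>N. of_real (m \<xi>) * (inversion_const chi * head_symbol N j \<xi>)) \<longlonglongrightarrow> of_real (m \<xi>) * fourier (velocity_complex j) \<xi>"
    by (intro tendsto_mult_left fourier_velocity_tendsto)
  moreover have "\<forall>\<^sub>F N in sequentially. of_real (m \<xi>) * (inversion_const chi * head_symbol N j \<xi>) = inversion_const chi * h"
    using assms by (intro eventually_sequentiallyI[of N0]) (metis mult.left_commute)
  then have "(\<lambda>N. of_real (m \<xi>) * (inversion_const chi * head_symbol N j \<xi>)) \<longlonglongrightarrow> inversion_const chi * h"
    by (rule tendsto_eventually)
  ultimately show ?thesis by (rule LIMSEQ_unique)
qed

text \<open>The shell between \<open>r * 2^a\<close> and \<open>2^a\<close> avoids the transition
  zone of every dyadic dilate of \<open>chi\<close>: for \<open>a < q\<close> it lies within radius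
  \<open>2^q / 2\<close>, otherwise beyond \<open>r * 2^q\<close>.\<close>

lemma chi_level:
  "chi (\<xi> /\<^sub>R 2 ^ q) * level_symbol a j \<xi> = (if a < q then level_symbol a j \<xi> else 0)"
proof (cases "level_symbol a j \<xi> = 0")
  case False
  note n = level_symbol_nonzero[OF False]
  show ?thesis
  proof (cases "a < q")
    case True
    then have "(2::real) ^ Suc a \<le> 2 ^ q" by (intro power_increasing) auto
    then have "norm \<xi> \<le> 2 ^ q / 2" using n(2) by simp
    then have "norm (\<xi> /\<^sub>R 2 ^ q) \<le> 1/2" by (simp add: field_simps)
    then show ?thesis using True cutoff_inner[OF chi] by simp
  next
    case False
    then have "(2::real) ^ q \<le> 2 ^ a" by (intro power_increasing) auto
    then have "r * 2 ^ q \<le> r * 2 ^ a" using r by (intro mult_left_mono) auto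
    then have "r * 2 ^ q \<le> norm \<xi>" using n(1) by linarith
    then have "r \<le> norm (\<xi> /\<^sub>R 2 ^ q)" by (simp add: field_simps)
    then show ?thesis using False chi_outside by simp
  qed
qed simp

lemma chi_head:
  assumes "Q \<le> N"
  shows "chi (\<xi> /\<^sub>R 2 ^ Suc Q) * head_symbol N j \<xi> = head_symbol Q j \<xi>"
proof -
  have "chi (\<xi> /\<^sub>R 2 ^ Suc Q) * head_symbol N j \<xi> = (\<Sum>a\<le>N. if a < Suc Q then level_symbol a j \<xi> else 0)"
    unfolding head_symbol_def sum_distrib_left chi_level ..
  also have "\<dots> = (\<Sum>a\<in>{..N} \<inter> {a. a < Suc Q}. level_symbol a j \<xi>)"
    by (simp add: sum.inter_restrict)
  also have "{..N} \<inter> {a. a < Suc Q} = {..Q}" using assms by auto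
  finally show ?thesis by (simp add: head_symbol_def)
qed

lemma smooth_rep_velocity:
  "smooth_rep (lp_sum chi (int Q) (comp_distr velocity j)) = (\<lambda>x. inversion_const chi * head Q j x)"
proof -
  have "(\<lambda>\<xi>. chi (\<xi> /\<^sub>R 2 ^ Suc Q) * fourier (velocity_complex j) \<xi>) = (\<lambda>\<xi>. inversion_const chi * head_symbol Q j \<xi>)"
    by (intro ext multiplier_velocity[of Q "\<lambda>\<xi>. chi (\<xi> /\<^sub>R 2 ^ Suc Q)"]) (rule chi_head)
  then have eq: "inv_fourier (\<lambda>\<xi>. chi (\<xi> /\<^sub>R 2 ^ Suc Q) * fourier (velocity_complex j) \<xi>) = (\<lambda>x. inversion_const chi * head Q j x)"
    unfolding head_def by (auto simp: inv_fourier_cmult)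
  show ?thesis
    unfolding comp_distr_def
  proof (rule smooth_rep_eq[OF chi])
    show "smooth (\<lambda>x. inversion_const chi * head Q j x)"
      unfolding head_def
      by (intro smooth_bounded_linear[OF bounded_linear_mult_right] smooth_inv_fourier_test test_fun_head_symbol)
    show "represents (\<lambda>x. inversion_const chi * head Q j x) (lp_sum chi (int Q) (distr_of (velocity_complex j)))"
      using represents_lp_sum[OF chi integrable_velocity, of Q j] unfolding eq .
  qed
qed

text \<open>The filter is self-adjoint up to the inversion constant, and \<open>head Q\<close> is
  already invariant under it. Moving the filter to that side removes it, so the low-pass part of the
  products of velocity components never has to be computed.\<close>

lemma filtered_pairing:
  fixes Q :: nat
  assumes g: "integrable lborel g"
  defines "s \<equiv> smooth_rep (lp_sum chi (int Q) (distr_of g))"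
  shows "integrable lborel (\<lambda>x. s x * partial_deriv i (head Q j) x)"
    and "(LINT x|lborel. s x * partial_deriv i (head Q j) x)
      = inversion_const chi * (LINT x|lborel. g x * partial_deriv i (head Q j) x)"
proof -
  let ?m = "\<lambda>\<xi>. chi (\<xi> /\<^sub>R 2 ^ Suc Q)"
  let ?w = "\<lambda>\<xi>. ?m \<xi> * fourier g \<xi>"
  let ?\<kappa> = "inversion_const chi"
  define h where "h \<xi> = \<i> * \<xi> $ i * head_symbol Q j \<xi>" for \<xi>
  have h: "test_fun h" and G: "partial_deriv i (head Q j) = inv_fourier h"
    unfolding h_def[abs_def] head_def using partial_deriv_inv_fourier_test[OF test_fun_head_symbol] by auto
  have m: "test_fun (\<lambda>\<xi>. complex_of_real (?m \<xi>))" by (rule cutoff_dilate_test_fun[OF chi]) simp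
  note w = integrable_multiplier_symbol[OF g m] bounded_support_multiplier_symbol[OF g m]
  have s: "s = inv_fourier ?w"
    unfolding s_def by (rule smooth_rep_eq[OF chi smooth_inv_fourier[OF w] represents_lp_sum[OF chi g]])
  have iG: "integrable lborel (inv_fourier h)" by (rule integrable_inv_fourier[OF h])
  show "integrable lborel (\<lambda>x. s x * partial_deriv i (head Q j) x)"
    unfolding s G by (rule integrable_inv_fourier_mult[OF iG w(1)])
  let ?k = "\<lambda>\<xi>. ?\<kappa> / (2 * pi) ^ 3 * h (- \<xi>)"
  have IG: "inv_fourier (inv_fourier h) = ?k"
    unfolding inv_fourier_eq[of "inv_fourier h"] fourier_inv_fourier[OF chi h] by auto
  have h': "test_fun (\<lambda>\<xi>. h (- \<xi>))" using test_fun_affine[OF h, of "-1" 0] by simp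
  have k: "test_fun ?k" by (rule test_fun_cmult[OF h'])
  \<comment> \<open>The symbol of \<open>head Q\<close> lives on levels up to \<open>Q\<close>,
    where the cutoff at \<open>2^(Q+1)\<close> is 1; evenness of \<open>chi\<close> carries this
    over to the reflected argument.\<close>
  have mk: "?m \<xi> * ?k \<xi> = ?k \<xi>" for \<xi>
  proof -
    have "?m \<xi> = ?m (- \<xi>)" using cutoff_even[OF chi, of "\<xi> /\<^sub>R 2 ^ Suc Q"] by simp
    then have "?m \<xi> * h (- \<xi>) = h (- \<xi>)"
      using chi_head[of Q Q "- \<xi>" j] unfolding h_def by (metis mult.left_commute order_refl)
    then show ?thesis by (metis mult.left_commute)
  qed
  have Fk: "fourier ?k x = ?\<kappa> * inv_fourier h x" for x
  proof -
    have [measurable]: "h \<in> borel_measurable borel" by (rule test_fun_measurable[OF h])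
    have "fourier ?k x = ?\<kappa> / (2 * pi) ^ 3 * (LINT \<xi>|lborel. cis (- (\<xi> \<bullet> x)) * h (- \<xi>))"
      unfolding fourier_def by (simp only: mult.left_commute[of "cis _"] integral_mult_right_zero)
    also have "(LINT \<xi>|lborel. cis (- (\<xi> \<bullet> x)) * h (- \<xi>)) = (LINT \<xi>|lborel. cis (\<xi> \<bullet> x) * h \<xi>)"
      using integral_reflect[of "\<lambda>\<xi>. cis (\<xi> \<bullet> x) * h \<xi>"] by simp
    finally show ?thesis by (simp add: inv_fourier_def inner_commute)
  qed
  have "(LINT x|lborel. s x * partial_deriv i (head Q j) x) = (LINT \<xi>|lborel. ?w \<xi> * inv_fourier (inv_fourier h) \<xi>)"
    unfolding s G by (rule inv_fourier_duality[OF w(1) iG, symmetric])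
  also have "\<dots> = (LINT \<xi>|lborel. fourier g \<xi> * ?k \<xi>)"
  proof (rule Bochner_Integration.integral_cong[OF refl])
    fix \<xi>
    have "?w \<xi> * ?k \<xi> = fourier g \<xi> * (?m \<xi> * ?k \<xi>)" by (simp only: mult_ac)
    then show "?w \<xi> * inv_fourier (inv_fourier h) \<xi> = fourier g \<xi> * ?k \<xi>" unfolding IG mk .
  qed
  also have "\<dots> = (LINT x|lborel. g x * fourier ?k x)"
    by (rule fourier_duality[OF g test_fun_integrable[OF k], symmetric])
  also have "\<dots> = ?\<kappa> * (LINT x|lborel. g x * partial_deriv i (head Q j) x)"
    unfolding Fk G by (simp only: mult.left_commute[of "g _"] integral_mult_right_zero)
  finally show "(LINT x|lborel. s x * partial_deriv i (head Q j) x) = ?\<kappa> * (LINT x|lborel. g x * partial_deriv i (head Q j) x)" .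
qed

text \<open>One inversion constant comes from filtering the velocity, the other from moving the
  filter off the product. The value does not depend on \<open>Q\<close>.\<close>

lemma energy_flux_velocity: "energy_flux chi velocity (int Q) = Re ((inversion_const chi)\<^sup>2 * flux_const)"
proof -
  let ?\<kappa> = "inversion_const chi"
  let ?g = "\<lambda>i j x. velocity_complex i x * velocity_complex j x"
  let ?d = "\<lambda>i j. partial_deriv i (head Q j)"
  let ?s = "\<lambda>i j. smooth_rep (lp_sum chi (int Q) (tensor_distr velocity i j))"
  have T: "tensor_distr velocity i j = distr_of (?g i j)" for i j
    by (simp add: tensor_distr_def)
  have p: "integrable lborel (\<lambda>x. ?s i j x * ?d i j x)"
    "(LINT x|lborel. ?s i j x * ?d i j x) = ?\<kappa> * (LINT x|lborel. ?g i j x * ?d i j x)" for i j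
    unfolding T by (rule filtered_pairing[OF integrable_velocity_product])+
  have D: "partial_deriv i (smooth_rep (lp_sum chi (int Q) (comp_distr velocity j))) = (\<lambda>x. ?\<kappa> * ?d i j x)" for i j
  proof -
    have "smooth (head Q j)" unfolding head_def by (rule smooth_inv_fourier_test[OF test_fun_head_symbol])
    then show ?thesis
      unfolding smooth_rep_velocity
      by (auto simp: partial_deriv_bounded_linear[OF bounded_linear_mult_right smooth_differentiable])
  qed
  have int: "integrable lborel (\<lambda>x. ?s i j x * (?\<kappa> * ?d i j x))" for i j
    using integrable_mult_right[OF p(1)[of i j], of ?\<kappa>] by (simp add: mult.left_commute)
  have "(LINT x|lborel. (\<Sum>i\<in>UNIV. \<Sum>j\<in>UNIV. ?s i j x * (?\<kappa> * ?d i j x)))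
      = (\<Sum>i\<in>UNIV. \<Sum>j\<in>UNIV. LINT x|lborel. ?s i j x * (?\<kappa> * ?d i j x))"
    by (simp only: Bochner_Integration.integral_sum Bochner_Integration.integrable_sum int)
  also have "\<dots> = (\<Sum>i\<in>UNIV. \<Sum>j\<in>UNIV. ?\<kappa>\<^sup>2 * (LINT x|lborel. ?g i j x * ?d i j x))"
  proof (intro sum.cong refl)
    fix i j
    have "(LINT x|lborel. ?s i j x * (?\<kappa> * ?d i j x)) = ?\<kappa> * (LINT x|lborel. ?s i j x * ?d i j x)"
      by (simp only: mult.left_commute[of "?s i j _"] integral_mult_right_zero)
    then show "(LINT x|lborel. ?s i j x * (?\<kappa> * ?d i j x)) = ?\<kappa>\<^sup>2 * (LINT x|lborel. ?g i j x * ?d i j x)"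
      unfolding p(2) by (simp add: power2_eq_square)
  qed
  also have "\<dots> = ?\<kappa>\<^sup>2 * (\<Sum>i\<in>UNIV. \<Sum>j\<in>UNIV. LINT x|lborel. ?g i j x * ?d i j x)"
    by (simp only: sum_distrib_left)
  \<comment> \<open>The products are reached through heads, for which the advection form is the same
    constant as soon as \<open>N\<close> exceeds \<open>Q\<close>.\<close>
  also have "(\<Sum>i\<in>UNIV. \<Sum>j\<in>UNIV. LINT x|lborel. ?g i j x * ?d i j x) = flux_const"
  proof (rule LIMSEQ_unique)
    have "(\<lambda>N. LINT x|lborel. head N i x * head N j x * ?d i j x) \<longlonglongrightarrow> (LINT x|lborel. ?g i j x * ?d i j x)" for i j
    proof -
      note h = partial_deriv_inv_fourier_test[OF test_fun_head_symbol, of i Q j]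
      have dd: "?d i j = inv_fourier (\<lambda>\<xi>. \<i> * \<xi> $ i * head_symbol Q j \<xi>)" unfolding head_def by (rule h(1))
      show ?thesis
        unfolding dd
        by (rule head_product_integral_tendsto[OF inv_fourier_measurable[OF test_fun_integrable[OF h(2)]] norm_inv_fourier_le])
    qed
    then show "(\<lambda>N. advection (head N) (head N) (head Q)) \<longlonglongrightarrow> (\<Sum>i\<in>UNIV. \<Sum>j\<in>UNIV. LINT x|lborel. ?g i j x * ?d i j x)"
      unfolding advection_def by (intro tendsto_sum)
    show "(\<lambda>N. advection (head N) (head N) (head Q)) \<longlonglongrightarrow> flux_const"
      by (rule tendsto_eventually) (rule eventually_sequentiallyI[of "Suc Q"], rule advection_head)
  qed
  finally show ?thesis unfolding energy_flux_def D by simp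
qed

text \<open>The block symbol is a difference of two cutoffs: one keeps the levels up to
  \<open>n\<close>, the other those below \<open>n\<close>.\<close>

lemma lp_block_velocity:
  "represents (\<lambda>x. inversion_const chi * level n j x) (lp_block chi (int n) (comp_distr velocity j))"
proof -
  have "lp_symbol chi (int n) \<xi> * head_symbol N j \<xi> = level_symbol n j \<xi>" if "Suc n \<le> N" for N \<xi>
  proof -
    have "lp_symbol chi (int n) \<xi> = chi (\<xi> /\<^sub>R 2 ^ Suc n) - chi (\<xi> /\<^sub>R 2 ^ n)"
      by (simp add: lp_symbol_def lp_phi_def lp_freq_def mult.commute)
    moreover have "chi (\<xi> /\<^sub>R 2 ^ n) * head_symbol N j \<xi> = (\<Sum>a<n. level_symbol a j \<xi>)"
    proof -
      have "chi (\<xi> /\<^sub>R 2 ^ n) * head_symbol N j \<xi> = (\<Sum>a\<le>N. if a < n then level_symbol a j \<xi> else 0)"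
        unfolding head_symbol_def sum_distrib_left chi_level ..
      also have "\<dots> = (\<Sum>a\<in>{..N} \<inter> {a. a < n}. level_symbol a j \<xi>)"
        by (simp add: sum.inter_restrict)
      also have "{..N} \<inter> {a. a < n} = {..<n}" using that by auto
      finally show ?thesis .
    qed
    moreover have "head_symbol n j \<xi> = (\<Sum>a<n. level_symbol a j \<xi>) + level_symbol n j \<xi>"
      unfolding head_symbol_def lessThan_Suc_atMost[symmetric] by simp
    ultimately show ?thesis
      using chi_head[where Q = n and N = N and \<xi> = \<xi> and j = j] that by (simp add: left_diff_distrib)
  qed
  then have "(\<lambda>\<xi>. lp_symbol chi (int n) \<xi> * fourier (velocity_complex j) \<xi>) = (\<lambda>\<xi>. inversion_const chi * level_symbol n j \<xi>)"
    by (intro ext multiplier_velocity[of "Suc n"])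
  then have "inv_fourier (\<lambda>\<xi>. lp_symbol chi (int n) \<xi> * fourier (velocity_complex j) \<xi>) = (\<lambda>x. inversion_const chi * level n j x)"
    unfolding level_def by (auto simp: inv_fourier_cmult)
  then show ?thesis
    using represents_multiplier[OF integrable_velocity lp_symbol_test_fun[OF chi], of "int n" j]
    by (simp add: lp_block_def comp_distr_def)
qed

text \<open>Even level 0 has its frequencies beyond radius \<open>r\<close>, where
  \<open>chi\<close> vanishes.\<close>

lemma lp_block_low_velocity: "represents (\<lambda>x. 0) (lp_block chi (-1) (comp_distr velocity j))"
proof -
  have "chi \<xi> * head_symbol N j \<xi> = 0" for N \<xi>
    unfolding head_symbol_def sum_distrib_left
    by (rule sum.neutral) (use chi_level[where q = 0 and \<xi> = \<xi>] in simp)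
  then have "lp_symbol chi (-1) \<xi> * fourier (velocity_complex j) \<xi> = inversion_const chi * 0" for \<xi>
    by (intro multiplier_velocity[of 0]) (simp add: lp_symbol_def)
  then have "(\<lambda>\<xi>. lp_symbol chi (-1) \<xi> * fourier (velocity_complex j) \<xi>) = (\<lambda>\<xi>. 0)"
    by (simp only: mult_zero_right)
  moreover have "inv_fourier (\<lambda>\<xi>. 0) = (\<lambda>x. 0)"
    by (simp add: inv_fourier_def fun_eq_iff)
  ultimately have "inv_fourier (\<lambda>\<xi>. lp_symbol chi (-1) \<xi> * fourier (velocity_complex j) \<xi>) = (\<lambda>x. 0)"
    by (simp only:)
  then show ?thesis
    using represents_multiplier[OF integrable_velocity lp_symbol_test_fun[OF chi], of "-1" j]
    by (simp add: lp_block_def comp_distr_def)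
qed

section \<open>Besov bound and conclusion\<close>

lemma
  shows level_in_L3: "in_Lp 3 (\<lambda>x. c * level n j x)"
    and level_L3_norm: "2 ^ n * (LINT x|lborel. norm (c * level n j x) powr 3) \<le> norm c ^ 3 * (LINT x|lborel. magnitude 0 x ^ 3)"
proof -
  have p3: "norm (c * level n j x) powr 3 = norm c ^ 3 * norm (level n j x) ^ 3" for x
    by (simp add: norm_mult power_mult_distrib)
  note m3 = integrable_magnitude_power[of n 2] integral_magnitude_power[of n 2]
  have le: "norm (level n j x) ^ 3 \<le> magnitude n x ^ Suc 2" for x
    using norm_level_le[of n j x] by (simp add: power_mono)
  have int: "integrable lborel (\<lambda>x. norm (level n j x) ^ 3)"
    by (rule Bochner_Integration.integrable_bound[OF m3(1)]) (use le magnitude_nonneg in auto)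
  show "in_Lp 3 (\<lambda>x. c * level n j x)"
    unfolding in_Lp_def p3 using int by auto
  have "(LINT x|lborel. norm (level n j x) ^ 3) \<le> (LINT x|lborel. magnitude n x ^ Suc 2)"
    by (rule integral_mono[OF int m3(1) le])
  also have "\<dots> = (1 / 2) ^ n * (LINT x|lborel. magnitude 0 x ^ 3)"
    unfolding m3(2) using tau_cubed by simp
  finally have "2 ^ n * (LINT x|lborel. norm (level n j x) ^ 3) \<le> (LINT x|lborel. magnitude 0 x ^ 3)"
    by (simp add: power_divide field_simps)
  then have "norm c ^ 3 * (2 ^ n * (LINT x|lborel. norm (level n j x) ^ 3)) \<le> norm c ^ 3 * (LINT x|lborel. magnitude 0 x ^ 3)"
    by (intro mult_left_mono) auto
  then show "2 ^ n * (LINT x|lborel. norm (c * level n j x) powr 3) \<le> norm c ^ 3 * (LINT x|lborel. magnitude 0 x ^ 3)"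
    unfolding p3 integral_mult_right_zero by (simp only: mult.left_commute)
qed

text \<open>Each block is a multiple of one level. Under the cube root, the weight
  \<open>2^q\<close> cancels the halving of the cubed \<open>L^3\<close> norm per level, so all
  blocks obey one bound.\<close>

lemma velocity_besov: "comp_distr velocity j \<in> besov chi (1/3) 3"
proof -
  let ?T = "comp_distr velocity j"
  let ?\<kappa> = "inversion_const chi"
  define K where "K = norm ?\<kappa> ^ 3 * (LINT x|lborel. magnitude 0 x ^ 3)"
  have "distr_Lp_norm 3 (lp_block chi (-1) ?T) \<le> ennreal (Lp_norm 3 (\<lambda>x::real^3. 0::complex))"
    unfolding distr_Lp_norm_def using lp_block_low_velocity[of j] by (intro INF_lower) (simp add: in_Lp_def)
  also have "\<dots> = 0" by (simp add: Lp_norm_def)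
  finally have low: "distr_Lp_norm 3 (lp_block chi (-1) ?T) = 0" by simp
  have high: "ennreal (lp_freq q powr (1/3)) * distr_Lp_norm 3 (lp_block chi q ?T) \<le> ennreal (K powr (1/3))"
    if "q \<in> {0..}" for q
  proof -
    define n where "n = nat q"
    have q: "q = int n" using that by (simp add: n_def)
    let ?v = "\<lambda>x. ?\<kappa> * level n j x"
    let ?I = "LINT x|lborel. norm (?v x) powr 3"
    have I: "0 \<le> ?I" by simp
    have "distr_Lp_norm 3 (lp_block chi q ?T) \<le> ennreal (Lp_norm 3 ?v)"
      unfolding distr_Lp_norm_def using lp_block_velocity[of n j] level_in_L3[of ?\<kappa> n j]
      by (intro INF_lower) (simp add: q)
    then have "ennreal (lp_freq q powr (1/3)) * distr_Lp_norm 3 (lp_block chi q ?T)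
        \<le> ennreal (lp_freq q powr (1/3)) * ennreal (Lp_norm 3 ?v)"
      by (rule mult_left_mono) simp
    also have "\<dots> = ennreal (lp_freq q powr (1/3) * ?I powr (1/3))"
      by (simp add: Lp_norm_def ennreal_mult)
    also have "lp_freq q powr (1/3) * ?I powr (1/3) = (2 ^ n * ?I) powr (1/3)"
      using I by (subst powr_mult) (simp_all add: q lp_freq_def)
    also have "ennreal \<dots> \<le> ennreal (K powr (1/3))"
      unfolding K_def using level_L3_norm[of n ?\<kappa> j] I by (intro ennreal_leI powr_mono2) auto
    finally show ?thesis .
  qed
  have "besov_norm chi (1/3) 3 ?T \<le> ennreal (K powr (1/3))"
    unfolding besov_norm_def low using high by (simp add: SUP_le_iff)
  also have "\<dots> < \<infinity>" by simp
  finally have "besov_norm chi (1/3) 3 ?T < \<infinity>" .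
  moreover have "tempered ?T" unfolding comp_distr_def by (rule tempered_distr_of[OF integrable_velocity])
  ultimately show ?thesis by (simp add: besov_def)
qed

lemma velocity_flux_liminf: "liminf (\<lambda>Q::nat. ereal (energy_flux chi velocity (int Q))) > 0"
proof -
  obtain k where k: "k > 0" "inversion_const chi = complex_of_real k" by (rule inversion_const_pos[OF chi])
  obtain c where c: "c > 0" "flux_const = complex_of_real c" by (rule flux_const_pos)
  have "energy_flux chi velocity (int Q) = k\<^sup>2 * c" for Q
    unfolding energy_flux_velocity k c by (simp flip: of_real_power of_real_mult)
  then show ?thesis using k c by (simp add: Liminf_const)
qed

end

theorem mainTheorem4:
  fixes chi :: "real^3 \<Rightarrow> real"
  assumes "lp_cutoff chi"
  shows "\<exists>u :: real^3 \<Rightarrow> real^3.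
    in_Lp 2 u \<and> divergence_free u \<and>
    (\<forall>i. comp_distr u i \<in> besov chi (1/3) 3) \<and>
    liminf (\<lambda>Q::nat. ereal (energy_flux chi u (int Q))) > 0"
proof -
  obtain r where r: "1/2 < r" "r < 1" "\<And>\<xi>. r \<le> norm \<xi> \<Longrightarrow> chi \<xi> = 0"
    by (rule cutoff_radius[OF assms]) blast
  interpret flux_modes chi r
    by unfold_locales (use assms r in auto)
  show ?thesis
    using velocity_in_L2 velocity_divergence_free velocity_besov velocity_flux_liminf by blast
qed

end
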